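(* Let $N,k$ be integers with $1\le k\le N$, and write points of $\mathbb{R}^N$ as $x=(y,z)\in\mathbb{R}^k\times\mathbb{R}^{N-k}$. Let $1<p<N$, $0\le\beta<k$, $\beta\le p$, and set $q=\frac{p(N-\beta)}{N-p}$. Define $$S=\inf\left\{\int_{\mathbb{R}^N}|\nabla u|^p\,dx \ :\ u\in D^{1,p}(\mathbb{R}^N),\ \int_{\mathbb{R}^N}\frac{|u(x)|^q}{|y|^\beta}\,dx=1\right\}$$ and $$S^{\star\star}=\inf\left\{\int_{\mathbb{R}^N}|\nabla u|^p\,dx \ :\ u\in D^{1,p}_{\star\star}(\mathbb{R}^N),\ \int_{\mathbb{R}^N}\frac{|u(x)|^q}{|y|^\beta}\,dx=1\right\}.$$ Then $S=S^{\star\star}$.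
   Context: $\mathcal{D}(\mathbb{R}^N)$ is the space of $C^\infty$ functions on $\mathbb{R}^N$ with compact support. $D^{1,p}(\mathbb{R}^N)$ is the closure (completion) of $\mathcal{D}(\mathbb{R}^N)$ with respect to the norm $\|u\|_{D^{1,p}}=\left(\int_{\mathbb{R}^N}|\nabla u|^p\,dx\right)^{1/p}$; for $1<p<N$ it is identified, via the Sobolev inequality, with a space of functions in $L^{Np/(N-p)}(\mathbb{R}^N)$ with weak gradient in $L^p$. Integrals are with respect to Lebesgue measure. Schwarz symmetrization: for a non-negative measurable function $f$ on $\mathbb{R}^m$ whose superlevel sets $\{f>t\}$, $t>0$, have finite measure, its Schwarz symmetrization is the radially symmetric, radially non-increasing function on $\mathbb{R}^m$ whose superlevel set at each level $t>0$ is the open ball centered at $0$ with the same Lebesgue measure as $\{f>t\}$. Product of two symmetrizations: for a non-negative function $u$ on $\mathbb{R}^N=\mathbb{R}^k\times\mathbb{R}^{N-k}$ (integrable, or more generally with all superlevel sets $\{u>t\}$, $t>0$, of finite measure), $u^\star(\cdot,z)$ denotes the Schwarz symmetrization on $\mathbb{R}^k$ of $u(\cdot,z)$ (for a.e. $z$), and $u^{\star\star}(y,\cdot)$ denotes the Schwarz symmetrization on $\mathbb{R}^{N-k}$ of $u^\star(y,\cdot)$. Thus $u^{\star\star}$ depends only on $(|y|,|z|)$. When $k=N$ the variable $z$ is absent and $u^{\star\star}=u^\star$. $D^{1,p}_{\star\star}(\mathbb{R}^N)=\{u\in D^{1,p}(\mathbb{R}^N): u=u^{\star\star}\}$, where membership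 includes that $u$ is non-negative, and equality is almost everywhere. *)

theory Defs
  imports "HOL-Analysis.Analysis"
begin

section \<open>Test functions\<close>

definition partial :: "'n::finite \<Rightarrow> (real^'n \<Rightarrow> real) \<Rightarrow> real^'n \<Rightarrow> real" where
  "partial i f x = frechet_derivative f (at x) (axis i 1)"

definition gradient :: "(real^'n::finite \<Rightarrow> real) \<Rightarrow> real^'n \<Rightarrow> real^'n" where
  "gradient f x = (\<chi> i. partial i f x)"

primrec C_diff :: "nat \<Rightarrow> (real^'n::finite \<Rightarrow> real) \<Rightarrow> bool" where
  "C_diff 0 f \<longleftrightarrow> continuous_on UNIV f"
| "C_diff (Suc m) f \<longleftrightarrow> (\<forall>x. f differentiable (at x)) \<and> (\<forall>i. C_diff m (partial i f))"

definition test_functions :: "(real^'n::finite \<Rightarrow> real) set" where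
  "test_functions = {\<phi>. (\<forall>m. C_diff m \<phi>) \<and> compact (closure {x. \<phi> x \<noteq> 0})}"


section \<open>Weak gradients and the space D1p\<close>

definition has_weak_gradient ::
    "(real^'n::finite \<Rightarrow> real) \<Rightarrow> (real^'n \<Rightarrow> real^'n) \<Rightarrow> bool" where
  "has_weak_gradient u G \<longleftrightarrow>
     u \<in> borel_measurable borel \<and> G \<in> borel_measurable borel \<and>
     (\<forall>C. compact C \<longrightarrow> set_integrable lborel C u \<and> set_integrable lborel C G) \<and>
     (\<forall>\<phi>\<in>test_functions. \<forall>i.
        (\<integral>x. u x * partial i \<phi> x \<partial>lborel) = - (\<integral>x. G x $ i * \<phi> x \<partial>lborel))"

text \<open>The weak gradient is unique up to null sets, so the choice below does not affect
  integrals. It is only meaningful if some weak gradient exists, i.e. if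
  \<open>has_weak_gradient u (weak_gradient u)\<close>.\<close>

definition weak_gradient :: "(real^'n::finite \<Rightarrow> real) \<Rightarrow> real^'n \<Rightarrow> real^'n" where
  "weak_gradient u = (SOME G. has_weak_gradient u G)"

text \<open>For \<open>1 < p < N\<close>: the closure of the test functions, in the norm
  \<open>(\<integral> |\<nabla>u|\<^sup>p)\<^sup>1\<^sup>/\<^sup>p\<close>, inside the functions of \<open>L\<^sup>p\<^sup>*\<close>, \<open>p\<^sup>* = Np/(N - p)\<close>, with weak gradient
  in \<open>L\<^sup>p\<close>. Elements are Borel representatives of the almost-everywhere classes.\<close>

definition D1p :: "real \<Rightarrow> (real^'n::finite \<Rightarrow> real) set" where
  "D1p p = {u. u \<in> borel_measurable borel \<and>
     (\<integral>\<^sup>+x. ennreal (\<bar>u x\<bar> powr (real CARD('n) * p / (real CARD('n) - p))) \<partial>lborel) < \<infinity> \<and>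
     has_weak_gradient u (weak_gradient u) \<and>
     (\<integral>\<^sup>+x. ennreal (norm (weak_gradient u x) powr p) \<partial>lborel) < \<infinity> \<and>
     (\<exists>\<phi>. (\<forall>j. \<phi> j \<in> test_functions) \<and>
          (\<lambda>j. \<integral>\<^sup>+x. ennreal (norm (gradient (\<phi> j) x - weak_gradient u x) powr p) \<partial>lborel)
            \<longlonglongrightarrow> 0)}"


section \<open>Schwarz symmetrization\<close>

text \<open>\<open>\<real>\<^sup>m\<close> is represented as the extensional functions on an index set \<open>I\<close> with \<open>m\<close> elements,
  carrying the product measure. This allows \<open>I = {}\<close>: then \<open>\<real>\<^sup>0\<close> is one point of mass 1, the
  only open balls are the empty set and the whole space, and symmetrization is the identity.\<close>

abbreviation leb_on :: "'i set \<Rightarrow> ('i \<Rightarrow> real) measure" where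
  "leb_on I \<equiv> Pi\<^sub>M I (\<lambda>_. lborel)"

definition ball0 :: "'i set \<Rightarrow> real \<Rightarrow> ('i \<Rightarrow> real) set" where
  "ball0 I r = {y \<in> space (leb_on I). L2_set y I < r}"

text \<open>The open ball around 0 with the same measure as \<open>A\<close>. It is written as a union over all
  such balls, which are all equal when \<open>A\<close> has finite measure.\<close>

definition sym_set :: "'i set \<Rightarrow> ('i \<Rightarrow> real) set \<Rightarrow> ('i \<Rightarrow> real) set" where
  "sym_set I A = \<Union> {B. (\<exists>r. B = ball0 I r) \<and> emeasure (leb_on I) B = emeasure (leb_on I) A}"

text \<open>The function whose superlevel sets are the symmetrized superlevel sets of \<open>f\<close>. The values
  are extended reals because the symmetrization of an unbounded function may be infinite at 0.\<close>

definition schwarz :: "'i set \<Rightarrow> (('i \<Rightarrow> real) \<Rightarrow> ennreal) \<Rightarrow> ('i \<Rightarrow> real) \<Rightarrow> ennreal" where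
  "schwarz I f y = Sup {t. 0 < t \<and> y \<in> sym_set I {y' \<in> space (leb_on I). t < f y'}}"

text \<open>Schwarz symmetrization in the coordinates \<open>I\<close>, the other coordinates being frozen.\<close>

definition schwarz_in ::
    "'n::finite set \<Rightarrow> (real^'n \<Rightarrow> ennreal) \<Rightarrow> real^'n \<Rightarrow> ennreal" where
  "schwarz_in I u x =
     schwarz I (\<lambda>y. u (\<chi> i. if i \<in> I then y i else x $ i)) (\<lambda>i\<in>I. x $ i)"

text \<open>With \<open>x = (y, z)\<close>, where \<open>y\<close> collects the coordinates in \<open>K\<close> and \<open>z\<close> the remaining ones:
  first symmetrize in \<open>y\<close>, then in \<open>z\<close>.\<close>

definition double_star ::
    "'n::finite set \<Rightarrow> (real^'n \<Rightarrow> ennreal) \<Rightarrow> real^'n \<Rightarrow> ennreal" where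
  "double_star K u = schwarz_in (- K) (schwarz_in K u)"

definition D1p_star_star :: "'n::finite set \<Rightarrow> real \<Rightarrow> (real^'n \<Rightarrow> real) set" where
  "D1p_star_star K p = {u \<in> D1p p. (AE x in lborel. 0 \<le> u x) \<and>
     (AE x in lborel. ennreal (u x) = double_star K (\<lambda>x. ennreal (u x)) x)}"


section \<open>The minimization problems\<close>

definition dirichlet_energy :: "real \<Rightarrow> (real^'n::finite \<Rightarrow> real) \<Rightarrow> ennreal" where
  "dirichlet_energy p u = (\<integral>\<^sup>+x. ennreal (norm (weak_gradient u x) powr p) \<partial>lborel)"

text \<open>\<open>L2_set (($) x) K\<close> is the Euclidean norm \<open>|y|\<close>. On the null set \<open>y = 0\<close> the integrand
  evaluates to 0 (also for \<open>\<beta> = 0\<close>, since \<open>0 powr 0 = 0\<close>), which is harmless.\<close>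

definition weighted_integral ::
    "'n::finite set \<Rightarrow> real \<Rightarrow> real \<Rightarrow> (real^'n \<Rightarrow> real) \<Rightarrow> ennreal" where
  "weighted_integral K \<beta> q u =
     (\<integral>\<^sup>+x. ennreal (\<bar>u x\<bar> powr q / (L2_set (($) x) K) powr \<beta>) \<partial>lborel)"

end

theory Submission
  imports Defs "HOL-Complex_Analysis.Great_Picard"
begin

text \<open>The infimum over symmetric functions is the larger one, because fewer functions compete. For the
  other inequality, every admissible \<open>u\<close> and every small \<open>e > 0\<close> require a symmetric admissible \<open>v\<close>
  with almost the same energy (\<open>symmetric_near_optimal\<close>). It is found in four steps.

  \<^item> \<open>u\<close> is replaced by a test function \<open>\<phi>\<close>, by cut-off and mollification (\<open>test_approximation\<close>). The
    energy increases by at most \<open>e\<close>, because \<open>u\<close> is in \<open>L\<^sup>p\<^sup>*\<close>, and by Fatou's lemma the weighted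
    integral decreases by at most \<open>e\<close>. From here on all functions are Lipschitz with bounded support,
    and since \<open>\<beta> < k\<close> their weighted integrals are finite.

  \<^item> The energy is tested with differences instead of gradients. For \<open>t > 0\<close> let \<open>E\<^sub>t(w)\<close> be the
    integral of \<open>\<bar>w(x) - w(y)\<bar>\<^sup>p\<close> over all pairs with \<open>\<bar>x - y\<bar> < t\<close>. Polarization, which reflects in
    a hyperplane and puts the larger of the two values on the side of the origin, does not
    increase any \<open>E\<^sub>t\<close>: for four points this is a convexity inequality, and the general case is its
    integral (\<open>nonlocal_energy_polarize\<close>). If the reflection moves only \<open>y\<close> or only \<open>z\<close>, polarization
    does not decrease the weighted integral either, as the weight is a decreasing function of \<open>\<bar>y\<bar>\<close>
    (\<open>weighted_integral_polarize\<close>).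

  \<^item> Consider all non-negative Lipschitz functions, with a fixed Lipschitz constant and support in a
    fixed ball, that have no larger \<open>E\<^sub>t\<close>, for all \<open>t\<close>, and no smaller weighted integral than \<open>\<phi>\<close>. The
    second moment \<open>\<integral>\<bar>x\<bar>\<^sup>2w(x)dx\<close> attains its minimum on this class by the theorem of Arzela and
    Ascoli. Polarization stays in the class and decreases the second moment strictly unless it fixes
    the function. Hence a minimizer \<open>w\<close> is fixed by all these polarizations, which says that it is
    non-increasing in \<open>\<bar>y\<bar>\<close> for each \<open>z\<close> and non-increasing in \<open>\<bar>z\<bar>\<close> for each \<open>y\<close>
    (\<open>symmetric_competitor_exists\<close>). Such a function is its own double
    symmetrization (\<open>schwarz_in_eq_self\<close>). The function \<open>w\<close> plays the part of the double
    symmetrization of \<open>\<bar>\<phi>\<bar>\<close>, although it may be a different function.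

  \<^item> It remains to return from differences to gradients. For a test function, \<open>E\<^sub>t\<close> divided by
    \<open>t\<^sup>N\<^sup>+\<^sup>p\<close> tends to a constant multiple of \<open>\<integral>\<bar>\<nabla>\<phi>\<bar>\<^sup>p\<close> as \<open>t \<rightarrow> 0\<close> (\<open>quotient_energy_tendsto_gradient\<close>).
    Mollification does not increase \<open>E\<^sub>t\<close> by Jensen's inequality, so every mollification of \<open>w\<close> has
    at most the energy of \<open>\<phi>\<close> (\<open>mollified_gradient_energy_le\<close>). By the parallelogram
    law there are test functions with this energy bound that tend to \<open>w\<close> and whose gradients
    converge strongly; hence \<open>w\<close> belongs to \<open>D1p\<close>, and its energy is at most that of \<open>\<phi>\<close> (\<open>Lipschitz_in_D1p\<close>).

  Finally \<open>w\<close> is multiplied by the constant that makes its weighted integral 1. This constant is at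
  most \<open>(1 - e)\<^sup>-\<^sup>1\<^sup>/\<^sup>q\<close>, which tends to 1 with \<open>e \<rightarrow> 0\<close>.\<close>

section \<open>Smooth functions\<close>

lemma has_derivative_gradient:
  assumes "f differentiable (at x)"
  shows "(f has_derivative (\<lambda>h. gradient f x \<bullet> h)) (at x)"
proof -
  have D: "(f has_derivative frechet_derivative f (at x)) (at x)"
    using assms by (simp add: frechet_derivative_works)
  then have lin: "linear (frechet_derivative f (at x))"
    by (rule has_derivative_linear)
  have "frechet_derivative f (at x) h = gradient f x \<bullet> h" for h
  proof -
    have "frechet_derivative f (at x) h = frechet_derivative f (at x) (\<Sum>i\<in>UNIV. h $ i *\<^sub>R axis i 1)"
      by (simp add: basis_expansion flip: scalar_mult_eq_scaleR)
    also have "\<dots> = (\<Sum>i\<in>UNIV. h $ i * frechet_derivative f (at x) (axis i 1))"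
      by (simp add: linear_sum[OF lin] linear_scale[OF lin])
    finally show ?thesis
      by (simp add: gradient_def partial_def inner_vec_def mult.commute)
  qed
  then show ?thesis using D by (metis (no_types, lifting) ext)
qed

lemma partial_eqI:
  assumes "(f has_derivative f') (at x)"
  shows "partial i f x = f' (axis i 1)"
  unfolding partial_def frechet_derivative_at[OF assms, symmetric] ..

lemma C_diff_Suc_imp: "C_diff (Suc m) f \<Longrightarrow> C_diff m f"
proof (induction m arbitrary: f)
  case 0
  then show ?case
    by (auto intro!: continuous_at_imp_continuous_on differentiable_imp_continuous_within)
next
  case (Suc m)
  then show ?case by (metis C_diff.simps(2))
qed

lemma C_diff_const: "C_diff m (\<lambda>x. c)"
proof (induction m arbitrary: c)
  case (Suc m)
  have "partial i (\<lambda>x. c) = (\<lambda>x. 0)" for i :: 'a by (simp add: partial_def fun_eq_iff)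
  with Suc show ?case by simp
qed simp

lemma partial_add:
  assumes "f differentiable (at x)" "g differentiable (at x)"
  shows "partial i (\<lambda>x. f x + g x) x = partial i f x + partial i g x"
  using partial_eqI[OF has_derivative_add[OF has_derivative_gradient has_derivative_gradient], OF assms]
  by (simp add: partial_eqI[OF has_derivative_gradient] assms)

lemma partial_mult:
  assumes "f differentiable (at x)" "g differentiable (at x)"
  shows "partial i (\<lambda>x. f x * g x) x = f x * partial i g x + partial i f x * g x"
  using partial_eqI[OF has_derivative_mult[OF has_derivative_gradient has_derivative_gradient], OF assms]
  by (simp add: partial_eqI[OF has_derivative_gradient] assms)

lemma C_diff_add: "C_diff m f \<Longrightarrow> C_diff m g \<Longrightarrow> C_diff m (\<lambda>x. f x + g x)"
proof (induction m arbitrary: f g)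
  case 0
  then show ?case by (auto intro: continuous_intros)
next
  case (Suc m)
  then have "partial i (\<lambda>x. f x + g x) = (\<lambda>x. partial i f x + partial i g x)" for i
    by (simp add: fun_eq_iff partial_add)
  with Suc show ?case by auto
qed

lemma C_diff_mult: "C_diff m f \<Longrightarrow> C_diff m g \<Longrightarrow> C_diff m (\<lambda>x. f x * g x)"
proof (induction m arbitrary: f g)
  case 0
  then show ?case by (auto intro: continuous_intros)
next
  case (Suc m)
  then have "partial i (\<lambda>x. f x * g x) = (\<lambda>x. f x * partial i g x + partial i f x * g x)" for i
    by (simp add: fun_eq_iff partial_mult)
  moreover have "C_diff m f" "C_diff m g" using Suc.prems C_diff_Suc_imp by blast+
  ultimately show ?case using Suc by (auto intro!: C_diff_add)
qed

lemma C_diff_reflect: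
  fixes f :: "real^'n::finite \<Rightarrow> real"
  shows "C_diff m f \<Longrightarrow> C_diff m (\<lambda>y. f (x - y))"
proof (induction m arbitrary: f)
  case 0
  then show ?case
    by (auto intro!: continuous_on_compose2[of UNIV f] continuous_intros)
next
  case (Suc m)
  have D: "((\<lambda>y. f (x - y)) has_derivative (\<lambda>h. gradient f (x - y) \<bullet> (- h))) (at y)" for y
    by (rule has_derivative_compose[of "\<lambda>y. x - y" _ _ _ f])
      (use Suc.prems in \<open>auto intro!: derivative_eq_intros has_derivative_gradient\<close>)
  have "partial i (\<lambda>y. f (x - y)) = (\<lambda>y. (- 1) * partial i f (x - y))" for i :: 'n
    using partial_eqI[OF D, where i=i]
    by (simp add: fun_eq_iff gradient_def inner_axis)
  moreover have "C_diff m (\<lambda>y. (- 1) * partial i f (x - y))" for i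
    using Suc by (intro C_diff_mult C_diff_const Suc.IH) auto
  moreover have "(\<lambda>y. f (x - y)) differentiable (at y)" for y
    using D by (auto simp: differentiable_def)
  ultimately show ?case by simp
qed

text \<open>The derivatives of the smooth function that is \<open>exp(-1/s)\<close> for \<open>s > 0\<close> and 0 otherwise are linear
  combinations of these functions.\<close>

definition flat_exp :: "nat \<Rightarrow> real \<Rightarrow> real" where
  "flat_exp n s = (if 0 < s then exp (- (1 / s)) / s ^ n else 0)"

lemma flat_exp_bound: "\<bar>flat_exp n s\<bar> \<le> real (n + 2) ^ (n + 2) * s ^ 2"
proof (cases "0 < s")
  case True
  let ?m = "n + 2"
  have "(1 / (s * real ?m)) ^ ?m \<le> (1 + (1/s) / real ?m) ^ ?m"
    using True by (intro power_mono) (auto simp: divide_simps)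
  also have "\<dots> \<le> exp (1 / s)"
    by (rule exp_ge_one_plus_x_over_n_power_n) (use True in \<open>auto intro: order_trans[of _ 0]\<close>)
  finally have "(1 / (s * real ?m)) ^ ?m * (s * real ?m) ^ ?m \<le> exp (1 / s) * (s * real ?m) ^ ?m"
    using True by (intro mult_right_mono) auto
  then have "(1 / (s * real ?m) * (s * real ?m)) ^ ?m \<le> exp (1 / s) * (s * real ?m) ^ ?m"
    by (simp only: power_mult_distrib)
  moreover have "1 / (s * real ?m) * (s * real ?m) = 1" using True by simp
  moreover have "(s * real ?m) ^ ?m = s ^ n * (real ?m ^ ?m * s ^ 2)"
    by (subst power_mult_distrib) (simp only: power_add mult_ac)
  ultimately have "1 \<le> exp (1 / s) * (s ^ n * (real ?m ^ ?m * s ^ 2))" by (simp only: power_one)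
  moreover have "inverse (e * t) \<le> u" if "1 \<le> e * (t * u)" "0 < e" "0 < t" for e t u :: real
    using that by (simp add: field_simps)
  ultimately have "inverse (exp (1 / s) * s ^ n) \<le> real ?m ^ ?m * s ^ 2"
    using True by (meson exp_gt_zero zero_less_power)
  moreover have "\<bar>flat_exp n s\<bar> = inverse (exp (1 / s) * s ^ n)"
    using True by (simp add: flat_exp_def exp_minus divide_inverse)
  ultimately show ?thesis by simp
qed (simp add: flat_exp_def)

text \<open>Only \<open>s = 0\<close> needs an argument: there \<open>flat_exp_bound\<close> shows that the difference quotient is of
  order \<open>h\<close>.\<close>

lemma DERIV_flat_exp:
  "(flat_exp n has_real_derivative (flat_exp (n + 2) s - n * flat_exp (n + 1) s)) (at s)"
proof -
  consider "0 < s" | "s < 0" | "s = 0" by linarith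
  then show ?thesis
  proof cases
    case 1
    have "((\<lambda>s. exp (- (1 / s)) / s ^ n) has_real_derivative
        (exp (- (1 / s)) * (1 / s ^ 2) * s ^ n - exp (- (1 / s)) * (n * s ^ (n - 1))) / (s ^ n * s ^ n)) (at s)"
      using 1 by (auto intro!: derivative_eq_intros simp: power2_eq_square)
    moreover have "(exp (- (1 / s)) * (1 / s ^ 2) * s ^ n - exp (- (1 / s)) * (n * s ^ (n - 1))) / (s ^ n * s ^ n)
        = flat_exp (n + 2) s - n * flat_exp (n + 1) s"
      using 1 by (cases n) (auto simp: flat_exp_def field_simps power2_eq_square)
    ultimately have "((\<lambda>s. exp (- (1 / s)) / s ^ n) has_real_derivative
        (flat_exp (n + 2) s - n * flat_exp (n + 1) s)) (at s)" by simp
    then show ?thesis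
      by (rule has_field_derivative_transform_within_open[of _ _ _ "{0<..}"])
        (use 1 in \<open>auto simp: flat_exp_def\<close>)
  next
    case 2
    have "((\<lambda>s. 0) has_real_derivative 0) (at s)" by simp
    then have "(flat_exp n has_real_derivative 0) (at s)"
      by (rule has_field_derivative_transform_within_open[of _ _ _ "{..<0}"])
        (use 2 in \<open>auto simp: flat_exp_def\<close>)
    then show ?thesis using 2 by (simp add: flat_exp_def)
  next
    case 3
    let ?C = "real (n + 2) ^ (n + 2)"
    have "((\<lambda>h. flat_exp n h / h) \<longlongrightarrow> 0) (at 0)"
    proof (rule Lim_null_comparison)
      show "\<forall>\<^sub>F h in at 0. norm (flat_exp n h / h) \<le> ?C * \<bar>h\<bar>"
      proof (intro always_eventually allI)
        fix h
        have "\<bar>flat_exp n h\<bar> \<le> (?C * \<bar>h\<bar>) * \<bar>h\<bar>"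
          using flat_exp_bound[of n h] by (simp add: power2_eq_square mult.assoc)
        then show "norm (flat_exp n h / h) \<le> ?C * \<bar>h\<bar>"
          by (cases "h = 0") (simp_all add: abs_divide pos_divide_le_eq)
      qed
      show "((\<lambda>h. ?C * \<bar>h\<bar>) \<longlongrightarrow> 0) (at 0)" by (auto intro!: tendsto_eq_intros)
    qed
    then show ?thesis using 3 by (simp add: flat_exp_def DERIV_def)
  qed
qed

text \<open>Partial derivatives of such a function are sums of products of functions of the same kind with
  coordinates, which makes the induction on the order of differentiability work.\<close>

lemma C_diff_flat_exp_norm: "C_diff m (\<lambda>x::real^'n::finite. flat_exp n (c - x \<bullet> x))"
proof (induction m arbitrary: n)
  case 0
  have "continuous_on UNIV (flat_exp n)"
    by (intro continuous_at_imp_continuous_on ballI DERIV_isCont[OF DERIV_flat_exp])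
  then have "continuous_on UNIV (\<lambda>x::real^'n. flat_exp n (c - x \<bullet> x))"
    by (rule continuous_on_compose2) (auto intro!: continuous_intros)
  then show ?case by simp
next
  case (Suc m)
  let ?d = "\<lambda>s. flat_exp (n + 2) s + (- real n) * flat_exp (n + 1) s"
  have D: "((\<lambda>x::real^'n. flat_exp n (c - x \<bullet> x)) has_derivative
      (\<lambda>h. ?d (c - x \<bullet> x) * (- (x \<bullet> h + h \<bullet> x)))) (at x)" for x
    by (rule has_derivative_compose[of "\<lambda>x. c - x \<bullet> x" _ _ _ "flat_exp n"])
      (use DERIV_flat_exp[of n "c - x \<bullet> x"] in
        \<open>auto intro!: derivative_eq_intros simp: has_field_derivative_def mult_commute_abs\<close>)
  have "partial i (\<lambda>x::real^'n. flat_exp n (c - x \<bullet> x))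
      = (\<lambda>x. (flat_exp (n + 2) (c - x \<bullet> x) + (- real n) * flat_exp (n + 1) (c - x \<bullet> x)) * ((- 2) * x $ i))" for i
    using partial_eqI[OF D, where i=i] by (simp add: fun_eq_iff inner_axis inner_axis')
  moreover have "C_diff m (\<lambda>x::real^'n. x $ i)" for i
  proof -
    have D: "((\<lambda>x::real^'n. x $ i) has_derivative (\<lambda>h. h $ i)) (at x)" for x
      by (rule bounded_linear.has_derivative[OF bounded_linear_vec_nth]) simp
    show ?thesis
    proof (cases m)
      case (Suc l)
      have "partial j (\<lambda>x::real^'n. x $ i) = (\<lambda>x. axis j 1 $ i)" for j
        using partial_eqI[OF D, where i=j] by (simp add: fun_eq_iff)
      with D show ?thesis by (auto simp: Suc C_diff_const differentiable_def)
    qed (auto intro: continuous_intros)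
  qed
  moreover have "(\<lambda>x::real^'n. flat_exp n (c - x \<bullet> x)) differentiable (at x)" for x
    using D by (auto simp: differentiable_def)
  ultimately show ?case
    by (simp only: C_diff.simps) (intro conjI allI C_diff_mult C_diff_add C_diff_const Suc.IH; simp)
qed

section \<open>Test functions\<close>

lemma integrable_continuous_bounded_support:
  fixes f :: "'a::euclidean_space \<Rightarrow> 'b::{banach, second_countable_topology}"
  assumes "continuous_on UNIV f" and "\<And>x. norm x > R \<Longrightarrow> f x = 0"
  shows "integrable lborel f"
proof -
  have "integrable lborel (\<lambda>x. indicator (cball 0 R) x *\<^sub>R f x)"
    using assms(1) by (intro borel_integrable_compact) (auto intro: continuous_on_subset)
  moreover have "(\<lambda>x. indicator (cball 0 R) x *\<^sub>R f x) = f"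
    using assms(2) by (auto simp: fun_eq_iff indicator_def)
  ultimately show ?thesis by simp
qed

lemma bounded_continuous_bounded_support:
  fixes f :: "'a::euclidean_space \<Rightarrow> 'b::real_normed_vector"
  assumes "continuous_on UNIV f" and R: "\<And>x. norm x > R \<Longrightarrow> f x = 0"
  obtains B where "0 < B" "\<And>x. norm (f x) \<le> B"
proof -
  have "compact (f ` cball 0 R)"
    by (intro compact_continuous_image continuous_on_subset[OF assms(1)]) auto
  then obtain B where B: "0 < B" "\<forall>y\<in>f ` cball 0 R. norm y \<le> B"
    using compact_imp_bounded bounded_pos by blast
  have "norm (f x) \<le> B" for x using B R by (cases "norm x \<le> R") auto
  then show ?thesis using B that by blast
qed

lemma uniform_continuity_bounded_support:
  fixes g :: "'a::euclidean_space \<Rightarrow> 'b::real_normed_vector"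
  assumes "continuous_on UNIV g" "\<And>x. norm x > R \<Longrightarrow> g x = 0" "0 < e"
  obtains d where "0 < d" "\<And>x y. norm (x - y) < d \<Longrightarrow> norm (g x - g y) \<le> e"
proof -
  have "uniformly_continuous_on (cball 0 (R + 2)) g"
    by (intro compact_uniformly_continuous continuous_on_subset[OF assms(1)]) auto
  then obtain d where d: "0 < d"
    "\<And>x y. x \<in> cball 0 (R + 2) \<Longrightarrow> y \<in> cball 0 (R + 2) \<Longrightarrow> dist y x < d \<Longrightarrow> dist (g y) (g x) < e"
    using assms(3) unfolding uniformly_continuous_on_def by metis
  show ?thesis
  proof (rule that[of "min d 1"])
    fix x y :: 'a assume xy: "norm (x - y) < min d 1"
    show "norm (g x - g y) \<le> e"
    proof (cases "norm x \<le> R + 1")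
      case True
      then have "norm y \<le> R + 2" using norm_triangle_ineq2[of y x] xy by (simp add: norm_minus_commute)
      then show ?thesis using d(2)[of y x] True xy by (simp add: dist_norm)
    next
      case False
      then have "norm y > R" using norm_triangle_ineq2[of x y] xy by simp
      then show ?thesis using False assms by simp
    qed
  qed (use d in simp)
qed

lemma test_C_diff: "\<phi> \<in> test_functions \<Longrightarrow> C_diff m \<phi>"
  by (simp add: test_functions_def)

lemma test_differentiable: "\<phi> \<in> test_functions \<Longrightarrow> \<phi> differentiable (at x)"
  using test_C_diff[of \<phi> "Suc 0"] by simp

lemma test_continuous: "\<phi> \<in> test_functions \<Longrightarrow> continuous_on UNIV \<phi>"
  using test_C_diff[of \<phi> 0] by simp

lemma test_functionsI:
  assumes "\<And>m. C_diff m \<phi>" and "\<And>x. norm x > R \<Longrightarrow> \<phi> x = 0"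
  shows "\<phi> \<in> test_functions"
proof -
  have "closure {x. \<phi> x \<noteq> 0} \<subseteq> cball 0 R"
    using assms(2) by (intro closure_minimal) (auto simp: not_less[symmetric])
  then have "bounded (closure {x. \<phi> x \<noteq> 0})"
    by (rule bounded_subset[OF bounded_cball])
  then show ?thesis
    using assms(1) by (simp add: test_functions_def compact_eq_bounded_closed)
qed

lemma test_support:
  assumes "\<phi> \<in> test_functions" obtains R where "0 < R" "\<And>x. norm x > R \<Longrightarrow> \<phi> x = 0"
proof -
  have "bounded {x. \<phi> x \<noteq> 0}"
    using assms unfolding test_functions_def
    by (auto intro: bounded_subset[OF compact_imp_bounded] closure_subset)
  then obtain R where "0 < R" "\<forall>x\<in>{x. \<phi> x \<noteq> 0}. norm x \<le> R"
    using bounded_pos by blast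
  then show ?thesis using that[of R] by (auto simp: not_less[symmetric])
qed

lemma partial_zero_outside:
  assumes "\<And>x. norm x > R \<Longrightarrow> \<phi> x = 0" "norm x > R"
  shows "partial i \<phi> x = 0"
proof -
  have "open {x. R < norm x}" by (rule open_Collect_less) (auto intro: continuous_intros)
  then have "(\<phi> has_derivative (\<lambda>h. 0)) (at x)"
    by (intro has_derivative_transform_within_open[of "\<lambda>x. 0" _ x UNIV "{x. R < norm x}" \<phi>])
      (use assms in auto)
  then show ?thesis by (rule partial_eqI)
qed

lemma gradient_zero_outside:
  assumes "\<And>x. norm x > R \<Longrightarrow> \<phi> x = 0" "norm x > R"
  shows "gradient \<phi> x = 0"
  using partial_zero_outside[of R \<phi> x] assms by (simp add: gradient_def vec_eq_iff)

lemma test_partial: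
  assumes "\<phi> \<in> test_functions" shows "partial i \<phi> \<in> test_functions"
proof -
  obtain R where "\<And>x. norm x > R \<Longrightarrow> \<phi> x = 0" by (rule test_support[OF assms]) blast
  moreover have "C_diff m (partial i \<phi>)" for m
    using test_C_diff[OF assms, of "Suc m"] by simp
  ultimately show ?thesis
    by (intro test_functionsI[of _ R] partial_zero_outside)
qed

lemma test_mult:
  assumes "\<phi> \<in> test_functions" "\<And>m. C_diff m f"
  shows "(\<lambda>x. f x * \<phi> x) \<in> test_functions"
proof -
  obtain R where "\<And>x. norm x > R \<Longrightarrow> \<phi> x = 0" by (rule test_support[OF assms(1)]) blast
  then show ?thesis
    by (intro test_functionsI[of "\<lambda>x. f x * \<phi> x" R] C_diff_mult assms(2) test_C_diff[OF assms(1)]) simp_all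
qed

lemma test_scale: "\<phi> \<in> test_functions \<Longrightarrow> (\<lambda>x. c * \<phi> x) \<in> test_functions"
  by (intro test_mult C_diff_const)

lemma test_add:
  assumes "\<phi> \<in> test_functions" "\<psi> \<in> test_functions"
  shows "(\<lambda>x. \<phi> x + \<psi> x) \<in> test_functions"
proof -
  obtain R where R: "\<And>x. norm x > R \<Longrightarrow> \<phi> x = 0" by (rule test_support[OF assms(1)]) blast
  obtain S where S: "\<And>x. norm x > S \<Longrightarrow> \<psi> x = 0" by (rule test_support[OF assms(2)]) blast
  show ?thesis
    using R S
    by (intro test_functionsI[of "\<lambda>x. \<phi> x + \<psi> x" "max R S"] C_diff_add test_C_diff[OF assms(1)] test_C_diff[OF assms(2)]) auto
qed

lemma test_reflect:
  assumes "\<phi> \<in> test_functions" shows "(\<lambda>y. \<phi> (x - y)) \<in> test_functions"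
proof -
  obtain R where R: "\<And>x. norm x > R \<Longrightarrow> \<phi> x = 0" by (rule test_support[OF assms]) blast
  have "\<phi> (x - y) = 0" if "R + norm x < norm y" for y
    using norm_triangle_ineq4[of x "x - y"] that by (intro R) simp
  then show ?thesis
    by (intro test_functionsI[of "\<lambda>y. \<phi> (x - y)" "R + norm x"] C_diff_reflect test_C_diff[OF assms])
qed

lemma gradient_scale:
  "f differentiable (at x) \<Longrightarrow> gradient (\<lambda>x. c * f x) x = c *\<^sub>R gradient f x"
  by (simp add: gradient_def vec_eq_iff partial_mult) (simp add: partial_def)

lemma gradient_add:
  "f differentiable (at x) \<Longrightarrow> g differentiable (at x) \<Longrightarrow>
    gradient (\<lambda>x. f x + g x) x = gradient f x + gradient g x"
  by (simp add: gradient_def vec_eq_iff partial_add)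

lemma test_gradient_continuous:
  assumes "\<phi> \<in> test_functions" shows "continuous_on UNIV (gradient \<phi>)"
  unfolding gradient_def
  by (intro continuous_on_vec_lambda test_continuous[OF test_partial[OF assms]])

lemma test_gradient_bounded:
  assumes "\<phi> \<in> test_functions"
  obtains L where "0 \<le> L" "\<And>x. norm (gradient \<phi> x) \<le> L"
proof -
  obtain R where R: "\<And>x. norm x > R \<Longrightarrow> \<phi> x = 0" by (rule test_support[OF assms]) blast
  have "gradient \<phi> x = 0" if "norm x > R" for x by (rule gradient_zero_outside[OF R that])
  then obtain L where "0 < L" "\<And>x. norm (gradient \<phi> x) \<le> L"
    using bounded_continuous_bounded_support[OF test_gradient_continuous[OF assms]] by blast
  then show ?thesis using that[of L] by simp
qed

lemma Lipschitz_of_gradient_bound: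
  fixes f :: "real^'n::finite \<Rightarrow> real"
  assumes "\<And>x. f differentiable (at x)" "\<And>x. norm (gradient f x) \<le> L"
  shows "\<bar>f x - f y\<bar> \<le> L * norm (x - y)"
proof -
  have "onorm (\<lambda>h. gradient f x \<bullet> h) \<le> L" for x
  proof (rule onorm_bound)
    show "0 \<le> L" by (rule order_trans[OF norm_ge_zero assms(2)])
    show "norm (gradient f x \<bullet> h) \<le> L * norm h" for h
      using Cauchy_Schwarz_ineq2[of "gradient f x" h] mult_right_mono[OF assms(2)[of x], of "norm h"]
      by simp
  qed
  then show ?thesis
    using differentiable_bound[of UNIV f "\<lambda>x h. gradient f x \<bullet> h" L x y]
    by (auto intro: has_derivative_gradient assms)
qed

text \<open>The difference quotients in the direction of the gradient itself tend to the square of its norm.\<close>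

lemma gradient_bound_of_Lipschitz:
  fixes f :: "real^'n::finite \<Rightarrow> real"
  assumes "f differentiable (at x)" "\<And>x y. \<bar>f x - f y\<bar> \<le> L * norm (x - y)"
  shows "norm (gradient f x) \<le> L"
proof -
  let ?g = "gradient f x"
  have "((\<lambda>t. f (x + t *\<^sub>R ?g)) has_derivative (\<lambda>s. ?g \<bullet> (s *\<^sub>R ?g))) (at 0)"
    by (rule has_derivative_compose[of "\<lambda>t. x + t *\<^sub>R ?g" _ _ _ f])
      (auto intro!: derivative_eq_intros has_derivative_gradient assms)
  then have "((\<lambda>t. f (x + t *\<^sub>R ?g)) has_real_derivative (?g \<bullet> ?g)) (at 0)"
    by (simp add: has_field_derivative_def mult_commute_abs)
  then have "((\<lambda>t. (f (x + t *\<^sub>R ?g) - f x) / t) \<longlongrightarrow> ?g \<bullet> ?g) (at 0)"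
    by (simp add: DERIV_def)
  moreover have "(f (x + t *\<^sub>R ?g) - f x) / t \<le> L * norm ?g" for t
  proof (cases "t = 0")
    case False
    have "(f (x + t *\<^sub>R ?g) - f x) / t \<le> \<bar>f (x + t *\<^sub>R ?g) - f x\<bar> / \<bar>t\<bar>"
      by (metis abs_divide abs_ge_self)
    also have "\<dots> \<le> (L * norm (t *\<^sub>R ?g)) / \<bar>t\<bar>"
      using assms(2)[of "x + t *\<^sub>R ?g" x] by (intro divide_right_mono) auto
    finally show ?thesis using False by simp
  next
    case True
    have "0 \<le> L * norm ?g"
      using assms(2)[of "x + ?g" x] by (intro order_trans[OF abs_ge_zero]) simp
    then show ?thesis using True by simp
  qed
  ultimately have "?g \<bullet> ?g \<le> L * norm ?g"
    by (intro tendsto_upperbound) auto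
  then have "norm ?g * norm ?g \<le> L * norm ?g"
    by (simp add: power2_norm_eq_inner[symmetric] power2_eq_square)
  moreover have "0 \<le> L"
  proof -
    have "0 \<le> L * norm (axis undefined 1 :: real^'n)"
      using assms(2)[of "axis undefined 1" 0] by (intro order_trans[OF abs_ge_zero]) simp
    then show ?thesis by (simp add: norm_axis_1)
  qed
  ultimately show ?thesis by (cases "norm ?g = 0") auto
qed

text \<open>The gradient is uniformly continuous, so the mean value inequality for \<open>\<phi>\<close> minus its linearization
  at \<open>x\<close> gives an error that does not depend on \<open>x\<close>.\<close>

lemma test_uniformly_differentiable:
  fixes \<phi> :: "real^'n::finite \<Rightarrow> real"
  assumes "\<phi> \<in> test_functions" "0 < e"
  obtains d where "0 < d" "\<And>x h. norm h < d \<Longrightarrow> \<bar>\<phi> (x + h) - \<phi> x - gradient \<phi> x \<bullet> h\<bar> \<le> e * norm h"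
proof -
  obtain R where R: "0 < R" "\<And>x. norm x > R \<Longrightarrow> \<phi> x = 0" by (rule test_support[OF assms(1)]) blast
  have g0: "gradient \<phi> x = 0" if "norm x > R" for x by (rule gradient_zero_outside[OF R(2) that])
  obtain d where d: "0 < d" and unif: "\<And>x y. norm (x - y) < d \<Longrightarrow> norm (gradient \<phi> x - gradient \<phi> y) \<le> e"
    using uniform_continuity_bounded_support[OF test_gradient_continuous[OF assms(1)] g0 assms(2)] by blast
  show ?thesis
  proof (rule that[OF d])
    fix x h :: "real^'n" assume h: "norm h < d"
    let ?f = "\<lambda>y. \<phi> y - gradient \<phi> x \<bullet> y"
    have "norm (?f (x + h) - ?f x) \<le> e * norm (x + h - x)"
    proof (rule differentiable_bound[of "ball x d" ?f "\<lambda>y k. gradient \<phi> y \<bullet> k - gradient \<phi> x \<bullet> k" e "x + h" x])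
      fix y assume y: "y \<in> ball x d"
      show "(?f has_derivative (\<lambda>k. gradient \<phi> y \<bullet> k - gradient \<phi> x \<bullet> k)) (at y within ball x d)"
        by (rule has_derivative_at_withinI, intro has_derivative_diff
            has_derivative_gradient[OF test_differentiable[OF assms(1)]]
            bounded_linear_imp_has_derivative bounded_linear_inner_right)
      show "onorm (\<lambda>k. gradient \<phi> y \<bullet> k - gradient \<phi> x \<bullet> k) \<le> e"
      proof (rule onorm_bound)
        fix k
        have "norm (gradient \<phi> y \<bullet> k - gradient \<phi> x \<bullet> k) \<le> norm (gradient \<phi> y - gradient \<phi> x) * norm k"
          using Cauchy_Schwarz_ineq2[of "gradient \<phi> y - gradient \<phi> x" k] by (simp add: inner_diff_left)
        also have "\<dots> \<le> e * norm k"
          using unif[of y x] y by (intro mult_right_mono) (auto simp: dist_norm norm_minus_commute)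
        finally show "norm (gradient \<phi> y \<bullet> k - gradient \<phi> x \<bullet> k) \<le> e * norm k" .
      qed (use assms in simp)
    qed (use h d in \<open>auto simp: dist_norm\<close>)
    then show "\<bar>\<phi> (x + h) - \<phi> x - gradient \<phi> x \<bullet> h\<bar> \<le> e * norm h"
      by (simp add: inner_add_right algebra_simps)
  qed
qed

lemma test_difference_quotient_tendsto:
  fixes \<phi> :: "real^'n::finite \<Rightarrow> real"
  assumes \<phi>: "\<phi> \<in> test_functions" and t: "\<And>n. 0 < t n" "t \<longlonglongrightarrow> 0"
  shows "(\<lambda>n. (\<phi> (x + t n *\<^sub>R h) - \<phi> x) / t n) \<longlonglongrightarrow> gradient \<phi> x \<bullet> h"
proof -
  have "((\<lambda>s. \<phi> (x + s *\<^sub>R h)) has_derivative (\<lambda>s. gradient \<phi> (x + 0 *\<^sub>R h) \<bullet> (s *\<^sub>R h))) (at 0)"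
    by (rule has_derivative_compose[of "\<lambda>s. x + s *\<^sub>R h" _ _ _ \<phi>])
      (auto intro!: derivative_eq_intros has_derivative_gradient test_differentiable \<phi>)
  then have "((\<lambda>s. \<phi> (x + s *\<^sub>R h)) has_real_derivative (gradient \<phi> x \<bullet> h)) (at 0)"
    by (simp add: has_field_derivative_def mult_commute_abs)
  then have lim: "((\<lambda>s. (\<phi> (x + s *\<^sub>R h) - \<phi> x) / s) \<longlongrightarrow> gradient \<phi> x \<bullet> h) (at 0)"
    by (simp add: DERIV_def)
  have "filterlim t (at 0) sequentially"
    using t by (auto simp: filterlim_at intro!: always_eventually) (metis less_irrefl)
  from filterlim_compose[OF lim this] show ?thesis .
qed

section \<open>Mollifiers\<close>

definition mollifier :: "real \<Rightarrow> real^'n::finite \<Rightarrow> real" where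
  "mollifier d x = flat_exp 0 (d\<^sup>2 - x \<bullet> x) / (\<integral>y. flat_exp 0 (d\<^sup>2 - y \<bullet> (y::real^'n)) \<partial>lborel)"

lemma flat_exp_nonneg: "0 \<le> flat_exp n s"
  by (simp add: flat_exp_def)

lemma flat_exp_outside:
  assumes "0 < d" "d \<le> norm x" shows "flat_exp n (d\<^sup>2 - x \<bullet> x) = 0"
proof -
  have "d\<^sup>2 \<le> x \<bullet> x"
    using power_mono[of d "norm x" 2] assms by (simp only: power2_norm_eq_inner less_imp_le)
  then show ?thesis by (simp add: flat_exp_def)
qed

lemma mollifier_nonneg: "0 \<le> mollifier d x"
  by (simp add: mollifier_def flat_exp_nonneg integral_nonneg_AE)

lemma mollifier_outside: "0 < d \<Longrightarrow> d \<le> norm x \<Longrightarrow> mollifier d x = 0"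
  by (simp add: mollifier_def flat_exp_outside)

lemma mollifier_test:
  assumes "0 < d" shows "(mollifier d :: real^'n::finite \<Rightarrow> real) \<in> test_functions"
proof -
  have "mollifier d = (\<lambda>x::real^'n. (1 / (\<integral>y. flat_exp 0 (d\<^sup>2 - y \<bullet> (y::real^'n)) \<partial>lborel)) * flat_exp 0 (d\<^sup>2 - x \<bullet> x))"
    unfolding mollifier_def by (intro ext) (rule divide_inverse[THEN trans], simp add: divide_inverse)
  also have "\<dots> \<in> test_functions"
    using assms by (intro test_scale test_functionsI[of _ d] C_diff_flat_exp_norm flat_exp_outside) auto
  finally show ?thesis .
qed

lemma mollifier_integral:
  assumes "0 < d" shows "(\<integral>x. mollifier d (x::real^'n::finite) \<partial>lborel) = 1"
proof -
  let ?f = "\<lambda>x::real^'n. flat_exp 0 (d\<^sup>2 - x \<bullet> x)"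
  have t: "?f \<in> test_functions"
    using assms by (intro test_functionsI[of _ d] C_diff_flat_exp_norm flat_exp_outside) auto
  have int: "integrable lborel ?f"
    using assms by (intro integrable_continuous_bounded_support[of _ d] test_continuous t flat_exp_outside) auto
  have "(\<integral>x. ?f x \<partial>lborel) \<noteq> 0"
  proof
    assume "(\<integral>x. ?f x \<partial>lborel) = 0"
    then have "AE x in lborel. ?f x = 0"
      using int by (subst (asm) integral_nonneg_eq_0_iff_AE) (auto simp: flat_exp_nonneg)
    then have "AE x in lborel. x \<notin> ball (0::real^'n) d"
    proof (rule AE_mp, intro AE_I2 impI)
      fix x :: "real^'n" assume elim: "flat_exp 0 (d\<^sup>2 - x \<bullet> x) = 0"
      show "x \<notin> ball 0 d"
      proof
        assume "x \<in> ball 0 d"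
        then have "x \<bullet> x < d\<^sup>2" by (simp add: power2_norm_eq_inner[symmetric] power_strict_mono)
        then show False using elim by (simp add: flat_exp_def)
      qed
    qed
    then have "emeasure lborel (ball (0::real^'n) d) = 0"
      by (subst (asm) AE_iff_measurable[OF _ refl]) (auto simp: ball_def)
    moreover have "0 < measure lborel (ball (0::real^'n) d)" using assms by (rule content_ball_pos)
    ultimately show False by (simp add: measure_def)
  qed
  then show ?thesis by (simp add: mollifier_def)
qed

lemma mollifier_integrable: "0 < d \<Longrightarrow> integrable lborel (mollifier d)"
  by (intro integrable_continuous_bounded_support[of _ d] test_continuous mollifier_test mollifier_outside) auto

section \<open>Convolution\<close>

lemma lborel_distr_minus: "distr lborel borel (\<lambda>x. a - x) = (lborel :: 'a::euclidean_space measure)"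
  by (subst lborel_affine[of "-1" a]) (auto simp: density_1 one_ennreal_def[symmetric])

lemma nn_integral_reflect:
  fixes f :: "'a::euclidean_space \<Rightarrow> ennreal"
  assumes [measurable]: "f \<in> borel_measurable borel"
  shows "(\<integral>\<^sup>+x. f (a - x) \<partial>lborel) = (\<integral>\<^sup>+x. f x \<partial>lborel)"
  by (subst (2) lborel_distr_minus[of a, symmetric], subst nn_integral_distr) auto

lemma nn_integral_translate:
  fixes f :: "'a::euclidean_space \<Rightarrow> ennreal"
  assumes [measurable]: "f \<in> borel_measurable borel"
  shows "(\<integral>\<^sup>+x. f (a + x) \<partial>lborel) = (\<integral>\<^sup>+x. f x \<partial>lborel)"
  by (subst (2) lborel_distr_plus[of a, symmetric], subst nn_integral_distr) auto

lemma integral_reflect: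
  fixes f :: "'a::euclidean_space \<Rightarrow> 'b::{banach, second_countable_topology}"
  assumes [measurable]: "f \<in> borel_measurable borel"
  shows "(\<integral>x. f (a - x) \<partial>lborel) = (\<integral>x. f x \<partial>lborel)"
  by (subst (2) lborel_distr_minus[of a, symmetric], subst integral_distr) auto

lemma integrable_reflect:
  fixes f :: "'a::euclidean_space \<Rightarrow> 'b::{banach, second_countable_topology}"
  assumes "integrable lborel f"
  shows "integrable lborel (\<lambda>x. f (a - x))"
proof -
  have "integrable (distr lborel borel (\<lambda>x. a - x)) f" using assms by (simp add: lborel_distr_minus)
  then show ?thesis by (rule integrable_distr[rotated]) simp
qed

lemma test_bounded:
  assumes "\<phi> \<in> test_functions" obtains B where "0 < B" "\<And>x. \<bar>\<phi> x\<bar> \<le> B"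
proof -
  obtain R where "\<And>x. norm x > R \<Longrightarrow> \<phi> x = 0" by (rule test_support[OF assms]) blast
  from bounded_continuous_bounded_support[OF test_continuous[OF assms] this] show ?thesis
    using that by (metis real_norm_def)
qed

lemma test_measurable: "\<phi> \<in> test_functions \<Longrightarrow> \<phi> \<in> borel_measurable borel"
  by (intro borel_measurable_continuous_onI test_continuous)

lemma test_gradient_measurable: "\<phi> \<in> test_functions \<Longrightarrow> gradient \<phi> \<in> borel_measurable borel"
  by (intro borel_measurable_continuous_onI test_gradient_continuous)

lemma test_integrable:
  assumes "\<phi> \<in> test_functions" shows "integrable lborel \<phi>"
proof -
  obtain R where "\<And>x. norm x > R \<Longrightarrow> \<phi> x = 0" by (rule test_support[OF assms]) blast
  then show ?thesis by (intro integrable_continuous_bounded_support test_continuous assms)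
qed

lemma integrable_bounded_scaleR:
  fixes f :: "'a \<Rightarrow> 'b::{banach, second_countable_topology}"
  assumes "integrable M f" "g \<in> borel_measurable M" "\<And>x. \<bar>g x\<bar> \<le> (B::real)"
  shows "integrable M (\<lambda>x. g x *\<^sub>R f x)"
proof (rule Bochner_Integration.integrable_bound[of M "\<lambda>x. B *\<^sub>R f x"])
  have "0 \<le> B" using assms(3) abs_ge_zero order_trans by blast
  then show "AE x in M. norm (g x *\<^sub>R f x) \<le> norm (B *\<^sub>R f x)"
    using assms(3) by (auto intro!: mult_right_mono)
qed (use assms in auto)

definition conv :: "(real^'n::finite \<Rightarrow> real) \<Rightarrow> (real^'n \<Rightarrow> 'b::{banach, second_countable_topology}) \<Rightarrow> real^'n \<Rightarrow> 'b" where
  "conv \<rho> f x = (\<integral>y. \<rho> (x - y) *\<^sub>R f y \<partial>lborel)"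

lemma conv_integrable:
  fixes f :: "real^'n::finite \<Rightarrow> 'b::{banach, second_countable_topology}"
  assumes "\<rho> \<in> test_functions" "integrable lborel f"
  shows "integrable lborel (\<lambda>y. \<rho> (x - y) *\<^sub>R f y)"
proof -
  obtain B where "\<And>x. \<bar>\<rho> x\<bar> \<le> B" by (rule test_bounded[OF assms(1)]) blast
  moreover have "(\<lambda>y. \<rho> (x - y)) \<in> borel_measurable borel"
    by (rule test_measurable[OF test_reflect[OF assms(1)]])
  ultimately show ?thesis
    by (intro integrable_bounded_scaleR[OF assms(2), of "\<lambda>y. \<rho> (x - y)" B]) simp_all
qed

lemma integrable_scaleR_gradient:
  fixes f :: "real^'n::finite \<Rightarrow> real"
  assumes \<rho>: "\<rho> \<in> test_functions" and f: "integrable lborel f"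
  shows "integrable lborel (\<lambda>y. f y *\<^sub>R gradient \<rho> (x - y))"
proof -
  obtain L where L: "0 \<le> L" "\<And>x. norm (gradient \<rho> x) \<le> L" by (rule test_gradient_bounded[OF \<rho>]) blast
  have [measurable]: "gradient \<rho> \<in> borel_measurable borel" "f \<in> borel_measurable borel"
    using test_gradient_measurable[OF \<rho>] f by auto
  show ?thesis
  proof (rule Bochner_Integration.integrable_bound)
    show "integrable lborel (\<lambda>y. L * f y)" using f by simp
    show "AE y in lborel. norm (f y *\<^sub>R gradient \<rho> (x - y)) \<le> norm (L * f y)"
    proof (intro AE_I2)
      fix y
      have "\<bar>f y\<bar> * norm (gradient \<rho> (x - y)) \<le> \<bar>f y\<bar> * L"
        by (intro mult_left_mono L) simp
      then show "norm (f y *\<^sub>R gradient \<rho> (x - y)) \<le> norm (L * f y)"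
        using L(1) by (simp add: abs_mult mult.commute)
    qed
  qed simp
qed

lemma conv_reflect:
  fixes f :: "real^'n::finite \<Rightarrow> 'b::{banach, second_countable_topology}"
  assumes [measurable]: "\<rho> \<in> borel_measurable borel" "f \<in> borel_measurable borel"
  shows "conv \<rho> f x = (\<integral>y. \<rho> y *\<^sub>R f (x - y) \<partial>lborel)"
  unfolding conv_def by (subst integral_reflect[symmetric, of _ x]) auto

lemma conv_diff:
  assumes "\<rho> \<in> test_functions" "integrable lborel f" "integrable lborel g"
  shows "conv \<rho> (\<lambda>x. f x - g x) x = conv \<rho> f x - conv \<rho> g x"
  unfolding conv_def using assms
  by (simp add: scaleR_diff_right Bochner_Integration.integral_diff conv_integrable)

text \<open>Differentiation under the integral sign: the error in the first-order expansion of \<open>\<rho>\<close> is uniformly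
  small by \<open>test_uniformly_differentiable\<close>, and \<open>f\<close> is integrable.\<close>

lemma conv_has_derivative:
  fixes f :: "real^'n::finite \<Rightarrow> real"
  assumes \<rho>: "\<rho> \<in> test_functions" and f: "integrable lborel f"
  shows "(conv \<rho> f has_derivative (\<lambda>h. (\<integral>y. f y *\<^sub>R gradient \<rho> (x - y) \<partial>lborel) \<bullet> h)) (at x)"
  unfolding has_derivative_at_alt
proof (intro conjI allI impI)
  let ?G = "\<integral>y. f y *\<^sub>R gradient \<rho> (x - y) \<partial>lborel"
  show "bounded_linear (\<lambda>h. ?G \<bullet> h)" by (rule bounded_linear_inner_right)
  fix e :: real assume "0 < e"
  define I where "I = (\<integral>y. \<bar>f y\<bar> \<partial>lborel)"
  have I: "0 \<le> I" by (simp add: I_def)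
  note intG = integrable_scaleR_gradient[OF \<rho> f, of x]
  obtain d where d: "0 < d" "\<And>x h. norm h < d \<Longrightarrow> \<bar>\<rho> (x + h) - \<rho> x - gradient \<rho> x \<bullet> h\<bar> \<le> e / (I + 1) * norm h"
    using test_uniformly_differentiable[OF \<rho>, of "e / (I + 1)"] \<open>0 < e\<close> I by auto
  show "\<exists>d>0. \<forall>y. norm (y - x) < d \<longrightarrow> norm (conv \<rho> f y - conv \<rho> f x - ?G \<bullet> (y - x)) \<le> e * norm (y - x)"
  proof (intro exI conjI allI impI)
    fix y assume y: "norm (y - x) < d"
    let ?r = "\<lambda>z. (\<rho> (y - z) - \<rho> (x - z) - gradient \<rho> (x - z) \<bullet> (y - x)) * f z"
    have "conv \<rho> f y - conv \<rho> f x - ?G \<bullet> (y - x)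
        = (\<integral>z. \<rho> (y - z) * f z - \<rho> (x - z) * f z - (f z *\<^sub>R gradient \<rho> (x - z)) \<bullet> (y - x) \<partial>lborel)"
    proof -
      note i1 = conv_integrable[OF \<rho> f, of y, unfolded real_scaleR_def]
        and i2 = conv_integrable[OF \<rho> f, of x, unfolded real_scaleR_def]
      have i3: "integrable lborel (\<lambda>z. (f z *\<^sub>R gradient \<rho> (x - z)) \<bullet> (y - x))"
        by (rule integrable_inner_left) (rule intG)
      have "?G \<bullet> (y - x) = (\<integral>z. (f z *\<^sub>R gradient \<rho> (x - z)) \<bullet> (y - x) \<partial>lborel)"
        by (rule integral_inner_left[symmetric]) (rule intG)
      then show ?thesis
        unfolding conv_def real_scaleR_def
        by (simp only: Bochner_Integration.integral_diff[OF Bochner_Integration.integrable_diff[OF i1 i2] i3]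
            Bochner_Integration.integral_diff[OF i1 i2])
    qed
    also have "\<dots> = (\<integral>z. ?r z \<partial>lborel)"
      by (intro Bochner_Integration.integral_cong) (auto simp: algebra_simps)
    finally have eq: "conv \<rho> f y - conv \<rho> f x - ?G \<bullet> (y - x) = (\<integral>z. ?r z \<partial>lborel)" .
    have "norm (\<integral>z. ?r z \<partial>lborel) \<le> (\<integral>z. e / (I + 1) * norm (y - x) * \<bar>f z\<bar> \<partial>lborel)"
    proof (rule Bochner_Integration.integral_norm_bound_integral)
      show "integrable lborel ?r"
      proof -
        have "integrable lborel (\<lambda>z. \<rho> (y - z) *\<^sub>R f z - \<rho> (x - z) *\<^sub>R f z - (f z *\<^sub>R gradient \<rho> (x - z)) \<bullet> (y - x))"
          by (intro Bochner_Integration.integrable_diff integrable_inner_left intG conv_integrable \<rho> f)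
        then show ?thesis by (simp add: algebra_simps)
      qed
      show "norm (?r z) \<le> e / (I + 1) * norm (y - x) * \<bar>f z\<bar>" for z
        using d(2)[OF y, of "x - z"] by (simp only: real_norm_def abs_mult) (intro mult_right_mono, simp_all)
    qed (use f in auto)
    also have "\<dots> = e * (I / (I + 1)) * norm (y - x)" by (simp add: I_def)
    also have "\<dots> \<le> e * norm (y - x)"
      using I \<open>0 < e\<close> by (intro mult_right_mono) (auto simp: mult_le_cancel_left1 pos_divide_le_eq)
    finally show "norm (conv \<rho> f y - conv \<rho> f x - ?G \<bullet> (y - x)) \<le> e * norm (y - x)"
      by (simp only: eq)
  qed (use d in simp)
qed

lemma conv_partial:
  fixes f :: "real^'n::finite \<Rightarrow> real"
  assumes \<rho>: "\<rho> \<in> test_functions" and f: "integrable lborel f"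
  shows "partial i (conv \<rho> f) = conv (partial i \<rho>) f"
proof
  fix x
  have "integrable lborel (\<lambda>y. f y *\<^sub>R gradient \<rho> (x - y))"
    by (rule integrable_scaleR_gradient[OF \<rho> f])
  then have "(\<integral>y. f y *\<^sub>R gradient \<rho> (x - y) \<partial>lborel) \<bullet> axis i 1
      = (\<integral>y. (f y *\<^sub>R gradient \<rho> (x - y)) \<bullet> axis i 1 \<partial>lborel)"
    by (intro integral_inner_left[symmetric]) simp
  also have "\<dots> = conv (partial i \<rho>) f x"
    by (simp add: conv_def inner_axis gradient_def mult.commute)
  finally show "partial i (conv \<rho> f) x = conv (partial i \<rho>) f x"
    using partial_eqI[OF conv_has_derivative[OF assms], of i] by simp
qed

lemma conv_C_diff:
  assumes "\<rho> \<in> test_functions" "integrable lborel (f :: real^'n::finite \<Rightarrow> real)"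
  shows "C_diff m (conv \<rho> f)"
  using assms(1)
proof (induction m arbitrary: \<rho>)
  case 0
  then show ?case
    using conv_has_derivative[OF _ assms(2)]
    by (auto intro!: continuous_at_imp_continuous_on has_derivative_continuous)
next
  case (Suc m)
  then show ?case
    using conv_has_derivative[OF Suc.prems assms(2)]
    by (auto simp: conv_partial assms differentiable_def intro: test_partial)
qed

lemma conv_outside:
  assumes "\<And>x. norm x > R \<Longrightarrow> f x = 0" "\<And>x. norm x \<ge> d \<Longrightarrow> \<rho> x = 0" "norm x \<ge> R + d"
  shows "conv \<rho> f x = 0"
proof -
  have "\<rho> (x - y) *\<^sub>R f y = 0" for y
  proof (cases "norm y > R")
    case False
    then have "norm (x - y) \<ge> d" using norm_triangle_ineq2[of x y] assms(3) by simp
    then show ?thesis by (simp add: assms(2))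
  qed (simp add: assms(1))
  then show ?thesis unfolding conv_def by (simp only: integral_zero)
qed

lemma conv_measurable:
  fixes f :: "real^'n::finite \<Rightarrow> 'b::{banach, second_countable_topology}"
  assumes [measurable]: "\<rho> \<in> borel_measurable borel" "f \<in> borel_measurable borel"
  shows "conv \<rho> f \<in> borel_measurable borel"
  unfolding conv_def by measurable

lemma conv_mollifier_test:
  assumes "0 < d" "integrable lborel (f :: real^'n::finite \<Rightarrow> real)" "\<And>x. norm x > R \<Longrightarrow> f x = 0"
  shows "conv (mollifier d) f \<in> test_functions"
  using assms
  by (intro test_functionsI[of _ "R + d"] conv_C_diff mollifier_test conv_outside[of R f d] mollifier_outside) auto

section \<open>Jensen's inequality\<close>

lemma powr_above_tangent:
  assumes "1 \<le> p" "0 < s" "0 \<le> (a::real)"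
  shows "s powr p + p * s powr (p - 1) * (a - s) \<le> a powr p"
proof (cases "a = 0")
  case True
  have "s powr p - p * (s powr (p - 1) * s) = (1 - p) * s powr p"
    using assms by (simp add: powr_diff field_simps)
  also have "\<dots> \<le> 0" using assms by (simp add: mult_le_0_iff)
  finally show ?thesis using True by (simp add: algebra_simps)
next
  case False
  have "p * s powr (p - 1) * (a - s) \<le> a powr p - s powr p"
    by (rule convex_on_imp_above_tangent[of "{0<..}"])
      (use assms False in \<open>auto intro!: powr_convex derivative_eq_intros simp: interior_open\<close>)
  then show ?thesis by simp
qed

text \<open>The sum of the tangent inequalities at the convex combination; in contrast to \<open>powr_convex\<close> this
  includes the boundary point 0.\<close>

lemma powr_convex_combination:
  assumes "1 \<le> p" "0 \<le> a" "0 \<le> b" "0 \<le> t" "t \<le> (1::real)"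
  shows "((1 - t) * a + t * b) powr p \<le> (1 - t) * a powr p + t * b powr p"
proof (cases "(1 - t) * a + t * b = 0")
  case False
  let ?s = "(1 - t) * a + t * b"
  have s: "0 < ?s" using False assms by (simp add: order_less_le)
  have "?s powr p = (1 - t) * (?s powr p + p * ?s powr (p - 1) * (a - ?s)) + t * (?s powr p + p * ?s powr (p - 1) * (b - ?s))"
    by algebra
  also have "\<dots> \<le> (1 - t) * a powr p + t * b powr p"
    using assms s by (intro add_mono mult_left_mono powr_above_tangent) auto
  finally show ?thesis .
qed (use assms in simp)

lemma norm_powr_midpoint:
  fixes a b :: "'a::real_normed_vector"
  assumes "1 \<le> p"
  shows "norm ((1/2) *\<^sub>R (a + b)) powr p \<le> (norm a powr p + norm b powr p) / 2"
proof -
  have "norm ((1/2) *\<^sub>R (a + b)) powr p \<le> ((1 - 1/2) * norm a + 1/2 * norm b) powr p"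
    using assms norm_triangle_ineq[of a b] by (intro powr_mono2) auto
  also have "\<dots> \<le> (1 - 1/2) * norm a powr p + 1/2 * norm b powr p"
    using assms by (intro powr_convex_combination) auto
  finally show ?thesis by (simp add: field_simps)
qed

text \<open>Integrate the tangent inequality at the mean value of \<open>g\<close>.\<close>

lemma Jensen_powr:
  fixes g :: "'a \<Rightarrow> real"
  assumes M: "emeasure M (space M) = 1" and g: "integrable M g" "\<And>x. 0 \<le> g x" and p: "1 \<le> p"
  shows "ennreal ((\<integral>x. g x \<partial>M) powr p) \<le> (\<integral>\<^sup>+x. ennreal (g x powr p) \<partial>M)"
proof (cases "(\<integral>x. g x \<partial>M) = 0 \<or> (\<integral>\<^sup>+x. ennreal (g x powr p) \<partial>M) = \<infinity>")
  case False
  let ?s = "\<integral>x. g x \<partial>M"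
  have [measurable]: "g \<in> borel_measurable M" using g by auto
  interpret finite_measure M by standard (simp add: M)
  have m: "measure M (space M) = 1" by (simp add: measure_def M)
  have s: "0 < ?s" using False g integral_nonneg_AE[of g M] by (simp add: order_less_le)
  have int: "integrable M (\<lambda>x. g x powr p)"
    using False by (intro integrableI_nonneg) (auto simp: less_top)
  have "?s powr p = (\<integral>x. ?s powr p + p * ?s powr (p - 1) * (g x - ?s) \<partial>M)"
    using g by (simp add: m)
  also have "\<dots> \<le> (\<integral>x. g x powr p \<partial>M)"
    using g int p s by (intro integral_mono) (auto intro!: powr_above_tangent)
  finally have "?s powr p \<le> (\<integral>x. g x powr p \<partial>M)" .
  then show ?thesis using int by (simp add: nn_integral_eq_integral)
qed auto

lemma conv_Jensen:
  fixes V :: "real^'n::finite \<Rightarrow> 'b::{banach, second_countable_topology}"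
  assumes d: "0 < d" and V: "integrable lborel V" and p: "1 \<le> p"
  shows "ennreal (norm (conv (mollifier d) V x) powr p)
    \<le> (\<integral>\<^sup>+y. ennreal (mollifier d (x - y)) * ennreal (norm (V y) powr p) \<partial>lborel)"
proof -
  let ?\<rho> = "\<lambda>y. mollifier d (x - y)"
  let ?M = "density lborel ?\<rho>"
  have t: "?\<rho> \<in> test_functions" by (intro test_reflect mollifier_test d)
  have [measurable]: "?\<rho> \<in> borel_measurable borel" "V \<in> borel_measurable borel"
    using test_measurable[OF t] V by auto
  have "emeasure ?M (space ?M) = (\<integral>\<^sup>+y. ennreal (?\<rho> y) \<partial>lborel)"
    by (simp add: emeasure_density)
  also have "\<dots> = ennreal (\<integral>y. ?\<rho> y \<partial>lborel)"
    by (intro nn_integral_eq_integral test_integrable t) (simp add: mollifier_nonneg)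
  also have "(\<integral>y. ?\<rho> y \<partial>lborel) = 1"
    using mollifier_integral[OF d] by (subst integral_reflect) (auto intro: test_measurable mollifier_test d)
  finally have one: "emeasure ?M (space ?M) = 1" by simp
  have int: "integrable lborel (\<lambda>y. ?\<rho> y *\<^sub>R norm (V y))"
    using V by (intro conv_integrable mollifier_test d) auto
  have "norm (conv (mollifier d) V x) \<le> (\<integral>y. norm (?\<rho> y *\<^sub>R V y) \<partial>lborel)"
    unfolding conv_def by (rule integral_norm_bound)
  also have "\<dots> = (\<integral>y. norm (V y) \<partial>?M)"
    by (subst integral_density) (auto simp: mollifier_nonneg)
  finally have "ennreal (norm (conv (mollifier d) V x) powr p) \<le> ennreal ((\<integral>y. norm (V y) \<partial>?M) powr p)"
    using p by (intro ennreal_leI powr_mono2) auto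
  also have "\<dots> \<le> (\<integral>\<^sup>+y. ennreal (norm (V y) powr p) \<partial>?M)"
    using int by (intro Jensen_powr one p) (auto simp: integrable_density mollifier_nonneg)
  also have "\<dots> = (\<integral>\<^sup>+y. ennreal (mollifier d (x - y)) * ennreal (norm (V y) powr p) \<partial>lborel)"
    by (subst nn_integral_density) auto
  finally show ?thesis .
qed

lemma mollifier_measurable[measurable]: "mollifier d \<in> borel_measurable borel"
proof -
  have "flat_exp 0 \<in> borel_measurable borel" unfolding flat_exp_def by measurable
  then show ?thesis unfolding mollifier_def by measurable
qed

lemma nn_integral_mollifier:
  assumes "0 < d" shows "(\<integral>\<^sup>+x. ennreal (mollifier d (x - (y::real^'n::finite))) \<partial>lborel) = 1"
proof -
  have "(\<integral>\<^sup>+x. ennreal (mollifier d (x - y)) \<partial>lborel) = (\<integral>\<^sup>+x. ennreal (mollifier d ((- y) + x)) \<partial>lborel)"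
    by simp
  also have "\<dots> = (\<integral>\<^sup>+x. ennreal (mollifier d (x::real^'n)) \<partial>lborel)"
    by (rule nn_integral_translate) simp
  also have "\<dots> = 1"
    using assms by (subst nn_integral_eq_integral) (auto simp: mollifier_integrable mollifier_nonneg mollifier_integral)
  finally show ?thesis .
qed

abbreviation Lp_power :: "real \<Rightarrow> (real^'n::finite \<Rightarrow> 'b::real_normed_vector) \<Rightarrow> ennreal" where
  "Lp_power p V \<equiv> \<integral>\<^sup>+x. ennreal (norm (V x) powr p) \<partial>lborel"

text \<open>Jensen's inequality for the probability density \<open>y \<mapsto> mollifier d (x - y)\<close>, integrated over \<open>x\<close>.\<close>

lemma conv_Lp_contraction:
  fixes V :: "real^'n::finite \<Rightarrow> 'b::{banach, second_countable_topology}"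
  assumes d: "0 < d" and V: "integrable lborel V" and p: "1 \<le> p"
  shows "Lp_power p (conv (mollifier d) V)
    \<le> Lp_power p V"
proof -
  have [measurable]: "V \<in> borel_measurable borel" using V by auto
  have "Lp_power p (conv (mollifier d) V)
    \<le> (\<integral>\<^sup>+x. (\<integral>\<^sup>+y. ennreal (mollifier d (x - y)) * ennreal (norm (V y) powr p) \<partial>lborel) \<partial>lborel)"
    by (intro nn_integral_mono conv_Jensen assms)
  also have "\<dots> = (\<integral>\<^sup>+y. (\<integral>\<^sup>+x. ennreal (mollifier d (x - y)) * ennreal (norm (V y) powr p) \<partial>lborel) \<partial>lborel)"
    by (rule lborel_pair.Fubini'[symmetric]) measurable
  also have "\<dots> = (\<integral>\<^sup>+y. ennreal (norm (V y) powr p) \<partial>lborel)"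
    by (intro nn_integral_cong, subst nn_integral_multc) (auto simp: nn_integral_mollifier d)
  finally show ?thesis .
qed

section \<open>Approximation by mollification\<close>

lemma integral_translate:
  fixes f :: "'a::euclidean_space \<Rightarrow> 'b::{banach, second_countable_topology}"
  assumes [measurable]: "f \<in> borel_measurable borel"
  shows "(\<integral>x. f (a + x) \<partial>lborel) = (\<integral>x. f x \<partial>lborel)"
  by (subst (2) lborel_distr_plus[of a, symmetric], subst integral_distr) auto

lemma integrable_translate:
  fixes f :: "'a::euclidean_space \<Rightarrow> 'b::{banach, second_countable_topology}"
  assumes "integrable lborel f"
  shows "integrable lborel (\<lambda>x. f (a + x))"
proof -
  have "integrable (distr lborel borel (\<lambda>x. a + x)) f"
    using assms by (simp add: lborel_distr_plus)
  then show ?thesis by (rule integrable_distr[rotated]) simp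
qed

lemma cball_measurable[measurable]: "cball a r \<in> sets borel"
  by simp

text \<open>The domain and the values of \<open>f\<close> are truncated first. The resulting bounded function is almost
  everywhere a limit of continuous functions; these may be truncated in the same way without changing
  the limit, and then dominated convergence applies.\<close>

lemma integrable_approx_continuous:
  fixes f :: "'a::euclidean_space \<Rightarrow> real"
  assumes f: "integrable lborel f" and e: "0 < e"
  obtains g R where "continuous_on UNIV g" "\<And>x. norm x > R \<Longrightarrow> g x = 0" "(\<integral>x. \<bar>f x - g x\<bar> \<partial>lborel) < e"
proof -
  have [measurable]: "f \<in> borel_measurable borel" using f by auto
  define h where "h n x = indicator (cball 0 (real n)) x * max (- real n) (min (real n) (f x))" for n x
  have [measurable]: "h n \<in> borel_measurable borel" for n unfolding h_def by measurable
  have "(\<lambda>n. \<integral>x. \<bar>f x - h n x\<bar> \<partial>lborel) \<longlonglongrightarrow> (\<integral>x. 0 \<partial>(lborel :: 'a measure))"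
  proof (rule integral_dominated_convergence)
    show "integrable lborel (\<lambda>x. \<bar>f x\<bar>)" using f by auto
    show "AE x in lborel. norm \<bar>f x - h n x\<bar> \<le> \<bar>f x\<bar>" for n
      by (auto simp: h_def indicator_def)
    show "AE x in lborel. (\<lambda>n. \<bar>f x - h n x\<bar>) \<longlonglongrightarrow> 0"
    proof (intro AE_I2 tendsto_eventually)
      fix x
      obtain N where N: "max (norm x) \<bar>f x\<bar> \<le> real N" using real_arch_simple by blast
      show "\<forall>\<^sub>F n in sequentially. \<bar>f x - h n x\<bar> = 0"
        using eventually_ge_at_top[of N]
      proof eventually_elim
        case (elim n)
        then have "max (norm x) \<bar>f x\<bar> \<le> real n" using N by linarith
        then show ?case by (auto simp: h_def indicator_def)
      qed
    qed
  qed auto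
  then have "(\<lambda>n. \<integral>x. \<bar>f x - h n x\<bar> \<partial>lborel) \<longlonglongrightarrow> 0" by simp
  then have "\<forall>\<^sub>F n in sequentially. (\<integral>x. \<bar>f x - h n x\<bar> \<partial>lborel) < e / 2"
    using e by (intro order_tendstoD(2)) auto
  then obtain n where n: "(\<integral>x. \<bar>f x - h n x\<bar> \<partial>lborel) < e / 2"
    by (auto simp: eventually_sequentially)
  have "h n measurable_on UNIV"
    by (intro lebesgue_measurable_imp_measurable_on) (auto intro: measurable_completion)
  then obtain N g where N: "negligible N" and g: "\<And>m. continuous_on UNIV (g m)"
    and lim: "\<And>x. x \<notin> N \<Longrightarrow> (\<lambda>m. g m x) \<longlonglongrightarrow> h n x"
    unfolding measurable_on_def by auto
  \<comment> \<open>The first factor is 1 on the ball of radius \<open>n\<close> and makes the product vanish off the ball of radius \<open>n + 1\<close>.\<close>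
  define k where "k m x = max 0 (min 1 (real n + 1 - norm x)) * max (- real n) (min (real n) (g m x))" for m x
  have k_cont: "continuous_on UNIV (k m)" for m
    unfolding k_def by (intro continuous_intros g)
  have k_out: "k m x = 0" if "norm x > real n + 1" for m x
    using that by (simp add: k_def)
  have AEN: "AE x in lborel. x \<notin> N"
    using N AE_not_in[of N lebesgue] by (simp add: negligible_iff_null_sets AE_completion_iff)
  have h_int: "integrable lborel (h n)"
    by (rule Bochner_Integration.integrable_bound[OF f]) (auto simp: h_def indicator_def)
  have "(\<lambda>m. \<integral>x. \<bar>h n x - k m x\<bar> \<partial>lborel) \<longlonglongrightarrow> (\<integral>x. 0 \<partial>(lborel :: 'a measure))"
  proof (rule integral_dominated_convergence)
    show "integrable lborel (\<lambda>x::'a. 2 * real n * indicator (cball 0 (real n + 1)) x)"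
      using emeasure_lborel_cball_finite by (intro integrable_mult_right integrable_real_indicator) auto
    show "AE x in lborel. norm \<bar>h n x - k m x\<bar> \<le> 2 * real n * indicator (cball 0 (real n + 1)) x" for m
    proof (intro AE_I2)
      fix x
      have *: "\<bar>max (- real n) (min (real n) a)\<bar> \<le> real n" for a by auto
      have "\<bar>k m x\<bar> \<le> 1 * real n"
        unfolding k_def abs_mult by (intro mult_mono *) auto
      moreover have "\<bar>h n x\<bar> \<le> real n" using *[of "f x"] by (auto simp: h_def indicator_def)
      moreover have "k m x = 0" "h n x = 0" if "norm x > real n + 1"
        using that k_out by (auto simp: h_def)
      ultimately show "norm \<bar>h n x - k m x\<bar> \<le> 2 * real n * indicator (cball 0 (real n + 1)) x"
        by (cases "norm x > real n + 1") (auto simp: indicator_def)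
    qed
    have off_N: "(\<lambda>m. \<bar>h n x - k m x\<bar>) \<longlonglongrightarrow> 0" if "x \<notin> N" for x
    proof -
      have "(\<lambda>m. k m x) \<longlonglongrightarrow> max 0 (min 1 (real n + 1 - norm x)) * max (- real n) (min (real n) (h n x))"
        unfolding k_def by (intro tendsto_intros lim that)
      also have "max 0 (min 1 (real n + 1 - norm x)) * max (- real n) (min (real n) (h n x)) = h n x"
        by (auto simp: h_def indicator_def)
      finally have "(\<lambda>m. \<bar>h n x - k m x\<bar>) \<longlonglongrightarrow> \<bar>h n x - h n x\<bar>" by (intro tendsto_intros)
      then show ?thesis by simp
    qed
    show "AE x in lborel. (\<lambda>m. \<bar>h n x - k m x\<bar>) \<longlonglongrightarrow> 0"
      using AEN by eventually_elim (rule off_N)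
  qed (use k_cont[THEN borel_measurable_continuous_onI] in simp_all)
  then have "(\<lambda>m. \<integral>x. \<bar>h n x - k m x\<bar> \<partial>lborel) \<longlonglongrightarrow> 0" by simp
  then have "\<forall>\<^sub>F m in sequentially. (\<integral>x. \<bar>h n x - k m x\<bar> \<partial>lborel) < e / 2"
    using e by (intro order_tendstoD(2)) auto
  then obtain m where m: "(\<integral>x. \<bar>h n x - k m x\<bar> \<partial>lborel) < e / 2"
    by (auto simp: eventually_sequentially)
  have k_int: "integrable lborel (k m)"
    by (rule integrable_continuous_bounded_support[OF k_cont k_out])
  have "(\<integral>x. \<bar>f x - k m x\<bar> \<partial>lborel) \<le> (\<integral>x. \<bar>f x - h n x\<bar> + \<bar>h n x - k m x\<bar> \<partial>lborel)"
    using f h_int k_int by (intro integral_mono) auto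
  also have "\<dots> = (\<integral>x. \<bar>f x - h n x\<bar> \<partial>lborel) + (\<integral>x. \<bar>h n x - k m x\<bar> \<partial>lborel)"
    using f h_int k_int by (intro Bochner_Integration.integral_add) auto
  finally have "(\<integral>x. \<bar>f x - k m x\<bar> \<partial>lborel) < e" using n m by simp
  then show ?thesis using that k_cont k_out by blast
qed

lemma mollifier_integral_reflect:
  assumes "0 < d" shows "(\<integral>y. mollifier d (x - (y::real^'n::finite)) \<partial>lborel) = 1"
  using mollifier_integral[OF assms] by (subst integral_reflect) auto

text \<open>A mollification is an average over the ball of radius \<open>d\<close>.\<close>

lemma conv_mollifier_error:
  fixes g :: "real^'n::finite \<Rightarrow> real"
  assumes d: "0 < d" and g: "integrable lborel g" and e: "\<And>y. norm (x - y) < d \<Longrightarrow> \<bar>g y - g x\<bar> \<le> e"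
  shows "\<bar>conv (mollifier d) g x - g x\<bar> \<le> e"
proof -
  let ?\<rho> = "\<lambda>y. mollifier d (x - y)"
  have i1: "integrable lborel (\<lambda>y. ?\<rho> y * g y)"
    using conv_integrable[OF mollifier_test[OF d] g] by simp
  have i2: "integrable lborel ?\<rho>" by (intro integrable_reflect mollifier_integrable d)
  have "conv (mollifier d) g x - g x = (\<integral>y. ?\<rho> y * g y \<partial>lborel) - (\<integral>y. ?\<rho> y * g x \<partial>lborel)"
    by (simp add: conv_def mollifier_integral_reflect[OF d])
  also have "\<dots> = (\<integral>y. ?\<rho> y * g y - ?\<rho> y * g x \<partial>lborel)"
    using i1 i2 by (intro Bochner_Integration.integral_diff[symmetric]) auto
  also have "norm \<dots> \<le> (\<integral>y. ?\<rho> y * e \<partial>lborel)"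
  proof (rule Bochner_Integration.integral_norm_bound_integral)
    show "norm (?\<rho> y * g y - ?\<rho> y * g x) \<le> ?\<rho> y * e" for y
    proof (cases "norm (x - y) < d")
      case True
      then have "?\<rho> y * \<bar>g y - g x\<bar> \<le> ?\<rho> y * e" using e by (intro mult_left_mono mollifier_nonneg)
      moreover have "norm (?\<rho> y * g y - ?\<rho> y * g x) = ?\<rho> y * \<bar>g y - g x\<bar>"
        by (simp add: right_diff_distrib[symmetric] abs_mult mollifier_nonneg)
      ultimately show ?thesis by simp
    qed (use d in \<open>simp add: mollifier_outside\<close>)
  qed (use i1 i2 in auto)
  also have "\<dots> = e" by (simp add: mollifier_integral_reflect[OF d])
  finally show ?thesis by simp
qed

lemma conv_L1:
  fixes f :: "real^'n::finite \<Rightarrow> 'b::{banach, second_countable_topology}"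
  assumes d: "0 < d" and f: "integrable lborel f"
  shows "integrable lborel (conv (mollifier d) f)"
    and "(\<integral>x. norm (conv (mollifier d) f x) \<partial>lborel) \<le> (\<integral>x. norm (f x) \<partial>lborel)"
proof -
  have [measurable]: "f \<in> borel_measurable borel" using f by auto
  have [measurable]: "conv (mollifier d) f \<in> borel_measurable borel" by (rule conv_measurable) auto
  have le: "(\<integral>\<^sup>+x. ennreal (norm (conv (mollifier d) f x)) \<partial>lborel) \<le> (\<integral>\<^sup>+x. ennreal (norm (f x)) \<partial>lborel)"
    using conv_Lp_contraction[OF d f, of 1] by simp
  have fin: "(\<integral>\<^sup>+x. ennreal (norm (f x)) \<partial>lborel) < \<infinity>"
    using f by (simp add: integrable_iff_bounded)
  show int: "integrable lborel (conv (mollifier d) f)"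
    using le fin by (intro integrableI_bounded) auto
  show "(\<integral>x. norm (conv (mollifier d) f x) \<partial>lborel) \<le> (\<integral>x. norm (f x) \<partial>lborel)"
    using le int f by (simp add: nn_integral_eq_integral)
qed

text \<open>For continuous functions with bounded support the convergence is uniform. The general case follows
  by approximation, as mollification is a contraction of \<open>L\<^sup>1\<close>.\<close>

lemma conv_tendsto_L1:
  fixes f :: "real^'n::finite \<Rightarrow> real"
  assumes f: "integrable lborel f" and d: "\<And>n. 0 < d n" "d \<longlonglongrightarrow> 0"
  shows "(\<lambda>n. \<integral>x. norm (conv (mollifier (d n)) f x - f x) \<partial>lborel) \<longlonglongrightarrow> 0"
proof (rule LIMSEQ_I)
  fix r :: real assume r: "0 < r"
  obtain g R where g: "continuous_on UNIV g" "\<And>x. norm x > R \<Longrightarrow> g x = 0" "(\<integral>x. \<bar>f x - g x\<bar> \<partial>lborel) < r / 4"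
    using integrable_approx_continuous[OF f, of "r / 4"] r by auto
  have gi: "integrable lborel g" by (rule integrable_continuous_bounded_support[OF g(1,2)])
  define v where "v = measure lborel (cball (0::real^'n) (R + 1))"
  have v: "0 \<le> v" by (simp add: v_def)
  define e where "e = r / (4 * (v + 1))"
  have e: "0 < e" "e * v \<le> r / 4" using r v by (auto simp: e_def field_simps)
  obtain D where D: "0 < D" "\<And>x y. norm (x - y) < D \<Longrightarrow> norm (g x - g y) \<le> e"
    using uniform_continuity_bounded_support[OF g(1,2) e(1)] by blast
  have "\<forall>\<^sub>F n in sequentially. d n < min D 1" using D(1) d by (intro order_tendstoD(2)[of _ 0]) auto
  then obtain M where M: "\<And>n. n \<ge> M \<Longrightarrow> d n < min D 1" by (auto simp: eventually_sequentially)
  have "norm ((\<integral>x. norm (conv (mollifier (d n)) f x - f x) \<partial>lborel) - 0) < r" if "n \<ge> M" for n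
  proof -
    let ?c = "conv (mollifier (d n))"
    note c = conv_L1[OF d(1)[of n]]
    have err: "\<bar>?c g x - g x\<bar> \<le> e * indicator (cball 0 (R + 1)) x" for x
    proof (cases "norm x \<le> R + 1")
      case True
      have "\<bar>?c g x - g x\<bar> \<le> e"
        by (intro conv_mollifier_error d gi D(2)[unfolded real_norm_def]) (use M[OF that] in \<open>auto simp: norm_minus_commute\<close>)
      then show ?thesis using True by simp
    next
      case False
      have "?c g x = 0"
        by (rule conv_outside[of R _ "d n"]) (use g(2) mollifier_outside[OF d(1)] M[OF that] False in auto)
      then show ?thesis using False g(2) by simp
    qed
    note c1 = conv_L1(1)[OF d(1)[of n]]
    have iA: "integrable lborel (\<lambda>x. norm (?c (\<lambda>x. f x - g x) x))"
      by (intro integrable_norm c1 Bochner_Integration.integrable_diff f gi)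
    have iB: "integrable lborel (\<lambda>x. \<bar>?c g x - g x\<bar>)"
      by (intro integrable_abs c1 Bochner_Integration.integrable_diff gi)
    have iC: "integrable lborel (\<lambda>x. \<bar>f x - g x\<bar>)"
      by (intro integrable_abs Bochner_Integration.integrable_diff f gi)
    have iD: "integrable lborel (\<lambda>x. norm (?c f x - f x))"
      by (intro integrable_norm c1 Bochner_Integration.integrable_diff f)
    have "(\<integral>x. norm (?c f x - f x) \<partial>lborel)
        \<le> (\<integral>x. norm (?c (\<lambda>x. f x - g x) x) + (\<bar>?c g x - g x\<bar> + \<bar>f x - g x\<bar>) \<partial>lborel)"
    proof (rule integral_mono[OF iD])
      show "integrable lborel (\<lambda>x. norm (?c (\<lambda>x. f x - g x) x) + (\<bar>?c g x - g x\<bar> + \<bar>f x - g x\<bar>))"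
        by (intro Bochner_Integration.integrable_add iA iB iC)
      fix x
      show "norm (?c f x - f x) \<le> norm (?c (\<lambda>x. f x - g x) x) + (\<bar>?c g x - g x\<bar> + \<bar>f x - g x\<bar>)"
        unfolding conv_diff[OF mollifier_test[OF d(1)] f gi] real_norm_def by linarith
    qed
    also have "\<dots> = (\<integral>x. norm (?c (\<lambda>x. f x - g x) x) \<partial>lborel)
        + ((\<integral>x. \<bar>?c g x - g x\<bar> \<partial>lborel) + (\<integral>x. \<bar>f x - g x\<bar> \<partial>lborel))"
      unfolding Bochner_Integration.integral_add[OF iA Bochner_Integration.integrable_add[OF iB iC]]
        Bochner_Integration.integral_add[OF iB iC] ..
    also have "(\<integral>x. norm (?c (\<lambda>x. f x - g x) x) \<partial>lborel) \<le> (\<integral>x. norm (f x - g x) \<partial>lborel)"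
      using f gi by (intro c(2)) auto
    also have "(\<integral>x. \<bar>?c g x - g x\<bar> \<partial>lborel) \<le> (\<integral>x. e * indicator (cball 0 (R + 1)) x \<partial>(lborel :: (real^'n) measure))"
    proof (rule integral_mono[OF iB])
      show "integrable lborel (\<lambda>x::real^'n. e * indicator (cball 0 (R + 1)) x)"
        using emeasure_lborel_cball_finite by (intro integrable_mult_right integrable_real_indicator) auto
    qed (rule err)
    also have "\<dots> = e * v" by (simp add: v_def)
    finally have "(\<integral>x. norm (?c f x - f x) \<partial>lborel) \<le> r / 4 + (r / 4 + r / 4)"
      using e(2) g(3) by simp
    then show ?thesis using r by simp
  qed
  then show "\<exists>no. \<forall>n\<ge>no. norm ((\<integral>x. norm (conv (mollifier (d n)) f x - f x) \<partial>lborel) - 0) < r" by blast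
qed

text \<open>Convergence in \<open>L\<^sup>1\<close> implies convergence almost everywhere along a subsequence of the radii.\<close>

lemma conv_AE_subseq:
  fixes f :: "real^'n::finite \<Rightarrow> real"
  assumes f: "integrable lborel f"
  obtains d where "\<And>n. 0 < d n" "\<And>n. d n \<le> 1" "d \<longlonglongrightarrow> 0"
    "AE x in lborel. (\<lambda>n. conv (mollifier (d n)) f x) \<longlonglongrightarrow> f x"
proof -
  define d where "d n = inverse (real (Suc n))" for n
  have d: "0 < d n" "d n \<le> 1" for n by (auto simp: d_def divide_simps)
  have d0: "d \<longlonglongrightarrow> 0" unfolding d_def by (rule LIMSEQ_inverse_real_of_nat)
  have "\<exists>r. strict_mono r \<and> (AE x in lborel. (\<lambda>n. conv (mollifier (d (r n))) f x - f x) \<longlonglongrightarrow> 0)"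
    using conv_L1[OF d(1) f] f by (intro tendsto_L1_AE_subseq conv_tendsto_L1 d d0 f) auto
  then obtain r where r: "strict_mono r"
    "AE x in lborel. (\<lambda>n. conv (mollifier (d (r n))) f x - f x) \<longlonglongrightarrow> 0" by blast
  show ?thesis
  proof (rule that[of "d \<circ> r"])
    show "(d \<circ> r) \<longlonglongrightarrow> 0" by (rule LIMSEQ_subseq_LIMSEQ[OF d0 r(1)])
    show "AE x in lborel. (\<lambda>n. conv (mollifier ((d \<circ> r) n)) f x) \<longlonglongrightarrow> f x"
      using r(2) by (simp add: LIM_zero_iff)
  qed (auto simp: d)
qed

section \<open>Weak gradients\<close>

lemma integrable_test_scaleR:
  fixes f :: "real^'n::finite \<Rightarrow> 'b::{banach, second_countable_topology}"
  assumes f: "\<And>C. compact C \<Longrightarrow> set_integrable lborel C f" and g: "continuous_on UNIV g"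
    and R: "\<And>x. norm x > R \<Longrightarrow> g x = 0"
  shows "integrable lborel (\<lambda>x. g x *\<^sub>R f x)"
proof -
  obtain B where B: "\<And>x. norm (g x) \<le> B" by (rule bounded_continuous_bounded_support[OF g R]) blast+
  have "integrable lborel (\<lambda>x. indicator (cball 0 R) x *\<^sub>R f x)"
    using f[of "cball 0 R"] by (simp add: set_integrable_def)
  then have "integrable lborel (\<lambda>x. g x *\<^sub>R (indicator (cball 0 R) x *\<^sub>R f x))"
    by (rule integrable_bounded_scaleR[where B=B]) (use B g borel_measurable_continuous_onI in auto)
  moreover have "(\<lambda>x. g x *\<^sub>R (indicator (cball 0 R) x *\<^sub>R f x)) = (\<lambda>x. g x *\<^sub>R f x)"
    using R by (force simp: fun_eq_iff indicator_def not_le)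
  ultimately show ?thesis by simp
qed

lemma set_integrable_times_test:
  fixes f :: "real^'n::finite \<Rightarrow> real"
  assumes f: "\<And>C. compact C \<Longrightarrow> set_integrable lborel C f" and \<phi>: "\<phi> \<in> test_functions"
  shows "integrable lborel (\<lambda>x. f x * \<phi> x)"
proof -
  obtain R where R: "\<And>x. norm x > R \<Longrightarrow> \<phi> x = 0" by (rule test_support[OF \<phi>]) blast
  show ?thesis using integrable_test_scaleR[OF f test_continuous[OF \<phi>] R] by (simp add: mult.commute)
qed

text \<open>The functions \<open>y \<mapsto> mollifier d (x - y)\<close> are test functions, so the mollifications of \<open>f\<close> vanish; they
  converge to \<open>f\<close>.\<close>

lemma fundamental_lemma:
  fixes f :: "real^'n::finite \<Rightarrow> real"
  assumes f: "\<And>C. compact C \<Longrightarrow> set_integrable lborel C f"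
    and 0: "\<And>\<phi>. \<phi> \<in> test_functions \<Longrightarrow> (\<integral>x. f x * \<phi> x \<partial>lborel) = 0"
  shows "AE x in lborel. f x = 0"
proof -
  have "AE x in lborel. norm x < real n \<longrightarrow> f x = 0" for n
  proof -
    let ?g = "\<lambda>x. indicator (cball 0 (real n + 1)) x *\<^sub>R f x"
    have "integrable lborel ?g" using f[of "cball 0 (real n + 1)"] by (simp add: set_integrable_def)
    then obtain d where d: "\<And>n. 0 < d n" "\<And>n. d n \<le> 1"
      "AE x in lborel. (\<lambda>n. conv (mollifier (d n)) ?g x) \<longlonglongrightarrow> ?g x"
      by (rule conv_AE_subseq) blast
    have c0: "conv (mollifier (d m)) ?g x = 0" if x: "norm x < real n" for m x
    proof -
      have "mollifier (d m) (x - y) *\<^sub>R ?g y = f y * mollifier (d m) (x - y)" for y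
      proof (cases "norm y \<le> real n + 1")
        case False
        then have "d m \<le> norm (x - y)"
          using norm_triangle_ineq2[of y x] x d(2)[of m] by (simp add: norm_minus_commute)
        then show ?thesis using d(1) by (simp add: mollifier_outside)
      qed simp
      then show ?thesis
        unfolding conv_def by (simp only: 0 test_reflect mollifier_test d(1))
    qed
    show ?thesis
      using d(3)
    proof eventually_elim
      case (elim x)
      show ?case
      proof
        assume x: "norm x < real n"
        then have "(\<lambda>n. 0) \<longlonglongrightarrow> f x" using elim by (simp add: c0[unfolded real_scaleR_def])
        then show "f x = 0" by (simp add: LIMSEQ_const_iff)
      qed
    qed
  qed
  then have "AE x in lborel. \<forall>n::nat. norm x < real n \<longrightarrow> f x = 0"
    unfolding AE_all_countable by blast
  then show ?thesis
    by eventually_elim (use reals_Archimedean2 in blast)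
qed

lemma has_weak_gradient_nth_integrable:
  assumes "has_weak_gradient u G" "compact C"
  shows "set_integrable lborel C (\<lambda>x. G x $ i)"
proof -
  have "integrable lborel (\<lambda>x. indicator C x *\<^sub>R G x)"
    using assms by (auto simp: has_weak_gradient_def set_integrable_def)
  then have "integrable lborel (\<lambda>x. (indicator C x *\<^sub>R G x) $ i)"
    by (rule integrable_bounded_linear[OF bounded_linear_vec_nth])
  then show ?thesis by (simp add: set_integrable_def)
qed

lemma has_weak_gradientD:
  assumes "has_weak_gradient u G" "\<phi> \<in> test_functions"
  shows "(\<integral>x. u x * partial i \<phi> x \<partial>lborel) = - (\<integral>x. G x $ i * \<phi> x \<partial>lborel)"
  using assms unfolding has_weak_gradient_def by blast

lemma weak_gradient_unique:
  fixes u :: "real^'n::finite \<Rightarrow> real"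
  assumes G: "has_weak_gradient u G" and H: "has_weak_gradient u H"
  shows "AE x in lborel. G x = H x"
proof -
  have "AE x in lborel. G x $ i - H x $ i = 0" for i
  proof (rule fundamental_lemma)
    show "set_integrable lborel C (\<lambda>x. G x $ i - H x $ i)" if "compact C" for C
      using G H that by (intro set_integral_diff has_weak_gradient_nth_integrable)
    show "(\<integral>x. (G x $ i - H x $ i) * \<phi> x \<partial>lborel) = 0" if \<phi>: "\<phi> \<in> test_functions" for \<phi>
    proof -
      have iG: "integrable lborel (\<lambda>x. G x $ i * \<phi> x)" and iH: "integrable lborel (\<lambda>x. H x $ i * \<phi> x)"
        by (intro set_integrable_times_test \<phi> has_weak_gradient_nth_integrable[OF G]
            has_weak_gradient_nth_integrable[OF H]; assumption)+
      have "(\<integral>x. G x $ i * \<phi> x \<partial>lborel) = (\<integral>x. H x $ i * \<phi> x \<partial>lborel)"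
        using has_weak_gradientD[OF G \<phi>, of i] has_weak_gradientD[OF H \<phi>, of i] by simp
      then show ?thesis using iG iH by (simp add: left_diff_distrib Bochner_Integration.integral_diff)
    qed
  qed
  then have "AE x in lborel. \<forall>i. G x $ i - H x $ i = 0" unfolding AE_all_countable by blast
  then show ?thesis by eventually_elim (simp add: vec_eq_iff)
qed

text \<open>This replaces the arbitrary choice made in \<open>weak_gradient\<close> by any weak gradient at hand.\<close>

lemma weak_gradient_AE_eq:
  assumes "has_weak_gradient u G"
  shows "has_weak_gradient u (weak_gradient u)" "AE x in lborel. weak_gradient u x = G x"
proof -
  show "has_weak_gradient u (weak_gradient u)"
    unfolding weak_gradient_def by (rule someI[of _ G]) fact
  then show "AE x in lborel. weak_gradient u x = G x"
    by (rule weak_gradient_unique[OF _ assms])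
qed

text \<open>By translation invariance the difference quotients have integral 0.\<close>

lemma integral_partial_test:
  fixes \<phi> :: "real^'n::finite \<Rightarrow> real"
  assumes \<phi>: "\<phi> \<in> test_functions"
  shows "(\<integral>x. partial i \<phi> x \<partial>lborel) = 0"
proof -
  obtain R where R: "\<And>x. norm x > R \<Longrightarrow> \<phi> x = 0" by (rule test_support[OF \<phi>]) blast
  obtain L where L: "0 \<le> L" "\<And>x. norm (gradient \<phi> x) \<le> L" by (rule test_gradient_bounded[OF \<phi>]) blast
  define t where "t n = inverse (real (Suc n))" for n
  have t: "0 < t n" "t n \<le> 1" for n by (auto simp: t_def divide_simps)
  have t0: "t \<longlonglongrightarrow> 0" unfolding t_def by (rule LIMSEQ_inverse_real_of_nat)
  let ?e = "axis i 1 :: real^'n"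
  let ?q = "\<lambda>n x. (\<phi> (t n *\<^sub>R ?e + x) - \<phi> x) / t n"
  have [measurable]: "\<phi> \<in> borel_measurable borel" "partial i \<phi> \<in> borel_measurable borel"
    using test_measurable \<phi> test_partial by auto
  have "(\<lambda>n. \<integral>x. ?q n x \<partial>lborel) \<longlonglongrightarrow> (\<integral>x. partial i \<phi> x \<partial>lborel)"
  proof (rule integral_dominated_convergence)
    show "integrable lborel (\<lambda>x::real^'n. L * indicator (cball 0 (R + 1)) x)"
      using emeasure_lborel_cball_finite by (intro integrable_mult_right integrable_real_indicator) auto
    show "AE x in lborel. norm (?q n x) \<le> L * indicator (cball 0 (R + 1)) x" for n
    proof (intro AE_I2)
      fix x
      show "norm (?q n x) \<le> L * indicator (cball 0 (R + 1)) x"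
      proof (cases "norm x \<le> R + 1")
        case True
        have "\<bar>\<phi> (t n *\<^sub>R ?e + x) - \<phi> x\<bar> \<le> L * norm (t n *\<^sub>R ?e + x - x)"
          by (intro Lipschitz_of_gradient_bound L test_differentiable \<phi>)
        then show ?thesis using True t(1)[of n] by (simp add: abs_divide norm_axis_1 pos_divide_le_eq)
      next
        case False
        have "norm x \<le> norm (t n *\<^sub>R ?e + x) + t n"
          using norm_triangle_ineq4[of "t n *\<^sub>R ?e + x" "t n *\<^sub>R ?e"] t(1)[of n] by (simp add: norm_axis_1)
        then have "norm (t n *\<^sub>R ?e + x) > R" using False t(2)[of n] by simp
        then show ?thesis using False R by simp
      qed
    qed
    show "AE x in lborel. (\<lambda>n. ?q n x) \<longlonglongrightarrow> partial i \<phi> x"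
      using test_difference_quotient_tendsto[OF \<phi> t(1) t0, of _ ?e]
      by (simp add: add.commute inner_axis gradient_def)
  qed auto
  moreover have zero: "(\<integral>x. ?q n x \<partial>lborel) = 0" for n
    using test_integrable[OF \<phi>] integrable_translate[OF test_integrable[OF \<phi>], of "t n *\<^sub>R ?e"]
      integral_translate[OF test_measurable[OF \<phi>], of "t n *\<^sub>R ?e"]
    by simp
  ultimately have "(\<lambda>n. 0) \<longlonglongrightarrow> (\<integral>x. partial i \<phi> x \<partial>lborel)"
    by (simp only: zero)
  then show ?thesis by (simp add: LIMSEQ_const_iff)
qed

lemma integration_by_parts:
  fixes \<phi> :: "real^'n::finite \<Rightarrow> real"
  assumes \<phi>: "\<phi> \<in> test_functions" and \<psi>: "\<psi> \<in> test_functions"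
  shows "(\<integral>x. \<phi> x * partial i \<psi> x \<partial>lborel) = - (\<integral>x. partial i \<phi> x * \<psi> x \<partial>lborel)"
proof -
  have m: "(\<lambda>x. \<phi> x * \<psi> x) \<in> test_functions"
    by (intro test_mult \<psi> test_C_diff[OF \<phi>])
  have i1: "integrable lborel (\<lambda>x. \<phi> x * partial i \<psi> x)"
    by (intro test_integrable test_mult test_partial \<psi> test_C_diff[OF \<phi>])
  have i2: "integrable lborel (\<lambda>x. partial i \<phi> x * \<psi> x)"
    by (intro test_integrable test_mult \<psi> test_C_diff[OF test_partial[OF \<phi>]])
  have "0 = (\<integral>x. partial i (\<lambda>x. \<phi> x * \<psi> x) x \<partial>lborel)"
    using integral_partial_test[OF m] by simp
  also have "\<dots> = (\<integral>x. \<phi> x * partial i \<psi> x + partial i \<phi> x * \<psi> x \<partial>lborel)"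
    by (simp add: partial_mult test_differentiable \<phi> \<psi>)
  also have "\<dots> = (\<integral>x. \<phi> x * partial i \<psi> x \<partial>lborel) + (\<integral>x. partial i \<phi> x * \<psi> x \<partial>lborel)"
    by (rule Bochner_Integration.integral_add[OF i1 i2])
  finally show ?thesis by simp
qed

section \<open>Approximation in D1p by test functions\<close>

lemma conv_Lipschitz:
  fixes g :: "real^'n::finite \<Rightarrow> real"
  assumes d: "0 < d" and g: "integrable lborel g" and L: "\<And>x y. \<bar>g x - g y\<bar> \<le> L * norm (x - y)"
  shows "\<bar>conv (mollifier d) g x - conv (mollifier d) g y\<bar> \<le> L * norm (x - y)"
proof -
  have [measurable]: "g \<in> borel_measurable borel" using g by auto
  have int: "integrable lborel (\<lambda>z. mollifier d z * g (x - z))" for x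
    using integrable_reflect[OF conv_integrable[OF mollifier_test[OF d] g, of x], of x] by simp
  have "conv (mollifier d) g x - conv (mollifier d) g y
      = (\<integral>z. mollifier d z * g (x - z) - mollifier d z * g (y - z) \<partial>lborel)"
    by (simp add: conv_reflect Bochner_Integration.integral_diff[OF int int])
  also have "norm \<dots> \<le> (\<integral>z. mollifier d z * (L * norm (x - y)) \<partial>(lborel :: (real^'n) measure))"
  proof (rule Bochner_Integration.integral_norm_bound_integral)
    show "integrable lborel (\<lambda>z. mollifier d z * g (x - z) - mollifier d z * g (y - z))"
      by (intro Bochner_Integration.integrable_diff int)
    show "integrable lborel (\<lambda>z::real^'n. mollifier d z * (L * norm (x - y)))"
      by (intro integrable_mult_left mollifier_integrable d)
    fix z
    have "mollifier d z * \<bar>g (x - z) - g (y - z)\<bar> \<le> mollifier d z * (L * norm (x - y))"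
      using L[of "x - z" "y - z"] by (intro mult_left_mono mollifier_nonneg) simp
    then show "norm (mollifier d z * g (x - z) - mollifier d z * g (y - z)) \<le> mollifier d z * (L * norm (x - y))"
      by (simp add: right_diff_distrib[symmetric] abs_mult mollifier_nonneg)
  qed
  also have "\<dots> = L * norm (x - y)" by (simp add: mollifier_integral d)
  finally show ?thesis by simp
qed

text \<open>A mollified radial tent function: mollification preserves bounds and Lipschitz constants.\<close>

lemma cutoff_exists:
  fixes R :: real
  assumes R: "1 < R"
  obtains \<eta> :: "real^'n::finite \<Rightarrow> real" where "\<eta> \<in> test_functions" "\<And>x. 0 \<le> \<eta> x" "\<And>x. \<eta> x \<le> 1"
    "\<And>x. norm x < R - 1 \<Longrightarrow> \<eta> x = 1"
    "\<And>x. norm (gradient \<eta> x) \<le> 1 / R"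
    "\<And>x. norm x < R - 1 \<Longrightarrow> gradient \<eta> x = 0"
    "\<And>x. norm x > 2 * R + 1 \<Longrightarrow> gradient \<eta> x = 0"
proof -
  define \<zeta> where "\<zeta> x = max 0 (min 1 (2 - norm x / R))" for x :: "real^'n"
  define \<eta> where "\<eta> = conv (mollifier 1) \<zeta>"
  have cont: "continuous_on UNIV \<zeta>" unfolding \<zeta>_def using R by (intro continuous_intros) auto
  have out: "\<zeta> x = 0" if "norm x > 2 * R" for x using that R by (simp add: \<zeta>_def field_simps)
  have int: "integrable lborel \<zeta>" by (rule integrable_continuous_bounded_support[OF cont out])
  have bd: "0 \<le> \<zeta> x" "\<zeta> x \<le> 1" for x by (auto simp: \<zeta>_def)
  have lip: "\<bar>\<zeta> x - \<zeta> y\<bar> \<le> 1 / R * norm (x - y)" for x y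
  proof -
    have "\<bar>max 0 (min 1 a) - max 0 (min 1 b)\<bar> \<le> \<bar>a - b\<bar>" for a b :: real by auto
    then have "\<bar>\<zeta> x - \<zeta> y\<bar> \<le> \<bar>(2 - norm x / R) - (2 - norm y / R)\<bar>" unfolding \<zeta>_def .
    also have "\<dots> = \<bar>norm x - norm y\<bar> / R"
      using R by (simp add: diff_divide_distrib[symmetric] abs_divide abs_minus_commute)
    also have "\<dots> \<le> norm (x - y) / R" using R by (intro divide_right_mono norm_triangle_ineq3) auto
    finally show ?thesis by simp
  qed
  have test: "\<eta> \<in> test_functions" unfolding \<eta>_def by (rule conv_mollifier_test[OF _ int out]) auto
  have out\<eta>: "\<eta> x = 0" if "norm x > 2 * R + 1" for x
    unfolding \<eta>_def
    by (rule conv_outside[of "2 * R" _ 1]) (use out mollifier_outside[of 1] that in auto)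
  have one: "\<eta> x = 1" if "norm x < R - 1" for x
  proof -
    have z: "\<zeta> y = 1" if "norm y \<le> R" for y using that R by (simp add: \<zeta>_def field_simps)
    have "\<bar>\<eta> x - \<zeta> x\<bar> \<le> 0"
      unfolding \<eta>_def
    proof (rule conv_mollifier_error[OF _ int])
      fix y assume "norm (x - y) < 1"
      then have "norm y \<le> R" using norm_triangle_ineq2[of y x] \<open>norm x < R - 1\<close> by (simp add: norm_minus_commute)
      then show "\<bar>\<zeta> y - \<zeta> x\<bar> \<le> 0" using z \<open>norm x < R - 1\<close> by simp
    qed simp
    then show ?thesis using z[of x] that by simp
  qed
  have nn: "0 \<le> \<eta> x" for x
    unfolding \<eta>_def conv_def by (intro Bochner_Integration.integral_nonneg) (simp add: mollifier_nonneg bd)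
  have le1: "\<eta> x \<le> 1" for x
  proof -
    have "\<eta> x \<le> (\<integral>y. mollifier 1 (x - y) \<partial>lborel)"
      unfolding \<eta>_def conv_def
    proof (rule integral_mono)
      show "integrable lborel (\<lambda>y. mollifier 1 (x - y) *\<^sub>R \<zeta> y)" by (intro conv_integrable mollifier_test int) simp
      show "integrable lborel (\<lambda>y. mollifier 1 (x - y))" by (intro integrable_reflect mollifier_integrable) simp
      show "mollifier 1 (x - y) *\<^sub>R \<zeta> y \<le> mollifier 1 (x - y)" for y
        using bd by (simp add: mult_left_le mollifier_nonneg)
    qed
    then show ?thesis by (simp add: mollifier_integral_reflect)
  qed
  have grad: "norm (gradient \<eta> x) \<le> 1 / R" for x
    by (intro gradient_bound_of_Lipschitz test_differentiable test)
      (auto simp: \<eta>_def intro: conv_Lipschitz[OF _ int lip, simplified])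
  have grad0: "gradient \<eta> x = 0" if "norm x < R - 1" for x
  proof -
    have "(\<eta> has_derivative (\<lambda>h. 0)) (at x)"
      by (rule has_derivative_transform_within_open[of "\<lambda>x. 1" _ x UNIV "ball 0 (R - 1)" \<eta>])
        (use that one in auto)
    then show ?thesis using partial_eqI[of \<eta> "\<lambda>h. 0" x] by (simp add: gradient_def vec_eq_iff)
  qed
  have grad0': "gradient \<eta> x = 0" if "norm x > 2 * R + 1" for x
    by (rule gradient_zero_outside[OF out\<eta> that])
  show ?thesis by (rule that[OF test nn le1 one grad grad0 grad0'])
qed

lemma partial_reflect:
  assumes "\<rho> \<in> test_functions"
  shows "partial i (\<lambda>y. \<rho> (x - y)) y = - partial i \<rho> (x - y)"
proof -
  have "((\<lambda>y. \<rho> (x - y)) has_derivative (\<lambda>h. gradient \<rho> (x - y) \<bullet> (- h))) (at y)"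
    by (rule has_derivative_compose[of "\<lambda>y. x - y" _ _ _ \<rho>])
      (auto intro!: derivative_eq_intros has_derivative_gradient test_differentiable assms)
  from partial_eqI[OF this] show ?thesis by (simp add: gradient_def inner_axis)
qed

text \<open>The weak gradient of \<open>u\<close> is tested with \<open>y \<mapsto> \<eta>(y) mollifier d (x - y)\<close>.\<close>

lemma gradient_conv_cutoff:
  fixes u :: "real^'n::finite \<Rightarrow> real"
  assumes G: "has_weak_gradient u G" and \<eta>: "\<eta> \<in> test_functions" and d: "0 < d"
  defines "f \<equiv> \<lambda>x. \<eta> x *\<^sub>R u x"
    and "V \<equiv> \<lambda>x. \<eta> x *\<^sub>R G x + u x *\<^sub>R gradient \<eta> x"
  shows "integrable lborel f" "integrable lborel V"
    "gradient (conv (mollifier d) f) = conv (mollifier d) V"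
proof -
  obtain R where R: "\<And>x. norm x > R \<Longrightarrow> \<eta> x = 0" by (rule test_support[OF \<eta>]) blast
  have setu: "\<And>C. compact C \<Longrightarrow> set_integrable lborel C u" and setG: "\<And>C. compact C \<Longrightarrow> set_integrable lborel C G"
    using G by (auto simp: has_weak_gradient_def)
  show f: "integrable lborel f"
    unfolding f_def by (rule integrable_test_scaleR[OF setu test_continuous[OF \<eta>] R])
  have comp: "integrable lborel (\<lambda>x. partial i \<eta> x *\<^sub>R u x)" for i
    by (rule integrable_test_scaleR[OF setu test_continuous[OF test_partial[OF \<eta>]] partial_zero_outside[OF R]])
  have "(\<lambda>x. u x *\<^sub>R gradient \<eta> x) = (\<lambda>x. \<Sum>i\<in>UNIV. (partial i \<eta> x *\<^sub>R u x) *\<^sub>R axis i 1)"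
    by (simp add: fun_eq_iff vec_eq_iff gradient_def axis_def if_distrib[where f="\<lambda>x. _ * x"] sum.delta cong: if_cong)
  moreover have "integrable lborel (\<lambda>x. \<Sum>i\<in>UNIV. (partial i \<eta> x *\<^sub>R u x) *\<^sub>R (axis i 1 :: real^'n))"
    by (intro Bochner_Integration.integrable_sum integrable_scaleR_left comp)
  ultimately have ug: "integrable lborel (\<lambda>x. u x *\<^sub>R gradient \<eta> x)" by simp
  show V: "integrable lborel V"
    unfolding V_def
    by (intro Bochner_Integration.integrable_add ug integrable_test_scaleR[OF setG test_continuous[OF \<eta>] R])
  show "gradient (conv (mollifier d) f) = conv (mollifier d) V"
  proof
    fix x
    have "gradient (conv (mollifier d) f) x $ i = conv (mollifier d) V x $ i" for i
    proof -
      let ?\<rho> = "mollifier d :: real^'n \<Rightarrow> real"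
      have \<rho>: "?\<rho> \<in> test_functions" by (rule mollifier_test[OF d])
      let ?\<chi> = "\<lambda>y. \<eta> y * ?\<rho> (x - y)"
      have \<chi>: "?\<chi> \<in> test_functions" by (intro test_mult test_reflect \<rho> test_C_diff[OF \<eta>])
      have p: "partial i ?\<chi> y = partial i \<eta> y * ?\<rho> (x - y) - \<eta> y * partial i ?\<rho> (x - y)" for y
        by (simp add: partial_mult test_differentiable \<eta> test_reflect \<rho> partial_reflect)
      have i1: "integrable lborel (\<lambda>y. ?\<rho> (x - y) * (partial i \<eta> y * u y))"
        using conv_integrable[OF \<rho> comp, of x i] by simp
      have i2: "integrable lborel (\<lambda>y. partial i ?\<rho> (x - y) * f y)"
        using conv_integrable[OF test_partial[OF \<rho>] f, of i x] by simp
      have VG: "integrable lborel (\<lambda>y. ?\<rho> (x - y) *\<^sub>R V y)"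
        by (rule conv_integrable[OF \<rho> V])
      have i3: "integrable lborel (\<lambda>y. G y $ i * ?\<chi> y)"
        by (rule set_integrable_times_test[OF has_weak_gradient_nth_integrable[OF G] \<chi>])
      have "(\<integral>y. u y * partial i ?\<chi> y \<partial>lborel)
          = (\<integral>y. ?\<rho> (x - y) * (partial i \<eta> y * u y) - partial i ?\<rho> (x - y) * f y \<partial>lborel)"
        by (intro Bochner_Integration.integral_cong) (simp_all add: p f_def algebra_simps)
      also have "\<dots> = (\<integral>y. ?\<rho> (x - y) * (partial i \<eta> y * u y) \<partial>lborel) - (\<integral>y. partial i ?\<rho> (x - y) * f y \<partial>lborel)"
        by (rule Bochner_Integration.integral_diff[OF i1 i2])
      finally have "(\<integral>y. partial i ?\<rho> (x - y) * f y \<partial>lborel)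
          = (\<integral>y. ?\<rho> (x - y) * (partial i \<eta> y * u y) \<partial>lborel) + (\<integral>y. G y $ i * ?\<chi> y \<partial>lborel)"
        using has_weak_gradientD[OF G \<chi>, of i] by simp
      also have "\<dots> = (\<integral>y. ?\<rho> (x - y) * (partial i \<eta> y * u y) + G y $ i * ?\<chi> y \<partial>lborel)"
        by (rule Bochner_Integration.integral_add[OF i1 i3, symmetric])
      also have "\<dots> = (\<integral>y. (?\<rho> (x - y) *\<^sub>R V y) $ i \<partial>lborel)"
        by (intro Bochner_Integration.integral_cong) (simp_all add: V_def gradient_def algebra_simps)
      also have "\<dots> = conv ?\<rho> V x $ i"
        unfolding conv_def by (rule integral_bounded_linear[OF bounded_linear_vec_nth VG])
      finally show ?thesis
        by (simp add: gradient_def conv_partial[OF \<rho> f]) (simp add: conv_def)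
    qed
    then show "gradient (conv (mollifier d) f) x = conv (mollifier d) V x" by (simp add: vec_eq_iff)
  qed
qed

lemma L2_set_nth_measurable[measurable]: "(\<lambda>x::real^'n::finite. L2_set (($) x) K) \<in> borel_measurable borel"
  unfolding L2_set_def by (intro borel_measurable_continuous_onI continuous_intros)

lemma weighted_integral_Fatou:
  fixes f :: "real^'n::finite \<Rightarrow> real"
  assumes q: "0 < q" and g: "\<And>n. g n \<in> borel_measurable borel"
    and lim: "AE x in lborel. (\<lambda>n. g n x) \<longlonglongrightarrow> f x"
  shows "weighted_integral K \<beta> q f \<le> liminf (\<lambda>n. weighted_integral K \<beta> q (g n))"
proof -
  have "weighted_integral K \<beta> q f
      \<le> (\<integral>\<^sup>+x. liminf (\<lambda>n. ennreal (\<bar>g n x\<bar> powr q / (L2_set (($) x) K) powr \<beta>)) \<partial>lborel)"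
    unfolding weighted_integral_def
  proof (rule nn_integral_mono_AE, use lim in eventually_elim)
    case (elim x)
    have "(\<lambda>n. \<bar>g n x\<bar> powr q / (L2_set (($) x) K) powr \<beta>) \<longlonglongrightarrow> \<bar>f x\<bar> powr q / (L2_set (($) x) K) powr \<beta>"
      unfolding divide_inverse
      by (intro tendsto_mult tendsto_const tendsto_powr' tendsto_rabs elim) (use q in auto)
    then have "(\<lambda>n. ennreal (\<bar>g n x\<bar> powr q / (L2_set (($) x) K) powr \<beta>))
        \<longlonglongrightarrow> ennreal (\<bar>f x\<bar> powr q / (L2_set (($) x) K) powr \<beta>)"
      by (rule tendsto_ennrealI)
    from lim_imp_Liminf[OF _ this] show ?case by simp
  qed
  also have "\<dots> \<le> liminf (\<lambda>n. \<integral>\<^sup>+x. ennreal (\<bar>g n x\<bar> powr q / (L2_set (($) x) K) powr \<beta>) \<partial>lborel)"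
    by (rule nn_integral_liminf) (use g in measurable)
  finally show ?thesis unfolding weighted_integral_def .
qed


text \<open>Convexity with weights \<open>1 - l\<close> and \<open>l\<close>. For small \<open>l\<close> the factor of the main term is close to 1, at the
  cost of a large factor of the perturbation.\<close>

lemma powr_add_le_scaled:
  fixes a b l p :: real
  assumes "0 \<le> a" "0 \<le> b" "0 < l" "l < 1" "1 \<le> p"
  shows "(a + b) powr p \<le> (1 - l) powr (1 - p) * a powr p + l powr (1 - p) * b powr p"
proof -
  have "(a + b) powr p = ((1 - l) * (a / (1 - l)) + l * (b / l)) powr p" using assms by simp
  also have "\<dots> \<le> (1 - l) * (a / (1 - l)) powr p + l * (b / l) powr p"
    using assms by (intro powr_convex_combination) auto
  also have "\<dots> = (1 - l) powr (1 - p) * a powr p + l powr (1 - p) * b powr p"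
    using assms by (simp add: powr_divide powr_diff)
  finally show ?thesis .
qed

text \<open>The approximation is a mollification of \<open>\<eta> u\<close>, where the cut-off function \<open>\<eta>\<close> changes from 1 to 0
  between radii of order \<open>R\<close>. Mollification does not increase the \<open>p\<close>-norm of the gradient
  \<open>\<eta>\<nabla>u + u\<nabla>\<eta>\<close>, so only the second term must be small. On its support \<open>\<bar>u\<nabla>\<eta>\<bar>\<^sup>p \<le> \<bar>u\<bar>\<^sup>pR\<^sup>-\<^sup>p\<close>, and Young's
  inequality with exponents \<open>r = N/(N - p)\<close>, \<open>s = N/p\<close> and a factor \<open>M\<close> bounds this by
  \<open>M\<^sup>r\<bar>u\<bar>\<^sup>p\<^sup>* + M\<^sup>-\<^sup>sR\<^sup>-\<^sup>N\<close>. The second summand has an integral of order \<open>M\<^sup>-\<^sup>s\<close> over the ball of radius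
  \<open>3R\<close>, for every \<open>R\<close>; so \<open>M\<close> is fixed first. Then \<open>R\<close> is taken so large that the first summand, a
  tail of a convergent integral, is small too.\<close>

lemma test_approximation:
  fixes u :: "real^'n::finite \<Rightarrow> real"
  assumes u: "u \<in> D1p p" and p: "1 < p" "p < real CARD('n)" and q: "0 < q"
    and W: "weighted_integral K \<beta> q u = 1" and e: "0 < e" "e < 1"
  obtains \<phi> where "\<phi> \<in> test_functions"
    "Lp_power p (gradient \<phi>) \<le> dirichlet_energy p u + ennreal e"
    "ennreal (1 - e) \<le> weighted_integral K \<beta> q \<phi>"
proof -
  define N where "N = real CARD('n)"
  define ps where "ps = N * p / (N - p)"
  define r where "r = N / (N - p)"
  define s where "s = N / p"
  have Np: "0 < N - p" "0 < N" using p by (auto simp: N_def)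
  have r: "1 < r" and s: "1 < s" and rs: "1 / r + 1 / s = 1"
    using p Np by (auto simp: r_def s_def N_def field_simps)
  have pr: "p * r = ps" and psN: "p * s = N" using p by (auto simp: r_def ps_def s_def)
  define G where "G = weak_gradient u"
  have G: "has_weak_gradient u G" and [measurable]: "u \<in> borel_measurable borel"
    and up: "(\<integral>\<^sup>+x. ennreal (\<bar>u x\<bar> powr ps) \<partial>lborel) < \<infinity>"
    and Gp: "Lp_power p G < \<infinity>"
    using u by (auto simp: D1p_def G_def ps_def N_def)
  have [measurable]: "G \<in> borel_measurable borel" using G by (simp add: has_weak_gradient_def)
  obtain E where E: "0 \<le> E" "Lp_power p G = ennreal E"
    using Gp by (cases "\<integral>\<^sup>+x. ennreal (norm (G x) powr p) \<partial>lborel") auto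

  \<comment> \<open>The weight \<open>l\<close> in the convexity inequality for \<open>\<bar>\<eta>\<nabla>u + u\<nabla>\<eta>\<bar>\<^sup>p\<close>.\<close>
  have "((\<lambda>l. (1 - l) powr (1 - p) * E) \<longlongrightarrow> (1 - 0) powr (1 - p) * E) (at_right 0)"
    by (intro tendsto_intros) auto
  then have "\<forall>\<^sub>F l in at_right 0. (1 - l) powr (1 - p) * E < E + e / 3"
    using e by (intro order_tendstoD(2)) auto
  moreover have "\<forall>\<^sub>F l in at_right (0::real). l < 1" by (rule order_tendstoD(2)[OF tendsto_ident_at]) simp
  moreover have "\<forall>\<^sub>F l in at_right (0::real). 0 < l" by (simp add: eventually_at_right_less)
  ultimately have "\<forall>\<^sub>F l in at_right 0. (1 - l) powr (1 - p) * E < E + e / 3 \<and> l < 1 \<and> 0 < l"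
    by eventually_elim simp
  then obtain l where l: "(1 - l) powr (1 - p) * E < E + e / 3" "0 < l" "l < 1"
    using eventually_happens[of _ "at_right (0::real)"] by auto
  define A where "A = l powr (1 - p)"
  have A: "0 < A" using l by (simp add: A_def)
  define v where "v = unit_ball_vol (real CARD('n)) * 3 ^ CARD('n)"
  have v: "0 \<le> v" by (simp add: v_def)
  have "((\<lambda>M. A * (v * M powr (- s))) \<longlongrightarrow> A * (v * 0)) at_top"
    using s by (intro tendsto_intros tendsto_neg_powr filterlim_ident) auto
  then have "\<forall>\<^sub>F M in at_top. A * (v * M powr (- s)) < e / 3"
    using e by (intro order_tendstoD(2)) auto
  then have "\<forall>\<^sub>F M in at_top. A * (v * M powr (- s)) < e / 3 \<and> 0 < M"
    using eventually_gt_at_top[of "0::real"] by eventually_elim simp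
  then obtain M where M: "A * (v * M powr (- s)) < e / 3" "0 < M"
    using eventually_happens[of _ "at_top :: real filter"] by auto

  define R where "R n = real n + 2" for n
  define tail where "tail n = (\<integral>\<^sup>+x. ennreal (indicator {x::real^'n. R n - 1 \<le> norm x} x * \<bar>u x\<bar> powr ps) \<partial>lborel)" for n
  have ind[measurable]: "{x::real^'n. R n - 1 \<le> norm x} \<in> sets borel" for n by measurable
  have "tail \<longlonglongrightarrow> (\<integral>\<^sup>+x. 0 \<partial>(lborel :: (real^'n) measure))"
    unfolding tail_def
  proof (rule nn_integral_dominated_convergence[OF _ _ _ _ up])
    show "AE x in lborel. (\<lambda>n. ennreal (indicator {x::real^'n. R n - 1 \<le> norm x} x * \<bar>u x\<bar> powr ps)) \<longlonglongrightarrow> 0"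
    proof (intro AE_I2 tendsto_eventually)
      fix x :: "real^'n"
      obtain m where m: "norm x \<le> real m" using real_arch_simple by blast
      show "\<forall>\<^sub>F n in sequentially. ennreal (indicator {x::real^'n. R n - 1 \<le> norm x} x * \<bar>u x\<bar> powr ps) = 0"
        using eventually_ge_at_top[of m] by eventually_elim (use m in \<open>auto simp: R_def indicator_def\<close>)
    qed
  qed (auto simp: indicator_def)
  then have tail0: "tail \<longlonglongrightarrow> 0" by simp
  \<comment> \<open>The bound for the tail that makes the contribution of the first summand at most \<open>e / 3\<close>.\<close>
  define c where "c = e / (3 * (A * M powr r))"
  have c: "0 < c" using e A M by (simp add: c_def)
  have ev_tail: "\<forall>\<^sub>F n in sequentially. tail n < ennreal c"
    using tail0 c by (intro order_tendstoD(2)) auto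

  have "\<exists>\<eta> :: real^'n \<Rightarrow> real. \<eta> \<in> test_functions \<and> (\<forall>x. 0 \<le> \<eta> x) \<and> (\<forall>x. \<eta> x \<le> 1) \<and>
    (\<forall>x. norm x < R n - 1 \<longrightarrow> \<eta> x = 1) \<and> (\<forall>x. norm (gradient \<eta> x) \<le> 1 / R n) \<and>
    (\<forall>x. norm x < R n - 1 \<longrightarrow> gradient \<eta> x = 0) \<and> (\<forall>x. norm x > 2 * R n + 1 \<longrightarrow> gradient \<eta> x = 0)" for n
    by (rule cutoff_exists[of "R n"]) (auto simp: R_def)
  then obtain \<eta> :: "nat \<Rightarrow> real^'n \<Rightarrow> real" where \<eta>: "\<And>n. \<eta> n \<in> test_functions" "\<And>n x. 0 \<le> \<eta> n x" "\<And>n x. \<eta> n x \<le> 1"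
    "\<And>n x. norm x < R n - 1 \<Longrightarrow> \<eta> n x = 1" "\<And>n x. norm (gradient (\<eta> n) x) \<le> 1 / R n"
    "\<And>n x. norm x < R n - 1 \<Longrightarrow> gradient (\<eta> n) x = 0" "\<And>n x. norm x > 2 * R n + 1 \<Longrightarrow> gradient (\<eta> n) x = 0"
    by metis
  have [measurable]: "\<eta> n \<in> borel_measurable borel" for n by (rule test_measurable[OF \<eta>(1)])
  have "weighted_integral K \<beta> q u \<le> liminf (\<lambda>n. weighted_integral K \<beta> q (\<lambda>x. \<eta> n x *\<^sub>R u x))"
  proof (rule weighted_integral_Fatou[OF q], measurable, intro AE_I2 tendsto_eventually)
    fix x :: "real^'n"
    obtain m where m: "norm x \<le> real m" using real_arch_simple by blast
    show "\<forall>\<^sub>F n in sequentially. \<eta> n x *\<^sub>R u x = u x"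
      using eventually_ge_at_top[of m]
    proof eventually_elim
      case (elim n)
      then have "\<eta> n x = 1" using m by (intro \<eta>(4)) (simp add: R_def)
      then show ?case by simp
    qed
  qed
  moreover have "ennreal (1 - e / 2) < weighted_integral K \<beta> q u"
    using e unfolding W by (simp flip: ennreal_1 add: ennreal_less_iff)
  ultimately have "\<forall>\<^sub>F n in sequentially. ennreal (1 - e / 2) < weighted_integral K \<beta> q (\<lambda>x. \<eta> n x *\<^sub>R u x)"
    by (intro less_LiminfD) (rule less_le_trans)
  with ev_tail have "\<forall>\<^sub>F n in sequentially. tail n < ennreal c \<and>
      ennreal (1 - e / 2) < weighted_integral K \<beta> q (\<lambda>x. \<eta> n x *\<^sub>R u x)"
    by eventually_elim simp
  then obtain n where n: "tail n < ennreal c"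
    "ennreal (1 - e / 2) < weighted_integral K \<beta> q (\<lambda>x. \<eta> n x *\<^sub>R u x)"
    using eventually_happens[of _ sequentially] by auto

  define f where "f x = \<eta> n x *\<^sub>R u x" for x
  define V where "V x = \<eta> n x *\<^sub>R G x + u x *\<^sub>R gradient (\<eta> n) x" for x
  have f: "integrable lborel f" and V: "integrable lborel V"
    and grad: "gradient (conv (mollifier d) f) = conv (mollifier d) V" if "0 < d" for d
    using gradient_conv_cutoff[OF G \<eta>(1)[of n] that] unfolding f_def[abs_def] V_def[abs_def] by auto
  have f: "integrable lborel f" and V: "integrable lborel V" using f[of 1] V[of 1] by auto
  have R1: "1 < R n" by (simp add: R_def)

  have young: "(\<bar>u x\<bar> * norm (gradient (\<eta> n) x)) powr p
      \<le> M powr r * (indicator {x. R n - 1 \<le> norm x} x * \<bar>u x\<bar> powr ps)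
        + (M powr (- s) * R n powr (- N)) * indicator (cball 0 (3 * R n)) x" (is "?l \<le> ?r") for x
  proof (cases "gradient (\<eta> n) x = 0")
    case True
    then show ?thesis by simp
  next
    case False
    then have x: "R n - 1 \<le> norm x" "norm x \<le> 3 * R n"
      using \<eta>(6)[where n=n and x=x] \<eta>(7)[where n=n and x=x] R1 by force+
    have "?l \<le> (\<bar>u x\<bar> * (1 / R n)) powr p"
      using p \<eta>(5) by (intro powr_mono2 mult_left_mono) auto
    also have "\<dots> = (M * \<bar>u x\<bar> powr p) * (R n powr (- p) / M)"
    proof -
      have "(1 / R n) powr p = R n powr (- p)"
        using R1 by (simp add: powr_divide powr_minus_divide)
      then have "(\<bar>u x\<bar> * (1 / R n)) powr p = \<bar>u x\<bar> powr p * R n powr (- p)"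
        using R1 by (subst powr_mult) auto
      then show ?thesis using M by simp
    qed
    also have "\<dots> \<le> (M * \<bar>u x\<bar> powr p) powr r / r + (R n powr (- p) / M) powr s / s"
      using r s rs M R1 by (intro Youngs_inequality) auto
    also have "\<dots> \<le> (M * \<bar>u x\<bar> powr p) powr r + (R n powr (- p) / M) powr s"
    proof -
      have "X / a \<le> X" if "0 \<le> X" "1 < a" for X a :: real
        using that mult_left_mono[of 1 a X] by (simp add: pos_divide_le_eq)
      then show ?thesis using r s by (intro add_mono) auto
    qed
    also have "(M * \<bar>u x\<bar> powr p) powr r = M powr r * \<bar>u x\<bar> powr ps"
      using M by (simp add: powr_mult powr_powr pr)
    also have "(R n powr (- p) / M) powr s = M powr (- s) * R n powr (- N)"
    proof -
      have "(R n powr (- p) / M) powr s = (R n powr (- p)) powr s / M powr s"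
        by (rule powr_divide)
      also have "(R n powr (- p)) powr s = R n powr (- N)" by (simp add: powr_powr psN)
      finally show ?thesis by (simp add: powr_minus_divide[of M])
    qed
    finally show ?thesis using x by simp
  qed
  have V_le: "norm (V x) powr p \<le> (1 - l) powr (1 - p) * norm (G x) powr p
      + (A * M powr r * (indicator {x. R n - 1 \<le> norm x} x * \<bar>u x\<bar> powr ps)
        + A * (M powr (- s) * R n powr (- N)) * indicator (cball 0 (3 * R n)) x)" for x
  proof -
    have "norm (V x) \<le> norm (\<eta> n x *\<^sub>R G x) + norm (u x *\<^sub>R gradient (\<eta> n) x)"
      unfolding V_def by (rule norm_triangle_ineq)
    also have "\<dots> \<le> norm (G x) + \<bar>u x\<bar> * norm (gradient (\<eta> n) x)"
      using \<eta>(2,3) by (simp add: mult_left_le_one_le)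
    finally have "norm (V x) powr p \<le> (norm (G x) + \<bar>u x\<bar> * norm (gradient (\<eta> n) x)) powr p"
      using p by (intro powr_mono2) auto
    also have "\<dots> \<le> (1 - l) powr (1 - p) * norm (G x) powr p + A * (\<bar>u x\<bar> * norm (gradient (\<eta> n) x)) powr p"
      unfolding A_def using p l by (intro powr_add_le_scaled) auto
    also have "A * (\<bar>u x\<bar> * norm (gradient (\<eta> n) x)) powr p \<le>
       A * (M powr r * (indicator {x. R n - 1 \<le> norm x} x * \<bar>u x\<bar> powr ps)
        + (M powr (- s) * R n powr (- N)) * indicator (cball 0 (3 * R n)) x)"
      using A by (intro mult_left_mono young) auto
    finally show ?thesis by (simp add: algebra_simps)
  qed
  have vol: "R n powr (- N) * measure lborel (cball (0::real^'n) (3 * R n)) = v"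
  proof -
    have "R n powr (- N) = 1 / R n ^ CARD('n)"
      using R1 by (simp add: N_def powr_minus powr_realpow divide_inverse)
    then show ?thesis using R1 by (simp add: content_cball v_def power_mult_distrib)
  qed
  have "Lp_power p V
      \<le> (\<integral>\<^sup>+x. ennreal ((1 - l) powr (1 - p)) * ennreal (norm (G x) powr p)
      + (ennreal (A * M powr r) * ennreal (indicator {x. R n - 1 \<le> norm x} x * \<bar>u x\<bar> powr ps)
        + ennreal (A * (M powr (- s) * R n powr (- N))) * indicator (cball 0 (3 * R n)) x) \<partial>lborel)"
  proof (rule nn_integral_mono)
    fix x :: "real^'n"
    show "ennreal (norm (V x) powr p) \<le> ennreal ((1 - l) powr (1 - p)) * ennreal (norm (G x) powr p)
      + (ennreal (A * M powr r) * ennreal (indicator {x. R n - 1 \<le> norm x} x * \<bar>u x\<bar> powr ps)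
        + ennreal (A * (M powr (- s) * R n powr (- N))) * indicator (cball 0 (3 * R n)) x)"
      using ennreal_leI[OF V_le[of x]] A
      by (simp add: ennreal_mult ennreal_plus ennreal_indicator del: ennreal_plus[symmetric])
  qed
  also have "\<dots> = ennreal ((1 - l) powr (1 - p)) * ennreal E + (ennreal (A * M powr r) * tail n
      + ennreal (A * (M powr (- s) * R n powr (- N))) * emeasure lborel (cball (0::real^'n) (3 * R n)))"
    by (simp add: nn_integral_add nn_integral_cmult E(2) tail_def)
  also have "\<dots> \<le> ennreal (E + e / 3) + (ennreal (e / 3) + ennreal (e / 3))"
  proof (intro add_mono)
    show "ennreal ((1 - l) powr (1 - p)) * ennreal E \<le> ennreal (E + e / 3)"
      using l E by (simp add: ennreal_mult[symmetric] ennreal_leI)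
    have "ennreal (A * M powr r) * tail n \<le> ennreal (A * M powr r) * ennreal c"
      using n by (intro mult_left_mono) auto
    also have "\<dots> = ennreal (e / 3)"
      using A M c by (simp add: ennreal_mult[symmetric] c_def)
    finally show "ennreal (A * M powr r) * tail n \<le> ennreal (e / 3)" .
    have "emeasure lborel (cball (0::real^'n) (3 * R n)) = ennreal (measure lborel (cball (0::real^'n) (3 * R n)))"
      using emeasure_lborel_cball_finite[of "0::real^'n" "3 * R n"] by (intro emeasure_eq_ennreal_measure) auto
    then have "ennreal (A * (M powr (- s) * R n powr (- N))) * emeasure lborel (cball (0::real^'n) (3 * R n))
        = ennreal (A * (M powr (- s) * (R n powr (- N) * measure lborel (cball (0::real^'n) (3 * R n)))))"
      using A by (simp add: ennreal_mult[symmetric] mult.assoc)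
    also have "\<dots> \<le> ennreal (e / 3)"
      unfolding vol using M by (intro ennreal_leI) (simp add: mult.commute[of v])
    finally show "ennreal (A * (M powr (- s) * R n powr (- N))) * emeasure lborel (cball (0::real^'n) (3 * R n))
        \<le> ennreal (e / 3)" .
  qed
  also have "\<dots> = ennreal E + ennreal e"
    using E e by (simp add: ennreal_plus[symmetric] del: ennreal_plus)
  finally have V_energy: "Lp_power p V \<le> ennreal E + ennreal e" .

  obtain d where d: "\<And>j. 0 < d j" "AE x in lborel. (\<lambda>j. conv (mollifier (d j)) f x) \<longlonglongrightarrow> f x"
    by (rule conv_AE_subseq[OF f]) blast
  obtain S where S: "\<And>x. norm x > S \<Longrightarrow> \<eta> n x = 0" by (rule test_support[OF \<eta>(1)[of n]]) blast
  have t: "conv (mollifier (d j)) f \<in> test_functions" for j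
    by (rule conv_mollifier_test[OF d(1) f, of S]) (simp add: f_def S)
  have "weighted_integral K \<beta> q f \<le> liminf (\<lambda>j. weighted_integral K \<beta> q (conv (mollifier (d j)) f))"
    by (rule weighted_integral_Fatou[OF q test_measurable[OF t] d(2)])
  moreover have "ennreal (1 - e / 2) < weighted_integral K \<beta> q f" using n(2) by (simp add: f_def[abs_def])
  ultimately have "\<forall>\<^sub>F j in sequentially. ennreal (1 - e / 2) < weighted_integral K \<beta> q (conv (mollifier (d j)) f)"
    by (intro less_LiminfD) (rule less_le_trans)
  then obtain j where j: "ennreal (1 - e / 2) < weighted_integral K \<beta> q (conv (mollifier (d j)) f)"
    using eventually_happens[of _ sequentially] by auto
  show ?thesis
  proof (rule that[OF t[of j]])
    have "(\<integral>\<^sup>+x. ennreal (norm (gradient (conv (mollifier (d j)) f) x) powr p) \<partial>lborel)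
        \<le> Lp_power p V"
      unfolding grad[OF d(1)] using p by (intro conv_Lp_contraction d V) simp
    also have "\<dots> \<le> dirichlet_energy p u + ennreal e"
      using V_energy by (simp add: dirichlet_energy_def G_def[symmetric] E(2))
    finally show "(\<integral>\<^sup>+x. ennreal (norm (gradient (conv (mollifier (d j)) f) x) powr p) \<partial>lborel)
        \<le> dirichlet_energy p u + ennreal e" .
    have "ennreal (1 - e) \<le> ennreal (1 - e / 2)" using e by (intro ennreal_leI) simp
    then show "ennreal (1 - e) \<le> weighted_integral K \<beta> q (conv (mollifier (d j)) f)"
      using j by simp
  qed
qed

section \<open>Reflections\<close>

text \<open>An isometry maps balls to balls of the same measure. By Vitali's covering theorem an open set is a
  disjoint union of balls up to a null set, so its preimage has at least its measure; applied to the
  preimage this gives the reverse inequality.\<close>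

lemma distr_involutive_isometry:
  fixes T :: "'a::euclidean_space \<Rightarrow> 'a"
  assumes inv: "\<And>x. T (T x) = x" and iso: "\<And>x y. dist (T x) (T y) = dist x y"
  shows "distr lborel borel T = lborel"
proof -
  have cont: "continuous_on UNIV T"
    unfolding continuous_on_iff using iso by metis
  have [measurable]: "T \<in> borel_measurable borel" by (rule borel_measurable_continuous_onI[OF cont])
  have ball: "T -` ball c r = ball (T c) r" for c r
    using iso[of "T c"] inv by (auto simp: ball_def)
  have le: "emeasure lborel U \<le> emeasure lborel (T -` U)" if U: "open U" for U
  proof -
    let ?K = "{(c, r). 0 < r \<and> ball c r \<subseteq> U}"
    have vit: "\<exists>i. i \<in> ?K \<and> x \<in> ball (fst i) (snd i) \<and> snd i < d" if "x \<in> U" "0 < d" for x d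
    proof -
      obtain e where e: "0 < e" "ball x e \<subseteq> U" using U \<open>x \<in> U\<close> by (meson open_contains_ball)
      then have "ball x (min e (d/2)) \<subseteq> U" by auto
      then show ?thesis using e \<open>0 < d\<close> by (intro exI[of _ "(x, min e (d/2))"]) auto
    qed
    obtain C where C: "countable C" "C \<subseteq> ?K"
      "pairwise (\<lambda>i j. disjnt (ball (fst i) (snd i)) (ball (fst j) (snd j))) C"
      "negligible (U - (\<Union>i\<in>C. ball (fst i) (snd i)))"
      by (rule Vitali_covering_theorem_balls[of U ?K fst snd, OF vit])
    let ?B = "\<lambda>i. ball (fst i) (snd i)"
    let ?V = "\<Union>i\<in>C. ?B i"
    have disj: "disjoint_family_on ?B C"
      using C(3) by (simp add: disjoint_family_on_def pairwise_def disjnt_def)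
    have disj': "disjoint_family_on (\<lambda>i. T -` ?B i) C"
      unfolding disjoint_family_on_def
    proof (intro ballI impI)
      fix i j assume "i \<in> C" "j \<in> C" "i \<noteq> j"
      then have "?B i \<inter> ?B j = {}" using disj unfolding disjoint_family_on_def by blast
      then show "T -` ?B i \<inter> T -` ?B j = {}" by (simp only: vimage_Int[symmetric] vimage_empty)
    qed
    have V: "?V \<in> sets borel" "U \<in> sets borel" using U by (auto intro!: borel_open)
    have VU: "?V \<subseteq> U" using C(2) by fastforce
    have "U - ?V \<in> null_sets lborel"
      using C(4) V null_sets_completion_iff[of "U - ?V" lborel] by (simp add: negligible_iff_null_sets)
    then have "emeasure lborel U = emeasure lborel ?V"
      using V VU emeasure_Un_null_set[of ?V lborel "U - ?V"] by (simp add: Un_absorb1)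
    also have "\<dots> = (\<integral>\<^sup>+i. emeasure lborel (?B i) \<partial>count_space C)"
      using C(1) disj by (intro emeasure_UN_countable) auto
    also have "\<dots> = (\<integral>\<^sup>+i. emeasure lborel (T -` ?B i) \<partial>count_space C)"
      using C(2) by (intro nn_integral_cong) (auto simp: ball emeasure_ball)
    also have "\<dots> = emeasure lborel (\<Union>i\<in>C. T -` ?B i)"
      using C(1) disj' by (intro emeasure_UN_countable[symmetric]) (simp_all add: ball)
    also have "\<dots> \<le> emeasure lborel (T -` U)"
      using VU U by (intro emeasure_mono) (auto intro!: borel_open open_vimage cont)
    finally show ?thesis .
  qed
  have eq: "emeasure lborel (T -` U) = emeasure lborel U" if U: "open U" for U
  proof (rule antisym)
    have "T -` (T -` U) = U" using inv by auto
    then show "emeasure lborel (T -` U) \<le> emeasure lborel U"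
      using le[OF open_vimage[OF U cont]] by simp
  qed (rule le[OF U])
  show ?thesis
  proof (rule lborel_eqI[symmetric])
    fix l u :: 'a assume lu: "\<And>b. b \<in> Basis \<Longrightarrow> l \<bullet> b \<le> u \<bullet> b"
    have "emeasure (distr lborel borel T) (box l u) = emeasure lborel (T -` box l u)"
      by (subst emeasure_distr) auto
    also have "\<dots> = (\<Prod>b\<in>Basis. (u - l) \<bullet> b)"
      unfolding eq[OF open_box] using lu by (simp add: emeasure_lborel_box_eq)
    finally show "emeasure (distr lborel borel T) (box l u) = (\<Prod>b\<in>Basis. (u - l) \<bullet> b)" .
  qed simp
qed

text \<open>The signed distance of \<open>x\<close> from the bisecting hyperplane of \<open>a\<close> and \<open>b\<close>, in units of the distance of
  \<open>a\<close> and \<open>b\<close>; it is negative on the side of \<open>a\<close>.\<close>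

definition side :: "'a::euclidean_space \<Rightarrow> 'a \<Rightarrow> 'a \<Rightarrow> real" where
  "side a b x = ((x - (1/2) *\<^sub>R (a + b)) \<bullet> (b - a)) / ((b - a) \<bullet> (b - a))"

text \<open>The reflection in the bisecting hyperplane, which exchanges \<open>a\<close> and \<open>b\<close>.\<close>

definition mirror :: "'a::euclidean_space \<Rightarrow> 'a \<Rightarrow> 'a \<Rightarrow> 'a" where
  "mirror a b x = x - (2 * side a b x) *\<^sub>R (b - a)"

context
  fixes a b :: "'a::euclidean_space"
  assumes ab: "a \<noteq> b"
begin

lemma inner_diff_nonzero: "(b - a) \<bullet> (b - a) \<noteq> 0"
  using ab by simp

lemma side_inner: "side a b x * ((b - a) \<bullet> (b - a)) = (x - (1/2) *\<^sub>R (a + b)) \<bullet> (b - a)"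
  using ab by (simp add: side_def)

lemma side_diff: "(side a b x - side a b y) * ((b - a) \<bullet> (b - a)) = (x - y) \<bullet> (b - a)"
proof -
  have "(side a b x - side a b y) * ((b - a) \<bullet> (b - a))
      = (x - (1/2) *\<^sub>R (a + b)) \<bullet> (b - a) - (y - (1/2) *\<^sub>R (a + b)) \<bullet> (b - a)"
    by (subst left_diff_distrib) (simp only: side_inner)
  also have "\<dots> = ((x - (1/2) *\<^sub>R (a + b)) - (y - (1/2) *\<^sub>R (a + b))) \<bullet> (b - a)"
    by (rule inner_diff_left[symmetric])
  finally show ?thesis by simp
qed

lemma side_mirror: "side a b (mirror a b x) = - side a b x"
proof -
  have "(side a b (mirror a b x) - side a b x) * ((b - a) \<bullet> (b - a)) = (- 2 * side a b x) * ((b - a) \<bullet> (b - a))"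
    unfolding side_diff by (simp add: mirror_def)
  then have "side a b (mirror a b x) - side a b x = - 2 * side a b x"
    by (simp only: mult_right_cancel[OF inner_diff_nonzero])
  then show ?thesis by simp
qed

lemma mirror_mirror: "mirror a b (mirror a b x) = x"
  using side_mirror[of x] by (simp add: mirror_def)

lemma side_left: "side a b a = - 1 / 2"
proof -
  have "side a b a * ((b - a) \<bullet> (b - a)) = (- 1 / 2) * ((b - a) \<bullet> (b - a))"
    unfolding side_inner by (simp add: algebra_simps)
  then show ?thesis by (simp only: mult_right_cancel[OF inner_diff_nonzero])
qed

lemma mirror_left: "mirror a b a = b"
  by (simp add: mirror_def side_left)

lemma norm_diff_mirror: "(norm (x - mirror a b y))\<^sup>2 = (norm (x - y))\<^sup>2 + 4 * side a b x * side a b y * ((b - a) \<bullet> (b - a))"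
proof -
  have sq: "(norm (z + k *\<^sub>R v))\<^sup>2 = (norm z)\<^sup>2 + 2 * k * (z \<bullet> v) + k\<^sup>2 * (v \<bullet> v)" for z v :: 'a and k :: real
    unfolding power2_norm_eq_inner
    by (simp add: inner_add_left inner_add_right inner_commute power2_eq_square)
  have "x - mirror a b y = (x - y) + (2 * side a b y) *\<^sub>R (b - a)" by (simp add: mirror_def)
  then have "(norm (x - mirror a b y))\<^sup>2
      = (norm (x - y))\<^sup>2 + 4 * side a b y * ((x - y) \<bullet> (b - a)) + 4 * (side a b y)\<^sup>2 * ((b - a) \<bullet> (b - a))"
    by (simp only: sq power_mult_distrib) simp
  also have "(x - y) \<bullet> (b - a) = (side a b x - side a b y) * ((b - a) \<bullet> (b - a))" by (simp only: side_diff)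
  finally show ?thesis by (simp add: algebra_simps power2_eq_square)
qed

lemma norm_mirror_diff: "norm (mirror a b x - mirror a b y) = norm (x - y)"
proof -
  have "(norm (mirror a b x - mirror a b y))\<^sup>2 = (norm (mirror a b x - y))\<^sup>2 + 4 * side a b (mirror a b x) * side a b y * ((b - a) \<bullet> (b - a))"
    by (rule norm_diff_mirror)
  also have "(norm (mirror a b x - y))\<^sup>2 = (norm (x - y))\<^sup>2 + 4 * side a b y * side a b x * ((b - a) \<bullet> (b - a))"
    using norm_diff_mirror[of y x] by (simp add: norm_minus_commute)
  finally show ?thesis by (simp add: side_mirror)
qed

lemma norm_mirror_commute: "norm (mirror a b x - y) = norm (x - mirror a b y)"
  using norm_mirror_diff[of x "mirror a b y"] by (simp add: mirror_mirror)

lemma norm_le_norm_mirror: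
  assumes "side a b x * side a b y \<ge> 0" shows "norm (x - y) \<le> norm (x - mirror a b y)"
proof -
  have "(norm (x - y))\<^sup>2 \<le> (norm (x - mirror a b y))\<^sup>2"
    unfolding norm_diff_mirror
    using mult_nonneg_nonneg[OF assms inner_ge_zero, of "b - a"] by (simp add: mult.assoc)
  then show ?thesis by (rule power2_le_imp_le) simp
qed

text \<open>In particular, if \<open>a\<close> is closer to the origin than \<open>b\<close>, then so is each point on the side of \<open>a\<close>
  compared with its mirror image.\<close>

lemma norm_mirror: "(norm (mirror a b x))\<^sup>2 = (norm x)\<^sup>2 - 2 * side a b x * ((norm b)\<^sup>2 - (norm a)\<^sup>2)"
proof -
  have "(norm (mirror a b x))\<^sup>2 = (norm x)\<^sup>2 - 4 * side a b x * (x \<bullet> (b - a)) + 4 * side a b x * (side a b x * ((b - a) \<bullet> (b - a)))"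
    unfolding mirror_def power2_norm_eq_inner
    by (simp add: inner_diff_left inner_diff_right inner_commute algebra_simps)
  also have "\<dots> = (norm x)\<^sup>2 - 4 * side a b x * (((1/2) *\<^sub>R (a + b)) \<bullet> (b - a))"
    unfolding side_inner by (simp add: inner_diff_left algebra_simps)
  also have "((1/2) *\<^sub>R (a + b)) \<bullet> (b - a) = ((norm b)\<^sup>2 - (norm a)\<^sup>2) / 2"
    by (simp add: power2_norm_eq_inner inner_diff_left inner_diff_right inner_add_left inner_add_right inner_commute)
  finally show ?thesis by simp
qed

lemma norm_le_mirror:
  assumes "side a b x \<le> 0" "norm a \<le> norm b" shows "(norm x)\<^sup>2 \<le> (norm (mirror a b x))\<^sup>2"
proof -
  have "(norm a)\<^sup>2 \<le> (norm b)\<^sup>2" using assms(2) by (intro power_mono) auto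
  then have "0 \<le> (- 2 * side a b x) * ((norm b)\<^sup>2 - (norm a)\<^sup>2)"
    using assms(1) by (intro mult_nonneg_nonneg[of "- 2 * side a b x"]) linarith+
  then show ?thesis unfolding norm_mirror by simp
qed

lemma mirror_continuous: "continuous_on UNIV (mirror a b)"
  unfolding mirror_def side_def using ab by (intro continuous_intros) auto

lemma mirror_measurable: "mirror a b \<in> borel_measurable borel"
  by (rule borel_measurable_continuous_onI[OF mirror_continuous])

lemma distr_mirror: "distr lborel borel (mirror a b) = lborel"
  by (rule distr_involutive_isometry) (simp_all add: mirror_mirror dist_norm norm_mirror_diff)

lemma nn_integral_mirror:
  assumes [measurable]: "f \<in> borel_measurable borel"
  shows "(\<integral>\<^sup>+x. f (mirror a b x) \<partial>lborel) = (\<integral>\<^sup>+x. f x \<partial>lborel)"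
proof -
  have [measurable]: "mirror a b \<in> borel_measurable borel" by (rule mirror_measurable)
  show ?thesis by (subst (2) distr_mirror[symmetric], subst nn_integral_distr) auto
qed

lemma integral_mirror:
  fixes f :: "'a \<Rightarrow> real"
  assumes [measurable]: "f \<in> borel_measurable borel"
  shows "(\<integral>x. f (mirror a b x) \<partial>lborel) = (\<integral>x. f x \<partial>lborel)"
proof -
  have [measurable]: "mirror a b \<in> borel_measurable borel" by (rule mirror_measurable)
  show ?thesis by (subst (2) distr_mirror[symmetric], subst integral_distr) auto
qed

lemma AE_mirror:
  assumes "AE x in lborel. P x" shows "AE x in lborel. P (mirror a b x)"
proof -
  have "mirror a b \<in> measurable lborel borel" using mirror_measurable by simp
  moreover have "AE x in distr lborel borel (mirror a b). P x" unfolding distr_mirror by fact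
  ultimately show ?thesis by (rule AE_distrD)
qed

end

section \<open>Polarization\<close>

text \<open>The larger of the values at two mirror points is put on the side of \<open>a\<close>.\<close>

definition polarize :: "'a::euclidean_space \<Rightarrow> 'a \<Rightarrow> ('a \<Rightarrow> real) \<Rightarrow> 'a \<Rightarrow> real" where
  "polarize a b w x =
     (if side a b x \<le> 0 then max (w x) (w (mirror a b x)) else min (w x) (w (mirror a b x)))"

lemma polarize_pair:
  assumes ab: "a \<noteq> b" and x: "side a b x \<le> 0"
  shows "polarize a b w x = max (w x) (w (mirror a b x))"
    and "polarize a b w (mirror a b x) = min (w x) (w (mirror a b x))"
proof -
  show "polarize a b w x = max (w x) (w (mirror a b x))" using x by (simp add: polarize_def)
  show "polarize a b w (mirror a b x) = min (w x) (w (mirror a b x))"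
  proof (cases "side a b x = 0")
    case True
    then have "mirror a b x = x" by (simp add: mirror_def)
    then show ?thesis by (simp add: polarize_def)
  next
    case False
    then show ?thesis using x
      by (simp add: polarize_def side_mirror[OF ab] mirror_mirror[OF ab] min.commute)
  qed
qed

lemma polarize_Lipschitz:
  assumes ab: "a \<noteq> b" and L: "\<And>x y. \<bar>w x - w y\<bar> \<le> L * norm (x - y)" "0 \<le> L"
  shows "\<bar>polarize a b w x - polarize a b w y\<bar> \<le> L * norm (x - y)"
proof -
  have same: "\<bar>w x - w y\<bar> \<le> L * norm (x - y)" "\<bar>w (mirror a b x) - w (mirror a b y)\<bar> \<le> L * norm (x - y)"
    using L(1)[of x y] L(1)[of "mirror a b x" "mirror a b y"] by (auto simp: norm_mirror_diff[OF ab])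
  show ?thesis
  proof (cases "side a b x \<le> 0 \<longleftrightarrow> side a b y \<le> 0")
    case True
    then show ?thesis using same by (auto simp: polarize_def max_def min_def)
  next
    case False
    then have "side a b x * side a b (mirror a b y) \<ge> 0"
      by (auto simp: side_mirror[OF ab] mult_nonneg_nonpos mult_nonpos_nonneg)
    then have le: "norm (x - mirror a b y) \<le> norm (x - y)"
      using norm_le_norm_mirror[OF ab, of x "mirror a b y"] by (simp add: mirror_mirror[OF ab])
    then have le': "L * norm (x - mirror a b y) \<le> L * norm (x - y)" by (rule mult_left_mono[OF _ L(2)])
    have "\<bar>w x - w (mirror a b y)\<bar> \<le> L * norm (x - y)"
      using L(1)[of x "mirror a b y"] le' by linarith
    moreover have "\<bar>w (mirror a b x) - w y\<bar> \<le> L * norm (x - y)"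
      using L(1)[of "mirror a b x" y] le' by (simp add: norm_mirror_commute[OF ab])
    ultimately show ?thesis using same by (auto simp: polarize_def max_def min_def)
  qed
qed

lemma abs_powr_convex: 
  assumes "1 \<le> p" shows "convex_on UNIV (\<lambda>t::real. \<bar>t\<bar> powr p)"
proof (rule convex_onI)
  fix t x y :: real assume t: "0 < t" "t < 1"
  have "\<bar>(1 - t) *\<^sub>R x + t *\<^sub>R y\<bar> \<le> (1 - t) * \<bar>x\<bar> + t * \<bar>y\<bar>"
    using abs_triangle_ineq[of "(1 - t) * x" "t * y"] t by (simp add: abs_mult)
  then have "\<bar>(1 - t) *\<^sub>R x + t *\<^sub>R y\<bar> powr p \<le> ((1 - t) * \<bar>x\<bar> + t * \<bar>y\<bar>) powr p"
    using assms by (intro powr_mono2) auto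
  also have "\<dots> \<le> (1 - t) * \<bar>x\<bar> powr p + t * \<bar>y\<bar> powr p"
    using assms t by (intro powr_convex_combination) auto
  finally show "\<bar>(1 - t) *\<^sub>R x + t *\<^sub>R y\<bar> powr p \<le> (1 - t) * \<bar>x\<bar> powr p + t * \<bar>y\<bar> powr p" .
qed simp

text \<open>The numbers \<open>a - c\<close> and \<open>b - d\<close> lie between \<open>b - c\<close> and \<open>a - d\<close> and have the same sum, so this is
  convexity of \<open>\<bar>t\<bar>\<^sup>p\<close>.\<close>

lemma abs_powr_majorization:
  fixes a b c d :: real
  assumes "1 \<le> p" "b \<le> a" "d \<le> c"
  shows "\<bar>a - c\<bar> powr p + \<bar>b - d\<bar> powr p \<le> \<bar>a - d\<bar> powr p + \<bar>b - c\<bar> powr p"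
proof (cases "(a - b) + (c - d) = 0")
  case True
  then have "a = b" "c = d" using assms by auto
  then show ?thesis by simp
next
  case False
  \<comment> \<open>The position of \<open>a - c\<close> in the interval from \<open>b - c\<close> to \<open>a - d\<close>.\<close>
  define t where "t = (a - b) / ((a - b) + (c - d))"
  have pos: "0 < (a - b) + (c - d)" using False assms by linarith
  have t: "0 \<le> t" "t \<le> 1" using assms pos by (auto simp: t_def divide_simps)
  have tm: "t * ((a - b) + (c - d)) = a - b" using False by (simp add: t_def)
  have 1: "a - c = (1 - t) *\<^sub>R (b - c) + t *\<^sub>R (a - d)" using tm by (simp add: algebra_simps)
  have 2: "b - d = (1 - t) *\<^sub>R (a - d) + t *\<^sub>R (b - c)" using tm by (simp add: algebra_simps)
  have "\<bar>a - c\<bar> powr p \<le> (1 - t) * \<bar>b - c\<bar> powr p + t * \<bar>a - d\<bar> powr p"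
    unfolding 1 by (rule convex_onD[OF abs_powr_convex[OF assms(1)]]) (use t in auto)
  moreover have "\<bar>b - d\<bar> powr p \<le> (1 - t) * \<bar>a - d\<bar> powr p + t * \<bar>b - c\<bar> powr p"
    unfolding 2 by (rule convex_onD[OF abs_powr_convex[OF assms(1)]]) (use t in auto)
  ultimately show ?thesis by (simp add: algebra_simps)
qed

text \<open>Here \<open>a, b\<close> and \<open>c, d\<close> are the values at two pairs of mirror points, \<open>k\<close> is the weight of points on the
  same side and \<open>l\<close> that of points on different sides. If both pairs are ordered alike, polarization
  changes nothing. Otherwise it exchanges the two sums, and the smaller one gets the larger weight.\<close>

lemma four_point_inequality:
  fixes a b c d k l :: real
  assumes p: "1 \<le> p" and kl: "0 \<le> l" "l \<le> k"
  shows "k * (\<bar>max a b - max c d\<bar> powr p + \<bar>min a b - min c d\<bar> powr p)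
      + l * (\<bar>max a b - min c d\<bar> powr p + \<bar>min a b - max c d\<bar> powr p)
    \<le> k * (\<bar>a - c\<bar> powr p + \<bar>b - d\<bar> powr p) + l * (\<bar>a - d\<bar> powr p + \<bar>b - c\<bar> powr p)"
proof -
  have swap: "k * X + l * Y \<le> k * Y + l * X" if "X \<le> Y" for X Y
    using mult_right_mono[OF kl(2), of "Y - X"] that by (simp add: algebra_simps)
  consider "b \<le> a \<and> d \<le> c \<or> a \<le> b \<and> c \<le> d" | "b \<le> a \<and> c \<le> d" | "a \<le> b \<and> d \<le> c" by linarith
  then show ?thesis
  proof cases
    case 1
    then show ?thesis by (auto simp: max_def min_def algebra_simps)
  next
    case 2
    have "\<bar>a - d\<bar> powr p + \<bar>b - c\<bar> powr p \<le> \<bar>a - c\<bar> powr p + \<bar>b - d\<bar> powr p"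
      using abs_powr_majorization[OF p, of b a c d] 2 by simp
    from swap[OF this] 2 show ?thesis by (simp add: max_absorb1 max_absorb2 min_absorb1 min_absorb2)
  next
    case 3
    have "\<bar>b - c\<bar> powr p + \<bar>a - d\<bar> powr p \<le> \<bar>b - d\<bar> powr p + \<bar>a - c\<bar> powr p"
      using abs_powr_majorization[OF p, of a b d c] 3 by simp
    from swap[OF this] 3 show ?thesis
      by (simp add: max_absorb1 max_absorb2 min_absorb1 min_absorb2 add.commute)
  qed
qed

definition nonlocal_energy :: "real \<Rightarrow> real \<Rightarrow> ('a::euclidean_space \<Rightarrow> real) \<Rightarrow> ennreal" where
  "nonlocal_energy p t w =
     (\<integral>\<^sup>+x. \<integral>\<^sup>+y. ennreal (if norm (x - y) < t then \<bar>w x - w y\<bar> powr p else 0) \<partial>lborel \<partial>lborel)"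

text \<open>By invariance of the measure, the energy is a quarter of the integral of the sum over the four pairs
  that arise from \<open>(x, y)\<close> by reflecting one or both points. To these sums \<open>four_point_inequality\<close>
  applies, because a point is closer to points on its own side than to their mirror images.\<close>

lemma nonlocal_energy_polarize:
  fixes w :: "'a::euclidean_space \<Rightarrow> real"
  assumes ab: "a \<noteq> b" and p: "1 \<le> p" and [measurable]: "w \<in> borel_measurable borel"
  shows "nonlocal_energy p t (polarize a b w) \<le> nonlocal_energy p t w"
proof -
  let ?m = "mirror a b"
  have [measurable]: "?m \<in> borel_measurable borel" by (rule mirror_measurable[OF ab])
  have [measurable]: "side a b \<in> borel_measurable borel" unfolding side_def by measurable
  define ind where "ind z = (if norm z < t then 1 else 0 :: real)" for z :: 'a
  define F where "F v x y = ind (x - y) * \<bar>v x - v y\<bar> powr p" for v :: "'a \<Rightarrow> real" and x y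
  have Fm[measurable]: "(\<lambda>(x, y). F v x y) \<in> borel_measurable (borel \<Otimes>\<^sub>M borel)"
    if [measurable]: "v \<in> borel_measurable borel" for v
    unfolding F_def ind_def by measurable
  have Fnn: "0 \<le> F v x y" for v x y by (simp add: F_def ind_def)
  define S where "S v x y = F v x y + F v (?m x) y + F v x (?m y) + F v (?m x) (?m y)" for v x y
  have sum: "4 * nonlocal_energy p t v = (\<integral>\<^sup>+x. \<integral>\<^sup>+y. ennreal (S v x y) \<partial>lborel \<partial>lborel)"
    if vm[measurable]: "v \<in> borel_measurable borel" for v
  proof -
    have [measurable]: "(\<lambda>(x, y). F v x y) \<in> borel_measurable (borel \<Otimes>\<^sub>M borel)" by (rule Fm[OF vm])
    have E: "nonlocal_energy p t v = (\<integral>\<^sup>+x. \<integral>\<^sup>+y. ennreal (F v x y) \<partial>lborel \<partial>lborel)"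
      unfolding nonlocal_energy_def F_def ind_def by (intro nn_integral_cong arg_cong[where f=ennreal]) simp
    have inner: "(\<integral>\<^sup>+y. ennreal (F v z (?m y)) \<partial>lborel) = (\<integral>\<^sup>+y. ennreal (F v z y) \<partial>lborel)" for z
      by (rule nn_integral_mirror[OF ab, of "\<lambda>y. ennreal (F v z y)"]) measurable
    have outer: "(\<integral>\<^sup>+x. \<integral>\<^sup>+y. ennreal (F v (?m x) y) \<partial>lborel \<partial>lborel) = nonlocal_energy p t v"
      unfolding E by (rule nn_integral_mirror[OF ab, of "\<lambda>x. \<integral>\<^sup>+y. ennreal (F v x y) \<partial>lborel"]) measurable
    have "(\<integral>\<^sup>+x. \<integral>\<^sup>+y. ennreal (S v x y) \<partial>lborel \<partial>lborel)
      = (\<integral>\<^sup>+x. (\<integral>\<^sup>+y. ennreal (F v x y) \<partial>lborel) + (\<integral>\<^sup>+y. ennreal (F v (?m x) y) \<partial>lborel)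
         + (\<integral>\<^sup>+y. ennreal (F v x (?m y)) \<partial>lborel) + (\<integral>\<^sup>+y. ennreal (F v (?m x) (?m y)) \<partial>lborel) \<partial>lborel)"
      unfolding S_def by (simp add: Fnn nn_integral_add)
    also have "\<dots> = nonlocal_energy p t v + nonlocal_energy p t v + nonlocal_energy p t v + nonlocal_energy p t v"
      unfolding inner by (simp add: nn_integral_add outer E[symmetric])
    finally have "(\<integral>\<^sup>+x. \<integral>\<^sup>+y. ennreal (S v x y) \<partial>lborel \<partial>lborel)
        = (1 + 1 + 1 + 1) * nonlocal_energy p t v" by (simp only: distrib_right mult_1)
    then show ?thesis by simp
  qed
  have S_le: "S (polarize a b w) x y \<le> S w x y" for x y
  proof -
    have m: "norm (?m x - y) = norm (x - ?m y)" "norm (?m x - ?m y) = norm (x - y)" for x y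
      by (rule norm_mirror_commute[OF ab], rule norm_mirror_diff[OF ab])
    have Sm: "S v (?m x) y = S v x y" "S v x (?m y) = S v x y" for v x y
      by (simp_all add: S_def mirror_mirror[OF ab])
    \<comment> \<open>The sum \<open>S\<close> is invariant under reflection of either point, so both may be assumed on the side of \<open>a\<close>.\<close>
    have main: "S (polarize a b w) x y \<le> S w x y" if s: "side a b x \<le> 0" "side a b y \<le> 0" for x y
    proof -
      note px = polarize_pair[OF ab, where w=w]
      let ?k = "ind (x - y)" and ?l = "ind (x - ?m y)"
      have "0 \<le> ?l" "?l \<le> ?k"
        using norm_le_norm_mirror[OF ab, of x y] s by (auto simp: ind_def mult_nonpos_nonpos)
      have k: "ind (?m x - y) = ?l" "ind (?m x - ?m y) = ?k"
        by (simp_all only: ind_def m mirror_mirror[OF ab])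
      have S_eq: "S v x y = ?k * (\<bar>v x - v y\<bar> powr p + \<bar>v (?m x) - v (?m y)\<bar> powr p)
          + ?l * (\<bar>v x - v (?m y)\<bar> powr p + \<bar>v (?m x) - v y\<bar> powr p)" for v
        unfolding S_def F_def k by (simp only: algebra_simps)
      show ?thesis
        unfolding S_eq px[OF s(1)] px[OF s(2)]
        by (rule four_point_inequality[OF p]) fact+
    qed
    consider "side a b x \<le> 0" "side a b y \<le> 0" | "side a b (?m x) \<le> 0" "side a b y \<le> 0"
      | "side a b x \<le> 0" "side a b (?m y) \<le> 0" | "side a b (?m x) \<le> 0" "side a b (?m y) \<le> 0"
      using side_mirror[OF ab] by fastforce
    then show ?thesis
      by cases (use main[of x y] main[of "?m x" y] main[of x "?m y"] main[of "?m x" "?m y"] in \<open>simp_all only: Sm\<close>)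
  qed
  have [measurable]: "polarize a b w \<in> borel_measurable borel"
    unfolding polarize_def[abs_def] by measurable
  have "4 * nonlocal_energy p t (polarize a b w) \<le> 4 * nonlocal_energy p t w"
    by (subst (1 2) sum) (auto intro!: nn_integral_mono ennreal_leI S_le)
  then show ?thesis by (simp add: ennreal_mult_le_mult_iff)
qed

section \<open>The weight\<close>

lemma AE_nth_nonzero: "AE x in lborel. (x::real^'n::finite) $ i \<noteq> 0"
proof -
  have "negligible {x::real^'n. axis i 1 \<bullet> x = 0}"
    by (intro negligible_hyperplane) (auto simp: axis_eq_0_iff)
  moreover have "{x::real^'n. axis i 1 \<bullet> x = 0} \<in> sets borel"
    by (intro borel_closed closed_hyperplane)
  ultimately have "{x::real^'n. axis i 1 \<bullet> x = 0} \<in> null_sets lborel"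
    by (simp add: negligible_iff_null_sets null_sets_completion_iff)
  from AE_not_in[OF this] show ?thesis by (simp add: inner_axis')
qed

lemma L2_set_nth_pos:
  assumes "finite K" "i \<in> K" "(x::real^'n::finite) $ i \<noteq> 0" shows "0 < L2_set (($) x) K"
  using member_le_L2_set[OF assms(1,2), of "\<lambda>i. \<bar>x $ i\<bar>"] assms(3)
  by (simp add: L2_set_def) (meson sum_pos2 assms zero_less_power2 zero_le_power2)

lemma nn_integral_powr_finite:
  fixes b R :: real
  assumes "0 \<le> b" "b < 1" "0 \<le> R"
  shows "(\<integral>\<^sup>+t. ennreal (indicator {-R..R} t * \<bar>t\<bar> powr (- b)) \<partial>lborel) < \<infinity>"
proof -
  let ?f = "\<lambda>t::real. indicator {0..R} t * \<bar>t\<bar> powr (- b)"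
  have "((\<lambda>x. x powr (- b)) has_integral (R powr (- b + 1) / (- b + 1))) {0..R}"
    using assms by (intro has_integral_powr_from_0) auto
  then have "(\<integral>\<^sup>+t. ennreal (indicator {0..R} t * t powr (- b)) \<partial>lborel) = ennreal (R powr (- b + 1) / (- b + 1))"
    by (intro nn_integral_has_integral_lebesgue[THEN trans]) (auto simp: mult.commute)
  moreover have "?f = (\<lambda>t. indicator {0..R} t * t powr (- b))" by (auto simp: fun_eq_iff indicator_def)
  ultimately have "(\<integral>\<^sup>+t. ennreal (?f t) \<partial>lborel) = ennreal (R powr (- b + 1) / (- b + 1))"
    by metis
  then have fin: "(\<integral>\<^sup>+t. ennreal (?f t) \<partial>lborel) < \<infinity>" by (simp only: ennreal_less_top infinity_ennreal_def)
  have "(\<integral>\<^sup>+t. ennreal (indicator {-R..R} t * \<bar>t\<bar> powr (- b)) \<partial>lborel)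
      \<le> (\<integral>\<^sup>+t. ennreal (?f t) + ennreal (?f (0 - t)) \<partial>lborel)"
    by (intro nn_integral_mono) (auto simp: indicator_def)
  also have "\<dots> = (\<integral>\<^sup>+t. ennreal (?f t) \<partial>lborel) + (\<integral>\<^sup>+t. ennreal (?f (0 - t)) \<partial>lborel)"
    by (intro nn_integral_add) auto
  also have "(\<integral>\<^sup>+t. ennreal (?f (0 - t)) \<partial>lborel) = (\<integral>\<^sup>+t. ennreal (?f t) \<partial>lborel)"
    by (rule nn_integral_reflect) measurable
  finally show ?thesis
    by (rule order_le_less_trans) (use fin in \<open>simp add: less_top[symmetric]\<close>)
qed

text \<open>Since \<open>\<bar>y\<bar> \<ge> \<bar>y\<^sub>i\<bar>\<close> for each of the \<open>k\<close> coordinates, \<open>\<bar>y\<bar>\<close> to the power \<open>-\<beta>\<close> is at most the product of the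
  \<open>\<bar>y\<^sub>i\<bar>\<close> to the power \<open>-\<beta>/k\<close>. This product is integrable over a cube by Fubini, as \<open>\<beta>/k < 1\<close>.\<close>

lemma weight_locally_integrable:
  fixes K :: "'n::finite set"
  assumes K: "K \<noteq> {}" and \<beta>: "0 \<le> \<beta>" "\<beta> < real (card K)" and R: "0 \<le> R"
  shows "(\<integral>\<^sup>+x. ennreal (indicator (cball (0::real^'n) R) x / (L2_set (($) x) K) powr \<beta>) \<partial>lborel) < \<infinity>"
proof -
  define b where "b = \<beta> / real (card K)"
  have cK: "0 < card K" using K by (simp add: card_gt_0_iff)
  have b: "0 \<le> b" "b < 1" using \<beta> cK by (auto simp: b_def)
  \<comment> \<open>The factor of the product that belongs to the basis vector \<open>e\<close>.\<close>
  define g where "g e t = (if e \<in> (\<lambda>i. axis i 1) ` K then indicator {-R..R} t * \<bar>t\<bar> powr (- b)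
      else indicator {-R..R} t)" for e :: "real^'n" and t :: real
  have g0: "0 \<le> g e t" for e t by (simp add: g_def)
  have [measurable]: "g e \<in> borel_measurable borel" for e unfolding g_def by measurable
  have "AE x in lborel. \<forall>i. (x::real^'n) $ i \<noteq> 0" unfolding AE_all_countable using AE_nth_nonzero by blast
  then have "AE x in lborel. ennreal (indicator (cball (0::real^'n) R) x / (L2_set (($) x) K) powr \<beta>)
      \<le> (\<Prod>e\<in>Basis. ennreal (g e (x \<bullet> e)))"
  proof eventually_elim
    case (elim x)
    show ?case
    proof (cases "norm x \<le> R")
      case True
      let ?l = "L2_set (($) x) K"
      have abs: "\<bar>x $ i\<bar> \<le> R" for i using component_le_norm_cart[of x i] True by simp
      have xK: "0 < \<bar>x $ i\<bar>" "\<bar>x $ i\<bar> \<le> ?l" if "i \<in> K" for i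
      proof -
        show "0 < \<bar>x $ i\<bar>" using elim by simp
        have "\<bar>x $ i\<bar> = sqrt ((x $ i)\<^sup>2)" by simp
        also have "\<dots> \<le> ?l" unfolding L2_set_def using that by (intro real_sqrt_le_mono member_le_sum) auto
        finally show "\<bar>x $ i\<bar> \<le> ?l" .
      qed
      have l: "0 < ?l" using K xK by (meson ex_in_conv less_le_trans)
      have "1 / ?l powr \<beta> = (\<Prod>i\<in>K. ?l powr (- b))"
        using l cK by (simp add: powr_realpow[symmetric] powr_powr b_def powr_minus_divide[symmetric])
      also have "\<dots> \<le> (\<Prod>i\<in>K. \<bar>x $ i\<bar> powr (- b))"
        using xK b by (intro prod_mono conjI powr_mono2') auto
      also have "\<dots> = (\<Prod>i\<in>UNIV. if i \<in> K then \<bar>x $ i\<bar> powr (- b) else 1)"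
        by (simp add: prod.If_cases)
      also have "\<dots> = (\<Prod>i\<in>UNIV. g (axis i 1) (x $ i))"
      proof (rule prod.cong)
        fix i
        have "x $ i \<in> {-R..R}" using abs[of i] by (simp add: abs_le_iff)
        then show "(if i \<in> K then \<bar>x $ i\<bar> powr (- b) else 1) = g (axis i 1) (x $ i)"
          by (auto simp: g_def axis_eq_axis)
      qed simp
      also have "\<dots> = (\<Prod>e\<in>Basis. g e (x \<bullet> e))"
      proof -
        have B: "(Basis :: (real^'n) set) = range (\<lambda>i. axis i 1)" by (auto simp: Basis_vec_def)
        have "inj (\<lambda>i. axis i (1::real) :: real^'n)" by (auto simp: inj_on_def axis_eq_axis)
        then show ?thesis by (simp add: B prod.reindex inner_axis)
      qed
      finally show ?thesis using True by (simp add: prod_ennreal g0 ennreal_leI)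
    qed simp
  qed
  then have "(\<integral>\<^sup>+x. ennreal (indicator (cball (0::real^'n) R) x / (L2_set (($) x) K) powr \<beta>) \<partial>lborel)
      \<le> (\<integral>\<^sup>+x. (\<Prod>e\<in>Basis. ennreal (g e (x \<bullet> e))) \<partial>lborel)"
    by (rule nn_integral_mono_AE)
  also have "\<dots> = (\<Prod>e\<in>(Basis :: (real^'n) set). (\<integral>\<^sup>+t. ennreal (g e t) \<partial>lborel))"
    by (rule nn_integral_lborel_prod) auto
  also have "\<dots> < \<infinity>"
  proof -
    have "(\<integral>\<^sup>+t. ennreal (g e t) \<partial>lborel) < \<infinity>" for e
    proof (cases "e \<in> (\<lambda>i. axis i 1) ` K")
      case True
      then show ?thesis using nn_integral_powr_finite[OF b R] by (simp add: g_def)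
    next
      case False
      then show ?thesis using R by (simp add: g_def ennreal_indicator)
    qed
    then show ?thesis by (simp add: less_top[symmetric] ennreal_prod_eq_top)
  qed
  finally show ?thesis .
qed

lemma weighted_integral_finite:
  fixes w :: "real^'n::finite \<Rightarrow> real"
  assumes K: "K \<noteq> {}" and \<beta>: "0 \<le> \<beta>" "\<beta> < real (card K)" and q: "0 \<le> q" and R: "0 \<le> R"
    and out: "\<And>x. norm x > R \<Longrightarrow> w x = 0" and B: "\<And>x. \<bar>w x\<bar> \<le> B" "0 \<le> B"
  shows "weighted_integral K \<beta> q w < \<infinity>"
proof -
  let ?g = "\<lambda>x. ennreal (indicator (cball (0::real^'n) R) x / (L2_set (($) x) K) powr \<beta>)"
  have "weighted_integral K \<beta> q w \<le> (\<integral>\<^sup>+x. ennreal (B powr q) * ?g x \<partial>lborel)"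
    unfolding weighted_integral_def
  proof (rule nn_integral_mono)
    fix x
    have "\<bar>w x\<bar> powr q / (L2_set (($) x) K) powr \<beta> \<le> B powr q * (indicator (cball (0::real^'n) R) x / (L2_set (($) x) K) powr \<beta>)"
    proof (cases "norm x > R")
      case False
      then show ?thesis using B q by (auto intro!: divide_right_mono powr_mono2)
    qed (simp add: out)
    then show "ennreal (\<bar>w x\<bar> powr q / (L2_set (($) x) K) powr \<beta>) \<le> ennreal (B powr q) * ?g x"
      by (simp add: ennreal_mult[symmetric] ennreal_leI)
  qed
  also have "\<dots> = ennreal (B powr q) * (\<integral>\<^sup>+x. ?g x \<partial>lborel)"
    by (rule nn_integral_cmult) measurable
  also have "\<dots> < \<infinity>"
    using weight_locally_integrable[OF K \<beta> R] by (simp add: ennreal_mult_less_top)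
  finally show ?thesis .
qed

text \<open>The reflection changes only coordinates in which \<open>a\<close> and \<open>b\<close> differ. So either it leaves the part of
  \<open>x\<close> in \<open>K\<close> unchanged, or the squared norm of this part changes by the same amount as that of \<open>x\<close>, which increases.\<close>

lemma L2_set_mirror_mono:
  fixes a b :: "real^'n::finite"
  assumes ab: "norm a < norm b" and agree: "(\<forall>i\<in>K. a $ i = b $ i) \<or> (\<forall>i\<in>-K. a $ i = b $ i)"
    and x: "side a b x \<le> 0"
  shows "L2_set (($) x) K \<le> L2_set (($) (mirror a b x)) K"
proof -
  have ne: "a \<noteq> b" using ab by auto
  have same: "mirror a b x $ i = x $ i" if "a $ i = b $ i" for i using that by (simp add: mirror_def)
  from agree show ?thesis
  proof
    assume "\<forall>i\<in>K. a $ i = b $ i"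
    then have "L2_set (($) x) K = L2_set (($) (mirror a b x)) K"
      by (intro L2_set_cong) (simp_all add: same)
    then show ?thesis by simp
  next
    assume off: "\<forall>i\<in>-K. a $ i = b $ i"
    have split: "(norm z)\<^sup>2 = (\<Sum>i\<in>K. (z $ i)\<^sup>2) + (\<Sum>i\<in>-K. (z $ i)\<^sup>2)" for z :: "real^'n"
    proof -
      have "(norm z)\<^sup>2 = (\<Sum>i\<in>K \<union> -K. (z $ i)\<^sup>2)"
        by (simp add: norm_vec_def L2_set_def sum_nonneg)
      also have "\<dots> = (\<Sum>i\<in>K. (z $ i)\<^sup>2) + (\<Sum>i\<in>-K. (z $ i)\<^sup>2)"
        by (rule sum.union_disjoint) auto
      finally show ?thesis .
    qed
    have "(norm x)\<^sup>2 \<le> (norm (mirror a b x))\<^sup>2"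
      using ab by (intro norm_le_mirror[OF ne x]) simp
    moreover have "(\<Sum>i\<in>-K. (x $ i)\<^sup>2) = (\<Sum>i\<in>-K. (mirror a b x $ i)\<^sup>2)"
      using off by (intro sum.cong) (simp_all add: same)
    ultimately have "(\<Sum>i\<in>K. (x $ i)\<^sup>2) \<le> (\<Sum>i\<in>K. (mirror a b x $ i)\<^sup>2)"
      by (simp add: split)
    then show ?thesis by (simp add: L2_set_def)
  qed
qed

text \<open>For each pair of mirror points, the larger value is moved to the point with the larger weight. At
  points where \<open>y = 0\<close> the weight has the default value 0 instead of infinity; these are a null set.\<close>

lemma weighted_integral_polarize:
  fixes w :: "real^'n::finite \<Rightarrow> real"
  assumes K: "K \<noteq> {}" and ab: "norm a < norm b"
    and agree: "(\<forall>i\<in>K. a $ i = b $ i) \<or> (\<forall>i\<in>-K. a $ i = b $ i)"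
    and \<beta>: "0 \<le> \<beta>" and q: "0 \<le> q" and [measurable]: "w \<in> borel_measurable borel" and w: "\<And>x. 0 \<le> w x"
  shows "weighted_integral K \<beta> q w \<le> weighted_integral K \<beta> q (polarize a b w)"
proof -
  have ne: "a \<noteq> b" using ab by auto
  let ?m = "mirror a b"
  have [measurable]: "?m \<in> borel_measurable borel" by (rule mirror_measurable[OF ne])
  have [measurable]: "side a b \<in> borel_measurable borel" unfolding side_def by measurable
  have [measurable]: "polarize a b w \<in> borel_measurable borel"
    unfolding polarize_def[abs_def] by measurable
  define H where "H v x = \<bar>v x\<bar> powr q / (L2_set (($) x) K) powr \<beta>" for v :: "real^'n \<Rightarrow> real" and x
  have H0: "0 \<le> H v x" for v x by (simp add: H_def)
  have two: "2 * weighted_integral K \<beta> q v = (\<integral>\<^sup>+x. ennreal (H v x + H v (?m x)) \<partial>lborel)"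
    if [measurable]: "v \<in> borel_measurable borel" for v
  proof -
    have [measurable]: "H v \<in> borel_measurable borel" unfolding H_def by measurable
    have "(\<integral>\<^sup>+x. ennreal (H v x + H v (?m x)) \<partial>lborel) = (\<integral>\<^sup>+x. ennreal (H v x) + ennreal (H v (?m x)) \<partial>lborel)"
      by (simp add: H0)
    also have "\<dots> = (\<integral>\<^sup>+x. ennreal (H v x) \<partial>lborel) + (\<integral>\<^sup>+x. ennreal (H v (?m x)) \<partial>lborel)"
      by (intro nn_integral_add) auto
    also have "(\<integral>\<^sup>+x. ennreal (H v (?m x)) \<partial>lborel) = (\<integral>\<^sup>+x. ennreal (H v x) \<partial>lborel)"
      by (rule nn_integral_mirror[OF ne, of "\<lambda>x. ennreal (H v x)"]) measurable
    finally show ?thesis by (simp add: weighted_integral_def H_def mult_2)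
  qed
  have main: "H w x + H w (?m x) \<le> H (polarize a b w) x + H (polarize a b w) (?m x)"
    if s: "side a b x \<le> 0" and pos: "0 < L2_set (($) x) K" for x
  proof -
    let ?g = "1 / (L2_set (($) x) K) powr \<beta>" and ?h = "1 / (L2_set (($) (?m x)) K) powr \<beta>"
    have gh: "?h \<le> ?g"
      using L2_set_mirror_mono[OF ab agree s] pos \<beta>
      by (intro divide_left_mono powr_mono2) (auto intro: less_le_trans)
    have eq: "H v x + H v (?m x) = \<bar>v x\<bar> powr q * ?g + \<bar>v (?m x)\<bar> powr q * ?h" for v
      by (simp add: H_def)
    show ?thesis
    proof (cases "w (?m x) \<le> w x")
      case True
      then show ?thesis by (simp add: eq polarize_pair[OF ne s] max_absorb1 min_absorb2)
    next
      case False
      then have "w x powr q \<le> w (?m x) powr q" using w q by (intro powr_mono2) auto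
      from mult_left_mono[OF gh, of "w (?m x) powr q - w x powr q"] this
      have "w x powr q * ?g + w (?m x) powr q * ?h \<le> w (?m x) powr q * ?g + w x powr q * ?h"
        by (simp add: algebra_simps)
      then show ?thesis using False w by (simp only: eq polarize_pair[OF ne s]) (simp add: max_absorb2 min_absorb1)
    qed
  qed
  obtain i where i: "i \<in> K" using K by auto
  have "AE x in lborel. 0 < L2_set (($) (x::real^'n)) K"
    using AE_nth_nonzero[of i] by eventually_elim (use i in \<open>auto intro: L2_set_nth_pos\<close>)
  moreover from AE_mirror[OF ne this] have "AE x in lborel. 0 < L2_set (($) (?m x)) K" .
  ultimately have "AE x in lborel. ennreal (H w x + H w (?m x)) \<le> ennreal (H (polarize a b w) x + H (polarize a b w) (?m x))"
  proof eventually_elim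
    case (elim x)
    show ?case
    proof (cases "side a b x \<le> 0")
      case True
      then show ?thesis using elim by (intro ennreal_leI main)
    next
      case False
      then have "side a b (?m x) \<le> 0" by (simp add: side_mirror[OF ne])
      from main[OF this elim(2)] show ?thesis
        by (intro ennreal_leI) (simp add: mirror_mirror[OF ne] add.commute)
    qed
  qed
  then have "2 * weighted_integral K \<beta> q w \<le> 2 * weighted_integral K \<beta> q (polarize a b w)"
    by (subst (1 2) two) (auto intro: nn_integral_mono_AE)
  then show ?thesis by (simp add: ennreal_mult_le_mult_iff)
qed

section \<open>Minimizers of the second moment\<close>

text \<open>The conditions that compare \<open>w\<close> with \<open>\<phi>\<close> are inequalities in the directions that both polarization and
  pointwise limits respect.\<close>

definition competitors ::
    "'n::finite set \<Rightarrow> real \<Rightarrow> real \<Rightarrow> real \<Rightarrow> (real^'n \<Rightarrow> real) \<Rightarrow> real \<Rightarrow> real \<Rightarrow> (real^'n \<Rightarrow> real) set" where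
  "competitors K p q \<beta> \<phi> L R = {w. (\<forall>x. 0 \<le> w x) \<and> (\<forall>x y. \<bar>w x - w y\<bar> \<le> L * norm (x - y)) \<and>
     (\<forall>x. norm x > R \<longrightarrow> w x = 0) \<and> (\<forall>t>0. nonlocal_energy p t w \<le> nonlocal_energy p t \<phi>) \<and>
     weighted_integral K \<beta> q \<phi> \<le> weighted_integral K \<beta> q w}"

lemma Lipschitz_continuous:
  fixes w :: "'a::real_normed_vector \<Rightarrow> real"
  assumes "\<And>x y. \<bar>w x - w y\<bar> \<le> L * norm (x - y)" "0 \<le> L"
  shows "continuous_on UNIV w"
proof -
  have "L-lipschitz_on UNIV w"
    by (rule lipschitz_onI) (use assms in \<open>auto simp: dist_norm dist_real_def\<close>)
  then show ?thesis by (rule lipschitz_on_continuous_on)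
qed

lemma competitors_bounded:
  fixes w :: "real^'n::finite \<Rightarrow> real"
  assumes w: "w \<in> competitors K p q \<beta> \<phi> L R" and LR: "0 \<le> L" "0 \<le> R"
  shows "\<bar>w x\<bar> \<le> L * (2 * R + 1)"
proof (cases "norm x > R")
  case False
  let ?z = "(R + 1) *\<^sub>R axis undefined 1 :: real^'n"
  have "w ?z = 0" using w LR by (auto simp: competitors_def norm_axis_1)
  then have "\<bar>w x\<bar> \<le> L * norm (x - ?z)"
    using w unfolding competitors_def by (metis (mono_tags, lifting) diff_zero mem_Collect_eq)
  also have "\<dots> \<le> L * (norm x + norm ?z)" by (intro mult_left_mono norm_triangle_ineq4 LR)
  also have "\<dots> \<le> L * (2 * R + 1)" using False LR by (intro mult_left_mono) (auto simp: norm_axis_1)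
  finally show ?thesis .
qed (use w LR in \<open>auto simp: competitors_def\<close>)

lemma competitors_measurable:
  assumes "w \<in> competitors K p q \<beta> \<phi> L R" "0 \<le> L"
  shows "w \<in> borel_measurable borel"
  using assms by (intro borel_measurable_continuous_onI Lipschitz_continuous[of w L]) (auto simp: competitors_def)

lemma nonlocal_energy_Fatou:
  fixes w :: "'a::euclidean_space \<Rightarrow> real"
  assumes p: "0 < p" and wn: "\<And>n. wn n \<in> borel_measurable borel" and lim: "\<And>x. (\<lambda>n. wn n x) \<longlonglongrightarrow> w x"
  shows "nonlocal_energy p t w \<le> liminf (\<lambda>n. nonlocal_energy p t (wn n))"
proof -
  have [measurable]: "wn n \<in> borel_measurable borel" for n by (rule wn)
  define F where "F v x y = ennreal (if norm (x - y) < t then \<bar>v x - v y\<bar> powr p else 0)" for v :: "'a \<Rightarrow> real" and x y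
  have [measurable]: "(\<lambda>(x, y). F (wn n) x y) \<in> borel_measurable (borel \<Otimes>\<^sub>M borel)" for n
    unfolding F_def by measurable
  have "F w x y = liminf (\<lambda>n. F (wn n) x y)" for x y
  proof -
    have "(\<lambda>n. \<bar>wn n x - wn n y\<bar> powr p) \<longlonglongrightarrow> \<bar>w x - w y\<bar> powr p"
      by (intro tendsto_powr' tendsto_rabs tendsto_diff lim tendsto_const) (use p in auto)
    then have "(\<lambda>n. F (wn n) x y) \<longlonglongrightarrow> F w x y"
      unfolding F_def by (intro tendsto_ennrealI) simp
    from lim_imp_Liminf[OF _ this] show ?thesis by simp
  qed
  then have "nonlocal_energy p t w = (\<integral>\<^sup>+x. \<integral>\<^sup>+y. liminf (\<lambda>n. F (wn n) x y) \<partial>lborel \<partial>lborel)"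
    by (simp add: nonlocal_energy_def F_def)
  also have "\<dots> \<le> (\<integral>\<^sup>+x. liminf (\<lambda>n. \<integral>\<^sup>+y. F (wn n) x y \<partial>lborel) \<partial>lborel)"
    by (intro nn_integral_mono nn_integral_liminf) measurable
  also have "\<dots> \<le> liminf (\<lambda>n. \<integral>\<^sup>+x. \<integral>\<^sup>+y. F (wn n) x y \<partial>lborel \<partial>lborel)"
    by (intro nn_integral_liminf) measurable
  finally show ?thesis by (simp add: nonlocal_energy_def F_def)
qed

lemma weighted_integral_tendsto:
  fixes w :: "real^'n::finite \<Rightarrow> real"
  assumes K: "K \<noteq> {}" and \<beta>: "0 \<le> \<beta>" "\<beta> < real (card K)" and q: "0 < q" and R: "0 \<le> R"
    and wn: "\<And>n. wn n \<in> borel_measurable borel" and [measurable]: "w \<in> borel_measurable borel"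
    and out: "\<And>n x. norm x > R \<Longrightarrow> wn n x = 0" and B: "\<And>n x. \<bar>wn n x\<bar> \<le> B" "0 \<le> B"
    and lim: "\<And>x. (\<lambda>n. wn n x) \<longlonglongrightarrow> w x"
  shows "(\<lambda>n. weighted_integral K \<beta> q (wn n)) \<longlonglongrightarrow> weighted_integral K \<beta> q w"
  unfolding weighted_integral_def
proof (rule nn_integral_dominated_convergence)
  have [measurable]: "wn n \<in> borel_measurable borel" for n by (rule wn)
  show "(\<lambda>x. ennreal (\<bar>wn n x\<bar> powr q / L2_set (($) x) K powr \<beta>)) \<in> borel_measurable lborel" for n
    by measurable
  show "(\<lambda>x. ennreal (\<bar>w x\<bar> powr q / L2_set (($) x) K powr \<beta>)) \<in> borel_measurable lborel"
    by measurable
  let ?g = "\<lambda>x. ennreal (\<bar>B * indicator (cball (0::real^'n) R) x\<bar> powr q / L2_set (($) x) K powr \<beta>)"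
  show "?g \<in> borel_measurable lborel" by measurable
  show "AE x in lborel. ennreal (\<bar>wn n x\<bar> powr q / L2_set (($) x) K powr \<beta>) \<le> ?g x" for n
  proof (intro AE_I2 ennreal_leI divide_right_mono powr_mono2)
    fix x
    show "\<bar>wn n x\<bar> \<le> \<bar>B * indicator (cball 0 R) x\<bar>"
      using B out[of x n] by (cases "norm x > R") auto
  qed (use q in auto)
  have "weighted_integral K \<beta> q (\<lambda>x. B * indicator (cball (0::real^'n) R) x) < \<infinity>"
    by (rule weighted_integral_finite[OF K \<beta> _ R, where B=B]) (use q B in \<open>auto simp: indicator_def\<close>)
  then show "(\<integral>\<^sup>+x. ?g x \<partial>lborel) < \<infinity>" by (simp add: weighted_integral_def)
  show "AE x in lborel. (\<lambda>n. ennreal (\<bar>wn n x\<bar> powr q / L2_set (($) x) K powr \<beta>))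
      \<longlonglongrightarrow> ennreal (\<bar>w x\<bar> powr q / L2_set (($) x) K powr \<beta>)"
    unfolding divide_inverse
    by (intro AE_I2 tendsto_ennrealI tendsto_mult tendsto_const tendsto_powr' tendsto_rabs lim) (use q in auto)
qed

text \<open>By Fatou's lemma for the nonlocal energies, and by dominated convergence for the weighted
  integral.\<close>

lemma competitors_closed:
  fixes w :: "real^'n::finite \<Rightarrow> real"
  assumes K: "K \<noteq> {}" and \<beta>: "0 \<le> \<beta>" "\<beta> < real (card K)" and p: "0 < p" and q: "0 < q" and LR: "0 \<le> L" "0 \<le> R"
    and wn: "\<And>n. wn n \<in> competitors K p q \<beta> \<phi> L R" and lim: "\<And>x. (\<lambda>n. wn n x) \<longlonglongrightarrow> w x"
  shows "w \<in> competitors K p q \<beta> \<phi> L R"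
proof -
  have w: "\<And>n x. 0 \<le> wn n x" "\<And>n x y. \<bar>wn n x - wn n y\<bar> \<le> L * norm (x - y)" "\<And>n x. norm x > R \<Longrightarrow> wn n x = 0"
    "\<And>n t. t > 0 \<Longrightarrow> nonlocal_energy p t (wn n) \<le> nonlocal_energy p t \<phi>"
    "\<And>n. weighted_integral K \<beta> q \<phi> \<le> weighted_integral K \<beta> q (wn n)"
    using wn unfolding competitors_def by auto
  note m = competitors_measurable[OF wn LR(1)]
  have wm: "w \<in> borel_measurable borel" by (rule borel_measurable_LIMSEQ_real[OF lim m])
  have "0 \<le> w x" for x by (rule LIMSEQ_le_const[OF lim]) (use w in auto)
  moreover have "\<bar>w x - w y\<bar> \<le> L * norm (x - y)" for x y
    by (rule LIMSEQ_le_const2[of "\<lambda>n. \<bar>wn n x - wn n y\<bar>"]) (use w in \<open>auto intro!: tendsto_rabs tendsto_diff lim\<close>)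
  moreover have "w x = 0" if "norm x > R" for x
    using lim[of x] w(3)[OF that] by (simp add: LIMSEQ_const_iff)
  moreover have "nonlocal_energy p t w \<le> nonlocal_energy p t \<phi>" if "t > 0" for t
  proof -
    have "nonlocal_energy p t w \<le> liminf (\<lambda>n. nonlocal_energy p t (wn n))"
      by (rule nonlocal_energy_Fatou[OF p m lim])
    also have "\<dots> \<le> liminf (\<lambda>n::nat. nonlocal_energy p t \<phi>)"
      by (intro Liminf_mono always_eventually allI w that)
    finally show ?thesis by (simp add: Liminf_const)
  qed
  moreover have "weighted_integral K \<beta> q \<phi> \<le> weighted_integral K \<beta> q w"
  proof (rule LIMSEQ_le_const)
    show "(\<lambda>n. weighted_integral K \<beta> q (wn n)) \<longlonglongrightarrow> weighted_integral K \<beta> q w"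
      by (rule weighted_integral_tendsto[OF K \<beta> q LR(2) m wm w(3) competitors_bounded[OF wn LR] _ lim]) (use LR in auto)
  qed (use w in auto)
  ultimately show ?thesis unfolding competitors_def by blast
qed

lemma competitors_polarize:
  fixes w :: "real^'n::finite \<Rightarrow> real"
  assumes K: "K \<noteq> {}" and \<beta>: "0 \<le> \<beta>" and p: "1 \<le> p" and q: "0 \<le> q" and LR: "0 \<le> L"
    and w: "w \<in> competitors K p q \<beta> \<phi> L R" and ab: "norm a < norm b"
    and agree: "(\<forall>i\<in>K. a $ i = b $ i) \<or> (\<forall>i\<in>-K. a $ i = b $ i)"
  shows "polarize a b w \<in> competitors K p q \<beta> \<phi> L R"
proof -
  have ne: "a \<noteq> b" using ab by auto
  have c: "\<And>x. 0 \<le> w x" "\<And>x y. \<bar>w x - w y\<bar> \<le> L * norm (x - y)" "\<And>x. norm x > R \<Longrightarrow> w x = 0"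
    "\<And>t. t > 0 \<Longrightarrow> nonlocal_energy p t w \<le> nonlocal_energy p t \<phi>"
    "weighted_integral K \<beta> q \<phi> \<le> weighted_integral K \<beta> q w"
    using w unfolding competitors_def by auto
  note m = competitors_measurable[OF w LR]
  have "polarize a b w x = 0" if x: "norm x > R" for x
  proof (cases "side a b x \<le> 0")
    case True
    have "(norm x)\<^sup>2 \<le> (norm (mirror a b x))\<^sup>2"
      using ab by (intro norm_le_mirror[OF ne True]) simp
    then have "norm x \<le> norm (mirror a b x)" by (rule power2_le_imp_le) simp
    then show ?thesis using x c(3) by (simp add: polarize_def)
  next
    case False
    then show ?thesis using c(1)[of "mirror a b x"] c(3)[OF x] by (simp add: polarize_def)
  qed
  moreover have "nonlocal_energy p t (polarize a b w) \<le> nonlocal_energy p t \<phi>" if "t > 0" for t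
    using nonlocal_energy_polarize[OF ne p m] c(4)[OF that] by (rule order_trans)
  moreover have "weighted_integral K \<beta> q \<phi> \<le> weighted_integral K \<beta> q (polarize a b w)"
    by (rule order_trans[OF c(5)]) (rule weighted_integral_polarize[OF K ab agree \<beta> q m c(1)])
  moreover have "0 \<le> polarize a b w x" for x using c(1) by (simp add: polarize_def max.coboundedI1)
  moreover have "\<bar>polarize a b w x - polarize a b w y\<bar> \<le> L * norm (x - y)" for x y
    by (rule polarize_Lipschitz[OF ne c(2) LR])
  ultimately show ?thesis unfolding competitors_def by blast
qed

definition moment :: "(real^'n::finite \<Rightarrow> real) \<Rightarrow> real" where
  "moment w = (\<integral>x. (norm x)\<^sup>2 * w x \<partial>lborel)"

lemma moment_integrable:
  fixes w :: "real^'n::finite \<Rightarrow> real"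
  assumes w: "w \<in> competitors K p q \<beta> \<phi> L R" and L: "0 \<le> L"
  shows "integrable lborel (\<lambda>x. (norm x)\<^sup>2 * w x)"
proof (rule integrable_continuous_bounded_support)
  show "continuous_on UNIV (\<lambda>x. (norm x)\<^sup>2 * w x)"
    using w L by (intro continuous_intros Lipschitz_continuous[of w L]) (auto simp: competitors_def)
  show "(norm x)\<^sup>2 * w x = 0" if "norm x > R" for x using w that by (simp add: competitors_def)
qed

text \<open>The functions of a minimizing sequence are uniformly Lipschitz and bounded, so by the theorem of
  Arzela and Ascoli a subsequence converges.\<close>

lemma moment_minimizer_exists:
  fixes \<phi> :: "real^'n::finite \<Rightarrow> real"
  assumes K: "K \<noteq> {}" and \<beta>: "0 \<le> \<beta>" "\<beta> < real (card K)" and p: "0 < p" and q: "0 < q" and LR: "0 \<le> L" "0 \<le> R"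
    and ne: "competitors K p q \<beta> \<phi> L R \<noteq> {}"
  obtains w where "w \<in> competitors K p q \<beta> \<phi> L R" "\<And>v. v \<in> competitors K p q \<beta> \<phi> L R \<Longrightarrow> moment w \<le> moment v"
proof -
  let ?C = "competitors K p q \<beta> \<phi> L R"
  define J where "J = Inf (moment ` ?C)"
  have bdd: "bdd_below (moment ` ?C)"
    by (rule bdd_belowI2[of _ 0]) (auto simp: moment_def competitors_def intro!: Bochner_Integration.integral_nonneg)
  have "\<exists>v\<in>?C. moment v < J + inverse (real (Suc n))" for n
  proof -
    have "Inf (moment ` ?C) < J + inverse (real (Suc n))" by (simp add: J_def)
    then show ?thesis using ne by (subst (asm) cInf_less_iff) (auto simp: bdd)
  qed
  then obtain v where v: "\<And>n. v n \<in> ?C" "\<And>n. moment (v n) < J + inverse (real (Suc n))" by metis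
  have vb: "\<bar>v n x\<bar> \<le> L * (2 * R + 1)" for n x by (rule competitors_bounded[OF v(1) LR])
  have vL: "\<bar>v n x - v n y\<bar> \<le> L * norm (x - y)" for n x y using v(1) by (auto simp: competitors_def)
  obtain g k where g: "strict_mono (k :: nat \<Rightarrow> nat)"
    "\<And>e. 0 < e \<Longrightarrow> \<exists>N. \<forall>n x. n \<ge> N \<and> x \<in> cball 0 R \<longrightarrow> norm (v (k n) x - g x) < e"
  proof (rule Arzela_Ascoli[of "cball (0::real^'n) R" v "L * (2 * R + 1)"])
    fix x :: "real^'n" and e :: real assume "0 < e"
    have "\<bar>v n x - v n y\<bar> < e" if "norm (x - y) < e / (L + 1)" for n y
    proof -
      have "\<bar>v n x - v n y\<bar> \<le> L * norm (x - y)" by (rule vL)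
      also have "\<dots> \<le> L * (e / (L + 1))" using that LR by (intro mult_left_mono) auto
      also have "\<dots> < e" using \<open>0 < e\<close> LR by (simp add: field_simps)
      finally show ?thesis .
    qed
    then show "\<exists>d>0. \<forall>n y. y \<in> cball 0 R \<and> norm (x - y) < d \<longrightarrow> norm (v n x - v n y) < e"
      using \<open>0 < e\<close> LR by (intro exI[of _ "e / (L + 1)"]) auto
  qed (use vb in auto)
  define w where "w x = (if norm x \<le> R then g x else 0)" for x
  have lim: "(\<lambda>n. v (k n) x) \<longlonglongrightarrow> w x" for x
  proof (cases "norm x \<le> R")
    case True
    show ?thesis
    proof (rule LIMSEQ_I)
      fix r :: real assume "0 < r"
      then obtain N where "\<forall>n x. n \<ge> N \<and> x \<in> cball 0 R \<longrightarrow> norm (v (k n) x - g x) < r" using g(2) by blast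
      then show "\<exists>no. \<forall>n\<ge>no. norm (v (k n) x - w x) < r" using True by (auto simp: w_def)
    qed
  next
    case False
    then have "v (k n) x = 0" for n using v(1)[of "k n"] by (auto simp: competitors_def)
    then show ?thesis using False by (simp add: w_def)
  qed
  have wC: "w \<in> ?C" by (rule competitors_closed[OF K \<beta> p q LR _ lim]) (rule v)
  have "(\<lambda>n. moment (v (k n))) \<longlonglongrightarrow> moment w"
    unfolding moment_def
  proof (rule integral_dominated_convergence)
    show "(\<lambda>x. (norm x)\<^sup>2 * w x) \<in> borel_measurable lborel"
      using competitors_measurable[OF wC LR(1)] by simp
    show "(\<lambda>x. (norm x)\<^sup>2 * v (k n) x) \<in> borel_measurable lborel" for n
      using competitors_measurable[OF v(1) LR(1)] by simp
    show "integrable lborel (\<lambda>x::real^'n. R\<^sup>2 * (L * (2 * R + 1)) * indicator (cball 0 R) x)"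
      using emeasure_lborel_cball_finite by (intro integrable_mult_right integrable_real_indicator) auto
    show "AE x in lborel. (\<lambda>n. (norm x)\<^sup>2 * v (k n) x) \<longlonglongrightarrow> (norm x)\<^sup>2 * w x"
      by (intro AE_I2 tendsto_intros lim)
    show "AE x in lborel. norm ((norm x)\<^sup>2 * v (k n) x) \<le> R\<^sup>2 * (L * (2 * R + 1)) * indicator (cball 0 R) x" for n
    proof (intro AE_I2)
      fix x
      show "norm ((norm x)\<^sup>2 * v (k n) x) \<le> R\<^sup>2 * (L * (2 * R + 1)) * indicator (cball 0 R) x"
      proof (cases "norm x \<le> R")
        case True
        have "(norm x)\<^sup>2 * \<bar>v (k n) x\<bar> \<le> R\<^sup>2 * (L * (2 * R + 1))"
          using True vb by (intro mult_mono power_mono) auto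
        then show ?thesis using True by (simp add: abs_mult)
      next
        case False
        then have "v (k n) x = 0" using v(1)[of "k n"] by (auto simp: competitors_def)
        then show ?thesis using LR by simp
      qed
    qed
  qed
  moreover have "(\<lambda>n. moment (v (k n))) \<longlonglongrightarrow> J"
  proof (rule tendsto_sandwich)
    show "\<forall>\<^sub>F n in sequentially. J \<le> moment (v (k n))"
      unfolding J_def by (intro always_eventually allI cInf_lower bdd imageI v)
    show "\<forall>\<^sub>F n in sequentially. moment (v (k n)) \<le> J + inverse (real (Suc (k n)))"
      using v(2) by (intro always_eventually allI less_imp_le)
    have "(\<lambda>n. J + inverse (real (Suc (k n)))) \<longlonglongrightarrow> J + 0"
      using LIMSEQ_subseq_LIMSEQ[OF LIMSEQ_inverse_real_of_nat g(1)] by (intro tendsto_intros) (simp add: o_def)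
    then show "(\<lambda>n. J + inverse (real (Suc (k n)))) \<longlonglongrightarrow> J" by simp
  qed simp
  ultimately have "moment w = J" by (rule LIMSEQ_unique)
  then have "moment w \<le> moment u" if "u \<in> ?C" for u
    unfolding J_def using bdd that by (simp add: cInf_lower)
  then show ?thesis using that[OF wC] by blast
qed

lemma continuous_zero_of_AE_zero:
  fixes f :: "'a::euclidean_space \<Rightarrow> real"
  assumes "continuous_on UNIV f" "AE x in lborel. f x = 0"
  shows "f x = 0"
proof -
  have "open {x. f x \<noteq> 0}" by (intro open_Collect_neq assms continuous_intros)
  moreover have "{x. f x \<noteq> 0} \<in> null_sets lborel"
    using assms(2) calculation by (intro AE_iff_null_sets[THEN iffD2]) auto
  then have "negligible {x. f x \<noteq> 0}"
    using null_sets_completionI by (auto simp: negligible_iff_null_sets)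
  ultimately show ?thesis using open_not_negligible by blast
qed

text \<open>Polarization cannot decrease the second moment of a minimizer. The sum \<open>D\<close> of the decrease of the
  integrand at two mirror points is non-negative and continuous and has integral at most 0, hence it
  vanishes identically; at \<open>a\<close> this is the claim.\<close>

lemma moment_minimizer_monotone:
  fixes w :: "real^'n::finite \<Rightarrow> real"
  assumes K: "K \<noteq> {}" and \<beta>: "0 \<le> \<beta>" and p: "1 \<le> p" and q: "0 \<le> q" and L: "0 \<le> L"
    and w: "w \<in> competitors K p q \<beta> \<phi> L R"
    and min: "\<And>v. v \<in> competitors K p q \<beta> \<phi> L R \<Longrightarrow> moment w \<le> moment v"
    and ab: "norm a < norm b" and agree: "(\<forall>i\<in>K. a $ i = b $ i) \<or> (\<forall>i\<in>-K. a $ i = b $ i)"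
  shows "w b \<le> w a"
proof -
  have ne: "a \<noteq> b" using ab by auto
  have sq: "(norm a)\<^sup>2 < (norm b)\<^sup>2" using ab by (intro power_strict_mono) auto
  let ?v = "polarize a b w" and ?m = "mirror a b"
  have v: "?v \<in> competitors K p q \<beta> \<phi> L R" by (rule competitors_polarize[OF K \<beta> p q L w ab agree])
  have cont: "continuous_on UNIV u" if "u \<in> competitors K p q \<beta> \<phi> L R" for u
    using that L by (intro Lipschitz_continuous[of u L]) (auto simp: competitors_def)
  have contm: "continuous_on UNIV (\<lambda>x. u (?m x))" if "u \<in> competitors K p q \<beta> \<phi> L R" for u
    by (rule continuous_on_compose2[OF cont[OF that] mirror_continuous[OF ne]]) simp
  define D where "D x = (norm x)\<^sup>2 * w x + (norm (?m x))\<^sup>2 * w (?m x) - ((norm x)\<^sup>2 * ?v x + (norm (?m x))\<^sup>2 * ?v (?m x))" for x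
  have D_main: "D x = ((norm (?m x))\<^sup>2 - (norm x)\<^sup>2) * (max (w x) (w (?m x)) - w x)" if "side a b x \<le> 0" for x
    unfolding D_def polarize_pair[OF ne that] by (auto simp: max_def min_def algebra_simps)
  have D0: "0 \<le> D x" if "side a b x \<le> 0" for x
    using norm_le_mirror[OF ne that] ab unfolding D_main[OF that] by (intro mult_nonneg_nonneg) auto
  have D_nonneg: "0 \<le> D x" for x
  proof (cases "side a b x \<le> 0")
    case False
    then have "0 \<le> D (?m x)" by (intro D0) (simp add: side_mirror[OF ne])
    then show ?thesis by (simp add: D_def mirror_mirror[OF ne] algebra_simps)
  qed (rule D0)
  have int: "integrable lborel (\<lambda>x. (norm x)\<^sup>2 * u x)" "integrable lborel (\<lambda>x. (norm (?m x))\<^sup>2 * u (?m x))"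
    "(\<integral>x. (norm (?m x))\<^sup>2 * u (?m x) \<partial>lborel) = moment u"
    if u: "u \<in> competitors K p q \<beta> \<phi> L R" for u
  proof -
    show i: "integrable lborel (\<lambda>x. (norm x)\<^sup>2 * u x)" by (rule moment_integrable[OF u L])
    have [measurable]: "u \<in> borel_measurable borel" by (rule competitors_measurable[OF u L])
    show "(\<integral>x. (norm (?m x))\<^sup>2 * u (?m x) \<partial>lborel) = moment u"
      unfolding moment_def by (rule integral_mirror[OF ne, of "\<lambda>x. (norm x)\<^sup>2 * u x"]) measurable
    have "integrable (distr lborel borel ?m) (\<lambda>x. (norm x)\<^sup>2 * u x)" using i by (simp add: distr_mirror[OF ne])
    then show "integrable lborel (\<lambda>x. (norm (?m x))\<^sup>2 * u (?m x))"
      by (rule integrable_distr[rotated]) (use mirror_measurable[OF ne] in simp)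
  qed
  have D_int: "integrable lborel D"
    unfolding D_def by (intro Bochner_Integration.integrable_diff Bochner_Integration.integrable_add int w v)
  have "(\<integral>x. D x \<partial>lborel) = (moment w + moment w) - (moment ?v + moment ?v)"
    unfolding D_def
    by (simp only: Bochner_Integration.integral_diff[OF Bochner_Integration.integrable_add[OF int(1,2)[OF w]]
          Bochner_Integration.integrable_add[OF int(1,2)[OF v]]]
        Bochner_Integration.integral_add[OF int(1,2)[OF w]] Bochner_Integration.integral_add[OF int(1,2)[OF v]]
        int(3)[OF w] int(3)[OF v]) (simp add: moment_def)
  also have "\<dots> \<le> 0" using min[OF v] by simp
  finally have "(\<integral>x. D x \<partial>lborel) = 0"
    by (rule antisym) (rule Bochner_Integration.integral_nonneg, rule D_nonneg)
  then have "AE x in lborel. D x = 0"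
    using D_int D_nonneg by (subst (asm) integral_nonneg_eq_0_iff_AE) auto
  moreover have "continuous_on UNIV D"
    unfolding D_def
    by (intro continuous_intros cont[OF w] cont[OF v] contm[OF w] contm[OF v]
        continuous_on_compose2[OF continuous_on_norm_id mirror_continuous[OF ne]] mirror_continuous[OF ne])
  ultimately have "D a = 0" by (intro continuous_zero_of_AE_zero)
  moreover have "side a b a \<le> 0" by (simp add: side_left[OF ne])
  ultimately have "((norm b)\<^sup>2 - (norm a)\<^sup>2) * (max (w a) (w b) - w a) = 0"
    using D_main[of a] by (simp add: mirror_left[OF ne])
  then show ?thesis using sq by auto
qed

text \<open>The class of competitors is non-empty, because it contains \<open>\<bar>\<phi>\<bar>\<close>.\<close>

lemma symmetric_competitor_exists:
  fixes \<phi> :: "real^'n::finite \<Rightarrow> real"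
  assumes K: "K \<noteq> {}" and \<beta>: "0 \<le> \<beta>" "\<beta> < real (card K)" and p: "1 \<le> p" and q: "0 < q"
    and \<phi>: "\<phi> \<in> test_functions"
  obtains w L R where "0 \<le> L" "0 \<le> R" "\<And>x. 0 \<le> w x" "\<And>x y. \<bar>w x - w y\<bar> \<le> L * norm (x - y)"
    "\<And>x. norm x > R \<Longrightarrow> w x = 0" "\<And>t. 0 < t \<Longrightarrow> nonlocal_energy p t w \<le> nonlocal_energy p t \<phi>"
    "weighted_integral K \<beta> q \<phi> \<le> weighted_integral K \<beta> q w"
    "\<And>a b. norm a < norm b \<Longrightarrow> (\<forall>i\<in>K. a $ i = b $ i) \<or> (\<forall>i\<in>-K. a $ i = b $ i) \<Longrightarrow> w b \<le> w a"
proof -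
  obtain R where R: "0 < R" "\<And>x. norm x > R \<Longrightarrow> \<phi> x = 0" by (rule test_support[OF \<phi>]) blast
  obtain L where L: "0 \<le> L" "\<And>x. norm (gradient \<phi> x) \<le> L" by (rule test_gradient_bounded[OF \<phi>]) blast
  have lip: "\<bar>\<phi> x - \<phi> y\<bar> \<le> L * norm (x - y)" for x y
    by (intro Lipschitz_of_gradient_bound L test_differentiable \<phi>)
  have le: "\<bar>\<bar>\<phi> x\<bar> - \<bar>\<phi> y\<bar>\<bar> \<le> \<bar>\<phi> x - \<phi> y\<bar>" for x y by (rule abs_triangle_ineq3)
  have "(\<lambda>x. \<bar>\<phi> x\<bar>) \<in> competitors K p q \<beta> \<phi> L R"
    unfolding competitors_def
  proof (intro CollectI conjI allI impI)
    show "\<bar>\<bar>\<phi> x\<bar> - \<bar>\<phi> y\<bar>\<bar> \<le> L * norm (x - y)" for x y using le lip by (rule order_trans)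
    show "nonlocal_energy p t (\<lambda>x. \<bar>\<phi> x\<bar>) \<le> nonlocal_energy p t \<phi>" for t
      unfolding nonlocal_energy_def using le p
      by (intro nn_integral_mono ennreal_leI) (auto intro!: powr_mono2)
    show "weighted_integral K \<beta> q \<phi> \<le> weighted_integral K \<beta> q (\<lambda>x. \<bar>\<phi> x\<bar>)"
      by (simp add: weighted_integral_def)
  qed (use R in auto)
  then have ne: "competitors K p q \<beta> \<phi> L R \<noteq> {}" by blast
  obtain w where w: "w \<in> competitors K p q \<beta> \<phi> L R"
      "\<And>v. v \<in> competitors K p q \<beta> \<phi> L R \<Longrightarrow> moment w \<le> moment v"
    using moment_minimizer_exists[OF K \<beta> _ q L(1) _ ne] p R by auto
  have "w b \<le> w a" if "norm a < norm b" "(\<forall>i\<in>K. a $ i = b $ i) \<or> (\<forall>i\<in>-K. a $ i = b $ i)" for a b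
    by (rule moment_minimizer_monotone[OF K \<beta>(1) p _ L(1) w that]) (use q in auto)
  moreover have "\<And>x. 0 \<le> w x" "\<And>x y. \<bar>w x - w y\<bar> \<le> L * norm (x - y)"
    "\<And>x. norm x > R \<Longrightarrow> w x = 0" "\<And>t. 0 < t \<Longrightarrow> nonlocal_energy p t w \<le> nonlocal_energy p t \<phi>"
    "weighted_integral K \<beta> q \<phi> \<le> weighted_integral K \<beta> q w"
    using w(1) unfolding competitors_def by auto
  ultimately show ?thesis using that[of L R w] L(1) R(1) by auto
qed

section \<open>The local limit of the nonlocal energies\<close>

lemma nn_integral_affine:
  fixes f :: "'a::euclidean_space \<Rightarrow> ennreal"
  assumes [measurable]: "f \<in> borel_measurable borel" and t: "0 < t"
  shows "(\<integral>\<^sup>+y. f y \<partial>lborel) = ennreal (t ^ DIM('a)) * (\<integral>\<^sup>+h. f (x + t *\<^sub>R h) \<partial>lborel)"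
proof -
  have "(\<integral>\<^sup>+y. f y \<partial>lborel)
      = (\<integral>\<^sup>+y. f y \<partial>density (distr lborel borel (\<lambda>h. x + t *\<^sub>R h)) (\<lambda>_. ennreal (\<bar>t\<bar> ^ DIM('a))))"
    using t by (subst lborel_affine[of t x]) auto
  also have "\<dots> = (\<integral>\<^sup>+h. ennreal (t ^ DIM('a)) * f (x + t *\<^sub>R h) \<partial>lborel)"
    using t by (subst nn_integral_density) (auto simp: nn_integral_distr)
  also have "\<dots> = ennreal (t ^ DIM('a)) * (\<integral>\<^sup>+h. f (x + t *\<^sub>R h) \<partial>lborel)"
    by (rule nn_integral_cmult) measurable
  finally show ?thesis .
qed

text \<open>The nonlocal energy after the substitution \<open>y = x + t h\<close>, up to a power of \<open>t\<close>. With \<open>h\<close> as the outer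
  variable, contraction properties in \<open>x\<close> can be used for each \<open>h\<close> separately.\<close>

definition quotient_energy :: "real \<Rightarrow> real \<Rightarrow> ('a::euclidean_space \<Rightarrow> real) \<Rightarrow> ennreal" where
  "quotient_energy p t w = (\<integral>\<^sup>+h. \<integral>\<^sup>+x. ennreal (if norm h < 1 then (\<bar>w (x + t *\<^sub>R h) - w x\<bar> / t) powr p else 0) \<partial>lborel \<partial>lborel)"

lemma nonlocal_energy_eq_quotient:
  fixes w :: "'a::euclidean_space \<Rightarrow> real"
  assumes [measurable]: "w \<in> borel_measurable borel" and t: "0 < t"
  shows "nonlocal_energy p t w = ennreal (t ^ DIM('a) * t powr p) * quotient_energy p t w"
proof -
  define F where "F x y = ennreal (if norm (x - y) < t then \<bar>w x - w y\<bar> powr p else 0)" for x y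
  define Q where "Q x h = ennreal (if norm h < 1 then (\<bar>w (x + t *\<^sub>R h) - w x\<bar> / t) powr p else 0)" for x h :: 'a
  have [measurable]: "(\<lambda>(x, y). F x y) \<in> borel_measurable (borel \<Otimes>\<^sub>M borel)"
    unfolding F_def by measurable
  have [measurable]: "(\<lambda>(x, h). Q x h) \<in> borel_measurable (borel \<Otimes>\<^sub>M borel)"
    unfolding Q_def by measurable
  have FQ: "F x (x + t *\<^sub>R h) = ennreal (t powr p) * Q x h" for x h
  proof -
    have "norm (x - (x + t *\<^sub>R h)) < t \<longleftrightarrow> norm h < 1" using t by simp
    moreover have "\<bar>w x - w (x + t *\<^sub>R h)\<bar> powr p = t powr p * (\<bar>w (x + t *\<^sub>R h) - w x\<bar> / t) powr p"
      using t by (simp add: powr_divide abs_minus_commute)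
    ultimately show ?thesis by (simp add: F_def Q_def ennreal_mult[symmetric])
  qed
  have "nonlocal_energy p t w = (\<integral>\<^sup>+x. \<integral>\<^sup>+y. F x y \<partial>lborel \<partial>lborel)"
    by (simp add: nonlocal_energy_def F_def)
  also have "\<dots> = (\<integral>\<^sup>+x. ennreal (t ^ DIM('a)) * (\<integral>\<^sup>+h. F x (x + t *\<^sub>R h) \<partial>lborel) \<partial>lborel)"
    by (intro nn_integral_cong nn_integral_affine t) measurable
  also have "\<dots> = (\<integral>\<^sup>+x. ennreal (t ^ DIM('a) * t powr p) * (\<integral>\<^sup>+h. Q x h \<partial>lborel) \<partial>lborel)"
    using t by (intro nn_integral_cong) (simp add: FQ nn_integral_cmult ennreal_mult mult.assoc)
  also have "\<dots> = ennreal (t ^ DIM('a) * t powr p) * (\<integral>\<^sup>+x. \<integral>\<^sup>+h. Q x h \<partial>lborel \<partial>lborel)"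
    by (rule nn_integral_cmult) measurable
  also have "(\<integral>\<^sup>+x. \<integral>\<^sup>+h. Q x h \<partial>lborel \<partial>lborel) = (\<integral>\<^sup>+h. \<integral>\<^sup>+x. Q x h \<partial>lborel \<partial>lborel)"
    by (rule lborel_pair.Fubini'[symmetric]) measurable
  finally show ?thesis by (simp add: quotient_energy_def Q_def)
qed

lemma quotient_energy_mono_of_nonlocal:
  fixes v w :: "'a::euclidean_space \<Rightarrow> real"
  assumes "v \<in> borel_measurable borel" "w \<in> borel_measurable borel" "0 < t"
    and "nonlocal_energy p t v \<le> nonlocal_energy p t w"
  shows "quotient_energy p t v \<le> quotient_energy p t w"
proof -
  have "0 < ennreal (t ^ DIM('a) * t powr p)" using assms(3) by simp
  then show ?thesis
    using assms(4) unfolding nonlocal_energy_eq_quotient[OF assms(1,3)] nonlocal_energy_eq_quotient[OF assms(2,3)]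
    by (subst (asm) ennreal_mult_le_mult_iff) auto
qed

text \<open>Convolution commutes with differences, and it is a contraction of \<open>L\<^sup>p\<close>.\<close>

lemma quotient_energy_conv_le:
  fixes w :: "real^'n::finite \<Rightarrow> real"
  assumes d: "0 < d" and w: "integrable lborel w" and p: "1 \<le> p" and t: "0 < t"
  shows "quotient_energy p t (conv (mollifier d) w) \<le> quotient_energy p t w"
  unfolding quotient_energy_def
proof (rule nn_integral_mono)
  fix h :: "real^'n"
  have [measurable]: "w \<in> borel_measurable borel" using w by auto
  let ?a = "t *\<^sub>R h"
  have shift: "integrable lborel (\<lambda>x. w (?a + x))" by (rule integrable_translate[OF w])
  have c: "conv (mollifier d) w (x + ?a) - conv (mollifier d) w x = conv (mollifier d) (\<lambda>x. w (?a + x) - w x) x" for x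
  proof -
    have "conv (mollifier d) w (x + ?a) = conv (mollifier d) (\<lambda>x. w (?a + x)) x"
      by (subst (1 2) conv_reflect) (simp_all add: algebra_simps)
    then show ?thesis using conv_diff[OF mollifier_test[OF d] shift w] by simp
  qed
  have scale: "(\<integral>\<^sup>+x. ennreal ((f x / t) powr p) \<partial>lborel) = ennreal (1 / t powr p) * (\<integral>\<^sup>+x. ennreal (f x powr p) \<partial>lborel)"
    if "f \<in> borel_measurable borel" "\<And>x. 0 \<le> f x" for f :: "real^'n \<Rightarrow> real"
  proof -
    have "(\<integral>\<^sup>+x. ennreal ((f x / t) powr p) \<partial>lborel) = (\<integral>\<^sup>+x. ennreal (1 / t powr p) * ennreal (f x powr p) \<partial>lborel)"
      using t by (intro nn_integral_cong) (simp add: powr_divide ennreal_mult[symmetric])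
    also have "\<dots> = ennreal (1 / t powr p) * (\<integral>\<^sup>+x. ennreal (f x powr p) \<partial>lborel)"
      using that by (intro nn_integral_cmult) measurable
    finally show ?thesis .
  qed
  have [measurable]: "conv (mollifier d) w \<in> borel_measurable borel" by (rule conv_measurable) auto
  show "(\<integral>\<^sup>+x. ennreal (if norm h < 1 then (\<bar>conv (mollifier d) w (x + ?a) - conv (mollifier d) w x\<bar> / t) powr p else 0) \<partial>lborel)
      \<le> (\<integral>\<^sup>+x. ennreal (if norm h < 1 then (\<bar>w (x + ?a) - w x\<bar> / t) powr p else 0) \<partial>lborel)"
  proof (cases "norm h < 1")
    case True
    have "(\<integral>\<^sup>+x. ennreal (\<bar>conv (mollifier d) w (x + ?a) - conv (mollifier d) w x\<bar> powr p) \<partial>lborel)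
        \<le> (\<integral>\<^sup>+x. ennreal (\<bar>w (x + ?a) - w x\<bar> powr p) \<partial>lborel)"
      unfolding c
      using conv_Lp_contraction[OF d Bochner_Integration.integrable_diff[OF shift w] p] by (simp add: add.commute)
    then show ?thesis using True by (simp add: scale mult_left_mono)
  qed simp
qed

text \<open>Dominated convergence, first in \<open>x\<close> and then in \<open>h\<close>.\<close>

lemma quotient_energy_tendsto:
  fixes \<phi> :: "real^'n::finite \<Rightarrow> real"
  assumes \<phi>: "\<phi> \<in> test_functions" and p: "0 < p" and t: "\<And>n. 0 < t n" "\<And>n. t n \<le> 1" "t \<longlonglongrightarrow> 0"
  shows "(\<lambda>n. quotient_energy p (t n) \<phi>) \<longlonglongrightarrow>
    (\<integral>\<^sup>+h. \<integral>\<^sup>+x. ennreal (if norm h < 1 then \<bar>gradient \<phi> x \<bullet> h\<bar> powr p else 0) \<partial>lborel \<partial>lborel)"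
proof -
  obtain R where R: "\<And>x. norm x > R \<Longrightarrow> \<phi> x = 0" by (rule test_support[OF \<phi>]) blast
  obtain L where L: "0 \<le> L" "\<And>x. norm (gradient \<phi> x) \<le> L" by (rule test_gradient_bounded[OF \<phi>]) blast
  have [measurable]: "\<phi> \<in> borel_measurable borel" "gradient \<phi> \<in> borel_measurable borel"
    using test_measurable[OF \<phi>] test_gradient_measurable[OF \<phi>] by auto
  define F where "F n h x = ennreal (if norm h < 1 then (\<bar>\<phi> (x + t n *\<^sub>R h) - \<phi> x\<bar> / t n) powr p else 0)" for n and h x :: "real^'n"
  define G where "G h x = ennreal (if norm h < 1 then \<bar>gradient \<phi> x \<bullet> h\<bar> powr p else 0)" for h x :: "real^'n"
  define c where "c = ennreal (L powr p)"
  define B where "B = emeasure lborel (cball (0::real^'n) (R + 1))"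
  have B: "B < \<infinity>" unfolding B_def by (rule emeasure_lborel_cball_finite)
  have [measurable]: "(\<lambda>(h, x). F n h x) \<in> borel_measurable (borel \<Otimes>\<^sub>M borel)" for n
    unfolding F_def by measurable
  have [measurable]: "(\<lambda>(h, x). G h x) \<in> borel_measurable (borel \<Otimes>\<^sub>M borel)"
    unfolding G_def by measurable
  have bound: "F n h x \<le> c * indicator (cball 0 (R + 1)) x" for n h x
  proof (cases "norm h < 1 \<and> norm x \<le> R + 1")
    case True
    have "\<bar>\<phi> (x + t n *\<^sub>R h) - \<phi> x\<bar> \<le> L * norm (x + t n *\<^sub>R h - x)"
      by (intro Lipschitz_of_gradient_bound L test_differentiable \<phi>)
    also have "\<dots> \<le> L * (t n * 1)" using t(1)[of n] True L(1) by (intro mult_left_mono) auto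
    finally have "\<bar>\<phi> (x + t n *\<^sub>R h) - \<phi> x\<bar> / t n \<le> L" using t(1)[of n] by (simp add: pos_divide_le_eq)
    then have "(\<bar>\<phi> (x + t n *\<^sub>R h) - \<phi> x\<bar> / t n) powr p \<le> L powr p"
      using t(1)[of n] p by (intro powr_mono2) auto
    then show ?thesis using True by (simp add: F_def c_def ennreal_leI)
  next
    case False
    have "F n h x = 0"
    proof (cases "norm h < 1")
      case True
      then have x: "norm x > R + 1" using False by simp
      have "norm (t n *\<^sub>R h) \<le> 1 * 1" using True t(1,2)[of n] by (simp add: mult_le_one)
      then have "norm (x + t n *\<^sub>R h) > R" using norm_triangle_ineq4[of "x + t n *\<^sub>R h" "t n *\<^sub>R h"] x by simp
      then show ?thesis using x by (simp add: F_def R)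
    qed (simp add: F_def)
    then show ?thesis by simp
  qed
  have lim: "(\<lambda>n. F n h x) \<longlonglongrightarrow> G h x" for h x
  proof (cases "norm h < 1")
    case True
    have "(\<lambda>n. \<bar>(\<phi> (x + t n *\<^sub>R h) - \<phi> x) / t n\<bar> powr p) \<longlonglongrightarrow> \<bar>gradient \<phi> x \<bullet> h\<bar> powr p"
      by (intro tendsto_powr' tendsto_rabs test_difference_quotient_tendsto \<phi> t tendsto_const) (use p in auto)
    then show ?thesis using True t(1) by (auto simp: F_def G_def abs_divide abs_of_pos intro!: tendsto_ennrealI)
  qed (simp add: F_def G_def)
  have inner: "(\<lambda>n. \<integral>\<^sup>+x. F n h x \<partial>lborel) \<longlonglongrightarrow> (\<integral>\<^sup>+x. G h x \<partial>lborel)" for h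
  proof (rule nn_integral_dominated_convergence)
    show "(\<integral>\<^sup>+x. c * indicator (cball (0::real^'n) (R + 1)) x \<partial>lborel) < \<infinity>"
      using B by (simp add: nn_integral_cmult B_def c_def ennreal_mult_less_top)
  qed (use bound lim in auto)
  have "(\<lambda>n. \<integral>\<^sup>+h. \<integral>\<^sup>+x. F n h x \<partial>lborel \<partial>lborel) \<longlonglongrightarrow> (\<integral>\<^sup>+h. \<integral>\<^sup>+x. G h x \<partial>lborel \<partial>lborel)"
  proof (rule nn_integral_dominated_convergence)
    show "(\<integral>\<^sup>+h. (c * B) * indicator (cball (0::real^'n) 1) h \<partial>lborel) < \<infinity>"
      using B emeasure_lborel_cball_finite[of "0::real^'n" 1]
      by (simp add: nn_integral_cmult c_def ennreal_mult_less_top)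
    show "AE h in lborel. (\<integral>\<^sup>+x. F n h x \<partial>lborel) \<le> (c * B) * indicator (cball (0::real^'n) 1) h" for n
    proof (intro AE_I2)
      fix h :: "real^'n"
      show "(\<integral>\<^sup>+x. F n h x \<partial>lborel) \<le> (c * B) * indicator (cball (0::real^'n) 1) h"
      proof (cases "norm h \<le> 1")
        case True
        have "(\<integral>\<^sup>+x. F n h x \<partial>lborel) \<le> (\<integral>\<^sup>+x. c * indicator (cball (0::real^'n) (R + 1)) x \<partial>lborel)"
          by (intro nn_integral_mono bound)
        then show ?thesis using True by (simp add: nn_integral_cmult B_def)
      next
        case False
        then show ?thesis by (simp add: F_def)
      qed
    qed
    show "AE h in lborel. (\<lambda>n. \<integral>\<^sup>+x. F n h x \<partial>lborel) \<longlonglongrightarrow> (\<integral>\<^sup>+x. G h x \<partial>lborel)"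
      by (intro AE_I2 inner)
  qed measurable
  then show ?thesis by (simp add: quotient_energy_def F_def G_def)
qed

definition directional_constant :: "real \<Rightarrow> real^'n::finite \<Rightarrow> ennreal" where
  "directional_constant p e = (\<integral>\<^sup>+h. ennreal (if norm h < 1 then \<bar>e \<bullet> h\<bar> powr p else 0) \<partial>lborel)"

text \<open>The integral is homogeneous in \<open>g\<close>, and reflections carry every unit vector into every other one.\<close>

lemma directional_integral:
  fixes g :: "real^'n::finite"
  assumes p: "0 < p"
  shows "(\<integral>\<^sup>+h. ennreal (if norm h < 1 then \<bar>g \<bullet> h\<bar> powr p else 0) \<partial>lborel)
    = directional_constant p (axis undefined 1 :: real^'n) * ennreal (norm g powr p)"
proof -
  let ?e = "axis undefined 1 :: real^'n"
  have unit: "(\<integral>\<^sup>+h. ennreal (if norm h < 1 then \<bar>u \<bullet> h\<bar> powr p else 0) \<partial>lborel) = directional_constant p (axis undefined 1 :: real^'n)"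
    if u: "norm u = 1" for u :: "real^'n"
  proof (cases "u = ?e")
    case False
    then have ne: "?e \<noteq> u" by simp
    have n: "norm (mirror ?e u h) = norm h" for h
    proof -
      have "(norm (mirror ?e u h))\<^sup>2 = (norm h)\<^sup>2" unfolding norm_mirror[OF ne] by (simp add: u norm_axis_1)
      then show ?thesis by simp
    qed
    have i: "u \<bullet> mirror ?e u h = ?e \<bullet> h" for h
    proof -
      have "(norm (mirror ?e u h - u))\<^sup>2 = (norm (h - ?e))\<^sup>2"
        using norm_mirror_diff[OF ne, of h ?e] by (simp add: mirror_left[OF ne])
      moreover have "(norm (v - z))\<^sup>2 = (norm v)\<^sup>2 - 2 * (z \<bullet> v) + (norm z)\<^sup>2" for v z :: "real^'n"
        unfolding power2_norm_eq_inner by (simp add: inner_diff_left inner_diff_right inner_commute)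
      ultimately show ?thesis by (simp add: n u norm_axis_1)
    qed
    have "(\<integral>\<^sup>+h. ennreal (if norm h < 1 then \<bar>u \<bullet> h\<bar> powr p else 0) \<partial>lborel)
        = (\<integral>\<^sup>+h. ennreal (if norm (mirror ?e u h) < 1 then \<bar>u \<bullet> mirror ?e u h\<bar> powr p else 0) \<partial>lborel)"
      by (rule nn_integral_mirror[OF ne, of "\<lambda>h. ennreal (if norm h < 1 then \<bar>u \<bullet> h\<bar> powr p else 0)", symmetric]) measurable
    then show ?thesis by (simp only: n i directional_constant_def)
  next
    case True
    show ?thesis unfolding True directional_constant_def ..
  qed
  show ?thesis
  proof (cases "g = 0")
    case True
    have "(if norm h < 1 then \<bar>0 \<bullet> h\<bar> powr p else 0) = 0" for h :: "real^'n" using p by simp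
    then show ?thesis unfolding True using p by (simp only: norm_zero) simp
  next
    case False
    define u where "u = (1 / norm g) *\<^sub>R g"
    have u: "norm u = 1" "g = norm g *\<^sub>R u" using False by (auto simp: u_def)
    have "(\<integral>\<^sup>+h. ennreal (if norm h < 1 then \<bar>g \<bullet> h\<bar> powr p else 0) \<partial>lborel)
        = (\<integral>\<^sup>+h. ennreal (norm g powr p) * ennreal (if norm h < 1 then \<bar>u \<bullet> h\<bar> powr p else 0) \<partial>lborel)"
      by (intro nn_integral_cong, subst (1) u(2)) (auto simp: abs_mult powr_mult ennreal_mult[symmetric] u(1))
    also have "\<dots> = ennreal (norm g powr p) * directional_constant p (axis undefined 1 :: real^'n)"
      by (subst nn_integral_cmult) (auto simp: unit[OF u(1)])
    finally show ?thesis by (simp add: mult.commute)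
  qed
qed

lemma directional_constant_pos_finite:
  assumes p: "0 < p"
  shows "0 < directional_constant p (axis undefined 1 :: real^'n::finite)" "directional_constant p (axis undefined 1 :: real^'n::finite) < \<infinity>"
proof -
  let ?e = "axis undefined 1 :: real^'n"
  let ?f = "\<lambda>h::real^'n. ennreal (if norm h < 1 then \<bar>?e \<bullet> h\<bar> powr p else 0)"
  have "directional_constant p (axis undefined 1 :: real^'n) \<le> (\<integral>\<^sup>+h. indicator (cball (0::real^'n) 1) h \<partial>lborel)"
    unfolding directional_constant_def
  proof (rule nn_integral_mono)
    fix h :: "real^'n"
    have "\<bar>?e \<bullet> h\<bar> \<le> norm h" using Cauchy_Schwarz_ineq2[of ?e h] by (simp add: norm_axis_1)
    then have "\<bar>?e \<bullet> h\<bar> powr p \<le> 1 powr p" if "norm h < 1" using that p by (intro powr_mono2) auto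
    then show "?f h \<le> indicator (cball 0 1) h" by auto
  qed
  then show "directional_constant p (axis undefined 1 :: real^'n) < \<infinity>"
    using emeasure_lborel_cball_finite[of "0::real^'n" 1] by (simp add: order_le_less_trans)
  show "0 < directional_constant p (axis undefined 1 :: real^'n)"
  proof (rule ccontr)
    assume "\<not> 0 < directional_constant p (axis undefined 1 :: real^'n)"
    then have "(\<integral>\<^sup>+h. ?f h \<partial>lborel) = 0" by (simp add: directional_constant_def not_less)
    then have "AE h in lborel. ?f h = 0" by (subst (asm) nn_integral_0_iff_AE) auto
    with AE_nth_nonzero[of "undefined :: 'n"] have "AE h in lborel. h \<notin> ball (0::real^'n) 1"
      by eventually_elim (auto simp: inner_axis' split: if_splits)
    then have "ball (0::real^'n) 1 \<in> null_sets lborel" by (subst AE_iff_null_sets) auto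
    then have "emeasure lborel (ball (0::real^'n) 1) = 0" by auto
    moreover have "0 < measure lborel (ball (0::real^'n) 1)" by (rule content_ball_pos) simp
    ultimately show False by (simp add: measure_def)
  qed
qed

lemma quotient_energy_tendsto_gradient:
  fixes \<phi> :: "real^'n::finite \<Rightarrow> real"
  assumes \<phi>: "\<phi> \<in> test_functions" and p: "0 < p" and t: "\<And>n. 0 < t n" "\<And>n. t n \<le> 1" "t \<longlonglongrightarrow> 0"
  shows "(\<lambda>n. quotient_energy p (t n) \<phi>) \<longlonglongrightarrow>
    directional_constant p (axis undefined 1 :: real^'n) * Lp_power p (gradient \<phi>)"
proof -
  have [measurable]: "gradient \<phi> \<in> borel_measurable borel" by (rule test_gradient_measurable[OF \<phi>])
  have "(\<integral>\<^sup>+h. \<integral>\<^sup>+x. ennreal (if norm h < 1 then \<bar>gradient \<phi> x \<bullet> h\<bar> powr p else 0) \<partial>lborel \<partial>lborel)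
      = (\<integral>\<^sup>+x. \<integral>\<^sup>+h. ennreal (if norm h < 1 then \<bar>gradient \<phi> x \<bullet> h\<bar> powr p else 0) \<partial>lborel \<partial>lborel)"
    by (rule lborel_pair.Fubini'[symmetric]) measurable
  also have "\<dots> = (\<integral>\<^sup>+x. directional_constant p (axis undefined 1 :: real^'n) * ennreal (norm (gradient \<phi> x) powr p) \<partial>lborel)"
    by (simp add: directional_integral[OF p])
  also have "\<dots> = directional_constant p (axis undefined 1 :: real^'n) * Lp_power p (gradient \<phi>)"
    by (rule nn_integral_cmult) measurable
  finally show ?thesis using quotient_energy_tendsto[OF assms] by simp
qed

text \<open>Both sides are limits of quotient energies up to the same positive factor, and the inequality
  holds for these.\<close>

lemma mollified_gradient_energy_le:
  fixes w \<phi> :: "real^'n::finite \<Rightarrow> real"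
  assumes \<phi>: "\<phi> \<in> test_functions" and w: "integrable lborel w" and d: "0 < d" and p: "1 \<le> p"
    and t: "conv (mollifier d) w \<in> test_functions"
    and le: "\<And>t. 0 < t \<Longrightarrow> nonlocal_energy p t w \<le> nonlocal_energy p t \<phi>"
  shows "Lp_power p (gradient (conv (mollifier d) w))
    \<le> Lp_power p (gradient \<phi>)"
proof -
  define s where "s n = inverse (real (Suc n))" for n
  have s: "0 < s n" "s n \<le> 1" for n by (auto simp: s_def divide_simps)
  have s0: "s \<longlonglongrightarrow> 0" unfolding s_def by (rule LIMSEQ_inverse_real_of_nat)
  have p0: "0 < p" using p by simp
  let ?k = "directional_constant p (axis undefined 1 :: real^'n)"
  have wm: "w \<in> borel_measurable borel" using w by auto
  have "quotient_energy p (s n) (conv (mollifier d) w) \<le> quotient_energy p (s n) \<phi>" for n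
    using quotient_energy_conv_le[OF d w p s(1)]
      quotient_energy_mono_of_nonlocal[OF wm test_measurable[OF \<phi>] s(1) le[OF s(1)]]
    by (rule order_trans)
  then have "?k * Lp_power p (gradient (conv (mollifier d) w))
      \<le> ?k * Lp_power p (gradient \<phi>)"
    by (intro LIMSEQ_le[OF quotient_energy_tendsto_gradient[OF t p0 s s0] quotient_energy_tendsto_gradient[OF \<phi> p0 s s0]]) auto
  then show ?thesis
    using directional_constant_pos_finite[OF p0, where 'n='n] by (subst (asm) ennreal_mult_le_mult_iff) auto
qed

section \<open>Lipschitz functions in D1p\<close>

definition gradient_square :: "(real^'n::finite \<Rightarrow> real) \<Rightarrow> real" where
  "gradient_square \<psi> = (\<integral>x. (norm (gradient \<psi> x))\<^sup>2 \<partial>lborel)"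

text \<open>A convex set of approximations of \<open>w\<close>. The bounds on support and gradient turn convergence of the
  gradients almost everywhere into convergence in \<open>L\<^sup>p\<close>.\<close>

definition approximants ::
    "(real^'n::finite \<Rightarrow> real) \<Rightarrow> real \<Rightarrow> real \<Rightarrow> real \<Rightarrow> ennreal \<Rightarrow> real \<Rightarrow> (real^'n \<Rightarrow> real) set" where
  "approximants w R L p M \<delta> = {\<psi> \<in> test_functions. (\<forall>x. norm x > R \<longrightarrow> \<psi> x = 0) \<and>
     (\<forall>x. norm (gradient \<psi> x) \<le> L) \<and>
     Lp_power p (gradient \<psi>) \<le> M \<and> (\<forall>x. \<bar>\<psi> x - w x\<bar> \<le> \<delta>)}"

lemma gradient_midpoint:
  assumes "\<psi> \<in> test_functions" "\<eta> \<in> test_functions"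
  shows "gradient (\<lambda>x. (1/2) * (\<psi> x + \<eta> x)) x = (1/2) *\<^sub>R (gradient \<psi> x + gradient \<eta> x)"
proof -
  have "gradient (\<lambda>x. (1/2) * (\<psi> x + \<eta> x)) x = (1/2) *\<^sub>R gradient (\<lambda>x. \<psi> x + \<eta> x) x"
    by (intro gradient_scale differentiable_add test_differentiable assms)
  also have "gradient (\<lambda>x. \<psi> x + \<eta> x) x = gradient \<psi> x + gradient \<eta> x"
    by (intro gradient_add test_differentiable assms)
  finally show ?thesis .
qed

lemma approximants_midpoint:
  fixes \<psi> \<eta> :: "real^'n::finite \<Rightarrow> real"
  assumes p: "1 \<le> p" and \<psi>: "\<psi> \<in> approximants w R L p M \<delta>" and \<eta>: "\<eta> \<in> approximants w R L p M \<delta>"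
  shows "(\<lambda>x. (1/2) * (\<psi> x + \<eta> x)) \<in> approximants w R L p M \<delta>"
proof -
  have t: "\<psi> \<in> test_functions" "\<eta> \<in> test_functions" using \<psi> \<eta> by (auto simp: approximants_def)
  have [measurable]: "gradient \<psi> \<in> borel_measurable borel" "gradient \<eta> \<in> borel_measurable borel"
    using t by (auto intro: test_gradient_measurable)
  have "Lp_power p (gradient (\<lambda>x. (1/2) * (\<psi> x + \<eta> x)))
      \<le> (\<integral>\<^sup>+x. ennreal (1/2) * ennreal (norm (gradient \<psi> x) powr p) + ennreal (1/2) * ennreal (norm (gradient \<eta> x) powr p) \<partial>lborel)"
  proof (rule nn_integral_mono)
    fix x
    show "ennreal (norm (gradient (\<lambda>x. (1/2) * (\<psi> x + \<eta> x)) x) powr p)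
        \<le> ennreal (1/2) * ennreal (norm (gradient \<psi> x) powr p) + ennreal (1/2) * ennreal (norm (gradient \<eta> x) powr p)"
      unfolding gradient_midpoint[OF t]
    proof -
      have *: "ennreal h * ennreal a + ennreal h * ennreal b = ennreal (h * a + h * b)"
        if "0 \<le> a" "0 \<le> b" "0 \<le> h" for a b h :: real
        using that by (simp add: ennreal_mult)
      show "ennreal (norm ((1/2) *\<^sub>R (gradient \<psi> x + gradient \<eta> x)) powr p)
          \<le> ennreal (1/2) * ennreal (norm (gradient \<psi> x) powr p) + ennreal (1/2) * ennreal (norm (gradient \<eta> x) powr p)"
        unfolding *[OF powr_ge_zero powr_ge_zero zero_le_divide_1_iff[THEN iffD2, OF zero_le_numeral]]
        using norm_powr_midpoint[OF p, of "gradient \<psi> x" "gradient \<eta> x"]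
        by (intro ennreal_leI) (simp only: add_divide_distrib mult_1_left times_divide_eq_left)
    qed
  qed
  also have "\<dots> = ennreal (1/2) * Lp_power p (gradient \<psi>)
      + ennreal (1/2) * Lp_power p (gradient \<eta>)"
    by (simp add: nn_integral_add nn_integral_cmult)
  also have "\<dots> \<le> ennreal (1/2) * M + ennreal (1/2) * M"
    using \<psi> \<eta> by (intro add_mono mult_left_mono) (auto simp: approximants_def)
  also have "\<dots> = (ennreal (1/2) + ennreal (1/2)) * M" by (simp only: distrib_right)
  also have "\<dots> = M" by (subst ennreal_plus[symmetric]) auto
  finally have "Lp_power p (gradient (\<lambda>x. (1/2) * (\<psi> x + \<eta> x))) \<le> M" .
  moreover have "norm (gradient (\<lambda>x. (1/2) * (\<psi> x + \<eta> x)) x) \<le> L" for x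
  proof -
    have "norm (gradient \<psi> x) \<le> L" "norm (gradient \<eta> x) \<le> L" using \<psi> \<eta> by (auto simp: approximants_def)
    then show ?thesis
      unfolding gradient_midpoint[OF t] using norm_triangle_ineq[of "gradient \<psi> x" "gradient \<eta> x"] by simp
  qed
  moreover have "\<bar>(1/2) * (\<psi> x + \<eta> x) - w x\<bar> \<le> \<delta>" for x
  proof -
    have "\<bar>\<psi> x - w x\<bar> \<le> \<delta>" "\<bar>\<eta> x - w x\<bar> \<le> \<delta>" using \<psi> \<eta> by (auto simp: approximants_def)
    then show ?thesis by (simp add: abs_le_iff field_simps)
  qed
  moreover have "(\<lambda>x. (1/2) * (\<psi> x + \<eta> x)) \<in> test_functions"
    by (intro test_scale test_add t)
  ultimately show ?thesis using \<psi> \<eta> unfolding approximants_def by simp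
qed

lemma gradient_square_integrable:
  assumes "\<psi> \<in> test_functions" "\<eta> \<in> test_functions"
  shows "integrable lborel (\<lambda>x. (norm (gradient \<psi> x - gradient \<eta> x))\<^sup>2)"
    and "integrable lborel (\<lambda>x. (norm (gradient \<psi> x))\<^sup>2)"
proof -
  obtain R where R: "\<And>x. norm x > R \<Longrightarrow> \<psi> x = 0" by (rule test_support[OF assms(1)]) blast
  obtain S where S: "\<And>x. norm x > S \<Longrightarrow> \<eta> x = 0" by (rule test_support[OF assms(2)]) blast
  show "integrable lborel (\<lambda>x. (norm (gradient \<psi> x - gradient \<eta> x))\<^sup>2)"
    by (rule integrable_continuous_bounded_support[where R="max R S"])
      (auto intro!: continuous_intros test_gradient_continuous assms simp: gradient_zero_outside[OF R] gradient_zero_outside[OF S])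
  show "integrable lborel (\<lambda>x. (norm (gradient \<psi> x))\<^sup>2)"
    by (rule integrable_continuous_bounded_support[where R=R])
      (auto intro!: continuous_intros test_gradient_continuous assms simp: gradient_zero_outside[OF R])
qed

lemma gradient_square_parallelogram:
  assumes t: "\<psi> \<in> test_functions" "\<eta> \<in> test_functions"
  shows "(\<integral>x. (norm (gradient \<psi> x - gradient \<eta> x))\<^sup>2 \<partial>lborel)
    = 2 * gradient_square \<psi> + 2 * gradient_square \<eta> - 4 * gradient_square (\<lambda>x. (1/2) * (\<psi> x + \<eta> x))"
proof -
  let ?m = "\<lambda>x. (1/2) * (\<psi> x + \<eta> x)"
  have m: "?m \<in> test_functions" by (intro test_scale test_add t)
  note i = gradient_square_integrable(2)[OF t(1,1)] gradient_square_integrable(2)[OF t(2,2)] gradient_square_integrable(2)[OF m m]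
  have eq: "(norm (gradient \<psi> x - gradient \<eta> x))\<^sup>2
      = (2 * (norm (gradient \<psi> x))\<^sup>2 + 2 * (norm (gradient \<eta> x))\<^sup>2) - 4 * (norm (gradient ?m x))\<^sup>2" for x
    unfolding gradient_midpoint[OF t] power2_norm_eq_inner
    by (simp add: inner_diff_left inner_diff_right inner_add_left inner_add_right inner_commute algebra_simps)
  show ?thesis
    unfolding eq gradient_square_def using i by simp
qed

text \<open>The mollifications of \<open>w\<close> are approximants of \<open>w\<close> with \<open>M\<close> the energy of \<open>\<phi>\<close>. Their gradients are
  bounded, but an argument is needed to make gradients converge. Let \<open>\<psi>\<^sub>n\<close> almost minimize
  \<open>\<integral>\<bar>\<nabla>\<psi>\<bar>\<^sup>2\<close> among all approximants with error at most \<open>1/(n + 1)\<close>. These minima increase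
  with \<open>n\<close> and are bounded, so by the parallelogram law the gradients form a Cauchy sequence in \<open>L\<^sup>2\<close>,
  and on a bounded set also in \<open>L\<^sup>1\<close>. A subsequence converges almost everywhere. Its limit is the weak
  gradient of \<open>w\<close>, and dominated convergence gives the convergence in \<open>L\<^sup>p\<close> that \<open>D1p\<close> requires.\<close>

lemma Lipschitz_in_D1p:
  fixes w \<phi> :: "real^'n::finite \<Rightarrow> real"
  assumes p: "1 < p" "p < real CARD('n)" and \<phi>: "\<phi> \<in> test_functions" and LR: "0 \<le> L" "0 \<le> R"
    and L: "\<And>x y. \<bar>w x - w y\<bar> \<le> L * norm (x - y)" and R: "\<And>x. norm x > R \<Longrightarrow> w x = 0"
    and le: "\<And>t. 0 < t \<Longrightarrow> nonlocal_energy p t w \<le> nonlocal_energy p t \<phi>"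
  shows "w \<in> D1p p" "dirichlet_energy p w \<le> Lp_power p (gradient \<phi>)"
proof -
  define M where "M = Lp_power p (gradient \<phi>)"
  have p1: "1 \<le> p" using p by simp
  have w_cont: "continuous_on UNIV w" by (rule Lipschitz_continuous[OF L LR(1)])
  have [measurable]: "w \<in> borel_measurable borel" by (rule borel_measurable_continuous_onI[OF w_cont])
  have w_int: "integrable lborel w" by (rule integrable_continuous_bounded_support[OF w_cont R])
  obtain B where B: "0 < B" "\<And>x. \<bar>w x\<bar> \<le> B"
    using bounded_continuous_bounded_support[OF w_cont R] by (metis real_norm_def)
  define A where "A n = approximants w (R + 1) L p M (inverse (real (Suc n)))" for n
  have A_ne: "A n \<noteq> {}" for n
  proof -
    define d where "d = min 1 (inverse (real (Suc n)) / (L + 1))"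
    have d: "0 < d" "d \<le> 1" "L * d \<le> inverse (real (Suc n))"
    proof -
      show "0 < d" "d \<le> 1" using LR by (auto simp: d_def)
      have "L * d \<le> L * (inverse (real (Suc n)) / (L + 1))" using LR by (intro mult_left_mono) (auto simp: d_def)
      also have "\<dots> = inverse (real (Suc n)) * (L / (L + 1))" by simp
      also have "\<dots> \<le> inverse (real (Suc n)) * 1" using LR by (intro mult_left_mono) (auto simp: pos_divide_le_eq)
      finally show "L * d \<le> inverse (real (Suc n))" by simp
    qed
    let ?\<psi> = "conv (mollifier d) w"
    have t: "?\<psi> \<in> test_functions" by (rule conv_mollifier_test[OF d(1) w_int R])
    have "?\<psi> \<in> A n"
      unfolding A_def approximants_def
    proof (intro CollectI conjI allI impI)
      show "?\<psi> x = 0" if "norm x > R + 1" for x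
        by (rule conv_outside[OF R mollifier_outside[OF d(1)]]) (use that d in auto)
      show "norm (gradient ?\<psi> x) \<le> L" for x
        by (rule gradient_bound_of_Lipschitz[OF test_differentiable[OF t] conv_Lipschitz[OF d(1) w_int L]])
      show "Lp_power p (gradient ?\<psi>) \<le> M"
        unfolding M_def by (rule mollified_gradient_energy_le[OF \<phi> w_int d(1) p1 t le])
      show "\<bar>?\<psi> x - w x\<bar> \<le> inverse (real (Suc n))" for x
      proof (rule conv_mollifier_error[OF d(1) w_int])
        fix y assume "norm (x - y) < d"
        then have "L * norm (y - x) \<le> L * d" using LR by (intro mult_left_mono) (auto simp: norm_minus_commute)
        then show "\<bar>w y - w x\<bar> \<le> inverse (real (Suc n))" using L[of y x] d(3) by linarith
      qed
    qed (rule t)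
    then show ?thesis by blast
  qed
  have A_mono: "A n \<subseteq> A m" if "m \<le> n" for m n
  proof -
    have "inverse (real (Suc n)) \<le> inverse (real (Suc m))" using that by (simp add: divide_simps)
    then show ?thesis unfolding A_def approximants_def by (auto intro: order_trans)
  qed
  define V where "V = measure lborel (cball (0::real^'n) (R + 1))"
  have V: "0 \<le> V" by (simp add: V_def)
  have V_int: "integrable lborel (\<lambda>x::real^'n. c * indicator (cball 0 (R + 1)) x)" for c :: real
    using emeasure_lborel_cball_finite by (intro integrable_mult_right integrable_real_indicator) auto
  have sq_nonneg: "0 \<le> gradient_square \<psi>" for \<psi> :: "real^'n \<Rightarrow> real"
    unfolding gradient_square_def by (intro Bochner_Integration.integral_nonneg) simp
  have AD: "\<psi> \<in> test_functions" "\<And>x. norm x > R + 1 \<Longrightarrow> \<psi> x = 0" "\<And>x. norm (gradient \<psi> x) \<le> L"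
      "Lp_power p (gradient \<psi>) \<le> M" "\<And>x. \<bar>\<psi> x - w x\<bar> \<le> inverse (real (Suc n))"
      "\<And>x. norm x > R + 1 \<Longrightarrow> gradient \<psi> x = 0"
    if "\<psi> \<in> A n" for \<psi> n
    using that gradient_zero_outside[of "R + 1" \<psi>] unfolding A_def approximants_def by auto
  have sq_le: "gradient_square \<psi> \<le> L\<^sup>2 * V" if "\<psi> \<in> A n" for \<psi> n
  proof -
    note a = AD[OF that]
    have "gradient_square \<psi> \<le> (\<integral>x. L\<^sup>2 * indicator (cball 0 (R + 1)) x \<partial>(lborel :: (real^'n) measure))"
      unfolding gradient_square_def
    proof (rule integral_mono[OF gradient_square_integrable(2)[OF a(1,1)] V_int])
      show "(norm (gradient \<psi> x))\<^sup>2 \<le> L\<^sup>2 * indicator (cball 0 (R + 1)) x" for x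
        using a(3)[of x] a(6)[of x] by (cases "norm x > R + 1") (auto intro: power_mono)
    qed
    then show ?thesis by (simp add: V_def)
  qed
  define m where "m n = Inf (gradient_square ` A n)" for n
  have bdd: "bdd_below (gradient_square ` A n)" for n by (rule bdd_belowI2[of _ 0]) (rule sq_nonneg)
  have "incseq m"
    unfolding incseq_def m_def by (intro allI impI cInf_superset_mono bdd image_mono A_mono) (simp_all add: A_ne)
  moreover have "m n \<le> L\<^sup>2 * V" for n
  proof -
    obtain \<psi> where "\<psi> \<in> A n" using A_ne by blast
    then show ?thesis unfolding m_def using sq_le bdd by (intro cInf_lower2[of "gradient_square \<psi>"]) auto
  qed
  ultimately obtain ml where ml: "m \<longlonglongrightarrow> ml" "\<And>i. m i \<le> ml"
    using incseq_convergent[of m "L\<^sup>2 * V"] by blast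
  have "\<exists>\<psi>\<in>A n. gradient_square \<psi> < m n + inverse (real (Suc n))" for n
  proof -
    have "Inf (gradient_square ` A n) < m n + inverse (real (Suc n))" by (simp add: m_def)
    then show ?thesis using A_ne by (subst (asm) cInf_less_iff) (auto simp: bdd)
  qed
  then obtain \<psi> where \<psi>: "\<And>n. \<psi> n \<in> A n" "\<And>n. gradient_square (\<psi> n) < m n + inverse (real (Suc n))" by metis
  note \<psi>t = AD(1)[OF \<psi>(1)] and \<psi>0 = AD(2)[OF \<psi>(1)] and \<psi>L = AD(3)[OF \<psi>(1)] and \<psi>M = AD(4)[OF \<psi>(1)]
    and \<psi>w = AD(5)[OF \<psi>(1)] and \<psi>g0 = AD(6)[OF \<psi>(1)]
  have cauchy2: "(\<integral>x. (norm (gradient (\<psi> i) x - gradient (\<psi> j) x))\<^sup>2 \<partial>lborel) \<le> 4 * (ml - m n + inverse (real (Suc n)))"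
    if "n \<le> i" "n \<le> j" for i j n
  proof -
    have near: "gradient_square (\<psi> k) \<le> ml + inverse (real (Suc n))" if "n \<le> k" for k
    proof -
      have "inverse (real (Suc k)) \<le> inverse (real (Suc n))" using that by (simp add: divide_simps)
      then show ?thesis using \<psi>(2)[of k] ml(2)[of k] by linarith
    qed
    have "(\<lambda>x. (1/2) * (\<psi> i x + \<psi> j x)) \<in> A n"
      using \<psi>(1)[of i] \<psi>(1)[of j] A_mono[OF that(1)] A_mono[OF that(2)] unfolding A_def
      by (intro approximants_midpoint[OF p1]) auto
    then have "m n \<le> gradient_square (\<lambda>x. (1/2) * (\<psi> i x + \<psi> j x))"
      unfolding m_def using bdd by (intro cInf_lower) auto
    then show ?thesis
      unfolding gradient_square_parallelogram[OF \<psi>t \<psi>t] using near[OF that(1)] near[OF that(2)] by simp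
  qed
  have grad_int: "integrable lborel (gradient (\<psi> n))" for n
    by (rule integrable_continuous_bounded_support[OF test_gradient_continuous[OF \<psi>t] \<psi>g0])
  have cauchy1: "\<exists>N. \<forall>i\<ge>N. \<forall>j\<ge>N. (\<integral>x. norm (gradient (\<psi> i) x - gradient (\<psi> j) x) \<partial>lborel) < e" if "0 < e" for e
  proof -
    \<comment> \<open>By \<open>a \<le> c + a\<^sup>2 / c\<close> the \<open>L\<^sup>2\<close> estimate implies one in \<open>L\<^sup>1\<close> on the ball, of volume \<open>V\<close>.\<close>
    define c where "c = e / (4 * (V + 1))"
    have c: "0 < c" "c * V \<le> e / 4" using that V by (auto simp: c_def field_simps)
    have "(\<lambda>n. 4 * (ml - m n + inverse (real (Suc n)))) \<longlonglongrightarrow> 4 * (ml - ml + 0)"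
      by (intro tendsto_intros ml LIMSEQ_inverse_real_of_nat)
    then have "\<forall>\<^sub>F n in sequentially. 4 * (ml - m n + inverse (real (Suc n))) < c * e / 4"
      using c that by (intro order_tendstoD(2)) auto
    then obtain N where N: "4 * (ml - m N + inverse (real (Suc N))) < c * e / 4"
      by (auto simp: eventually_sequentially)
    have "(\<integral>x. norm (gradient (\<psi> i) x - gradient (\<psi> j) x) \<partial>lborel) < e" if ij: "N \<le> i" "N \<le> j" for i j
    proof -
      let ?D = "\<lambda>x. norm (gradient (\<psi> i) x - gradient (\<psi> j) x)"
      have i2: "integrable lborel (\<lambda>x. (1 / c) * (?D x)\<^sup>2)"
        by (intro integrable_mult_right gradient_square_integrable \<psi>t)
      have "(\<integral>x. ?D x \<partial>lborel) \<le> (\<integral>x. c * indicator (cball 0 (R + 1)) x + (1 / c) * (?D x)\<^sup>2 \<partial>lborel)"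
      proof (rule integral_mono)
        show "integrable lborel ?D" by (intro integrable_norm Bochner_Integration.integrable_diff grad_int)
        show "integrable lborel (\<lambda>x. c * indicator (cball 0 (R + 1)) x + (1 / c) * (?D x)\<^sup>2)"
          by (intro Bochner_Integration.integrable_add V_int i2)
        show "?D x \<le> c * indicator (cball 0 (R + 1)) x + (1 / c) * (?D x)\<^sup>2" for x
        proof (cases "norm x > R + 1")
          case True
          then show ?thesis by (simp add: \<psi>g0)
        next
          case False
          have "a \<le> c + (1 / c) * a\<^sup>2" if "0 \<le> a" for a :: real
          proof (cases "a \<le> c")
            case True
            have "0 \<le> (1 / c) * a\<^sup>2" using c(1) by simp
            then show ?thesis using True by linarith
          next
            case False
            then have "c * a \<le> a * a" using that by (intro mult_right_mono) auto
            then have "a \<le> (1 / c) * a\<^sup>2" using c(1) by (simp add: power2_eq_square field_simps)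
            then show ?thesis using c(1) by linarith
          qed
          then show ?thesis using False by simp
        qed
      qed
      also have "\<dots> = c * V + (1 / c) * (\<integral>x. (?D x)\<^sup>2 \<partial>lborel)"
        by (subst Bochner_Integration.integral_add[OF V_int i2]) (simp add: V_def)
      also have "\<dots> \<le> e / 4 + (1 / c) * (c * e / 4)"
        using cauchy2[OF ij] N c by (intro add_mono mult_left_mono) auto
      also have "\<dots> < e" using c \<open>0 < e\<close> by simp
      finally show ?thesis .
    qed
    then show ?thesis by blast
  qed
  obtain r where r: "strict_mono r" "AE x in lborel. Cauchy (\<lambda>i. gradient (\<psi> (r i)) x)"
    by (rule cauchy_L1_AE_cauchy_subseq[OF grad_int cauchy1])
  define G where "G x = lim (\<lambda>i. gradient (\<psi> (r i)) x)" for x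
  have gm[measurable]: "gradient (\<psi> n) \<in> borel_measurable borel" for n by (rule test_gradient_measurable[OF \<psi>t])
  have Gm[measurable]: "G \<in> borel_measurable borel" unfolding G_def by measurable
  have limG: "AE x in lborel. (\<lambda>i. gradient (\<psi> (r i)) x) \<longlonglongrightarrow> G x"
    using r(2) by eventually_elim (simp add: G_def Cauchy_convergent_iff convergent_LIMSEQ_iff)
  have G_bound: "AE x in lborel. norm (G x) \<le> L * indicator (cball 0 (R + 1)) x"
    using limG
  proof eventually_elim
    case (elim x)
    have "norm (gradient (\<psi> (r i)) x) \<le> L * indicator (cball 0 (R + 1)) x" for i
      using \<psi>L \<psi>g0 by (cases "norm x > R + 1") auto
    then show ?case by (intro LIMSEQ_le_const2[OF tendsto_norm[OF elim]]) auto
  qed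
  have G_int: "integrable lborel G"
    by (rule Bochner_Integration.integrable_bound[OF V_int[of L]]) (use G_bound LR in \<open>auto elim!: eventually_mono\<close>)
  have \<psi>_lim: "(\<lambda>i. \<psi> (r i) x) \<longlonglongrightarrow> w x" for x
  proof -
    have "(\<lambda>i. \<psi> (r i) x - w x) \<longlonglongrightarrow> 0"
    proof (rule Lim_null_comparison)
      show "\<forall>\<^sub>F i in sequentially. norm (\<psi> (r i) x - w x) \<le> inverse (real (Suc (r i)))"
        using \<psi>w by (intro always_eventually) simp
      show "(\<lambda>i. inverse (real (Suc (r i)))) \<longlonglongrightarrow> 0"
        using LIMSEQ_subseq_LIMSEQ[OF LIMSEQ_inverse_real_of_nat r(1)] by (simp add: o_def)
    qed
    then show ?thesis by (simp add: LIM_zero_iff)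
  qed
  have \<psi>B: "\<bar>\<psi> i x\<bar> \<le> B + 1" for i x
  proof -
    have "inverse (real (Suc i)) \<le> 1" by (simp add: divide_simps)
    then show ?thesis using \<psi>w[of i x] B(2)[of x] by linarith
  qed
  have wG: "has_weak_gradient w G"
    unfolding has_weak_gradient_def
  proof (intro conjI allI impI ballI)
    show "set_integrable lborel C w" if "compact C" for C
      unfolding set_integrable_def using that w_int by (intro integrable_mult_indicator) (auto simp: compact_imp_closed borel_closed)
    show "set_integrable lborel C G" if "compact C" for C
      unfolding set_integrable_def using that G_int by (intro integrable_mult_indicator) (auto simp: compact_imp_closed borel_closed)
    fix \<eta> :: "real^'n \<Rightarrow> real" and i assume \<eta>: "\<eta> \<in> test_functions"
    have [measurable]: "\<eta> \<in> borel_measurable borel" "partial i \<eta> \<in> borel_measurable borel" "\<psi> n \<in> borel_measurable borel" for n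
      by (intro test_measurable test_partial \<eta> \<psi>t)+
    have nth: "(\<lambda>v::real^'n. v $ i) \<in> borel_measurable borel"
      by (intro borel_measurable_continuous_onI continuous_intros)
    have [measurable]: "(\<lambda>x. G x $ i) \<in> borel_measurable borel"
        "(\<lambda>x. gradient (\<psi> n) x $ i) \<in> borel_measurable borel" for n
      by (rule measurable_compose[OF Gm nth], rule measurable_compose[OF gm nth])
    have lim1: "(\<lambda>n. \<integral>x. \<psi> (r n) x * partial i \<eta> x \<partial>lborel) \<longlonglongrightarrow> (\<integral>x. w x * partial i \<eta> x \<partial>lborel)"
    proof (rule integral_dominated_convergence)
      show "integrable lborel (\<lambda>x. (B + 1) * \<bar>partial i \<eta> x\<bar>)"
        by (intro integrable_mult_right integrable_abs test_integrable test_partial \<eta>)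
      show "AE x in lborel. norm (\<psi> (r n) x * partial i \<eta> x) \<le> (B + 1) * \<bar>partial i \<eta> x\<bar>" for n
        using \<psi>B by (intro AE_I2) (simp add: abs_mult mult_right_mono)
      show "AE x in lborel. (\<lambda>n. \<psi> (r n) x * partial i \<eta> x) \<longlonglongrightarrow> w x * partial i \<eta> x"
        by (intro AE_I2 tendsto_intros \<psi>_lim)
    qed measurable
    have lim2: "(\<lambda>n. \<integral>x. gradient (\<psi> (r n)) x $ i * \<eta> x \<partial>lborel) \<longlonglongrightarrow> (\<integral>x. G x $ i * \<eta> x \<partial>lborel)"
    proof (rule integral_dominated_convergence)
      show "integrable lborel (\<lambda>x. L * \<bar>\<eta> x\<bar>)"
        by (intro integrable_mult_right integrable_abs test_integrable \<eta>)
      show "AE x in lborel. norm (gradient (\<psi> (r n)) x $ i * \<eta> x) \<le> L * \<bar>\<eta> x\<bar>" for n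
        using order_trans[OF component_le_norm_cart \<psi>L] by (intro AE_I2) (simp add: abs_mult mult_right_mono)
      show "AE x in lborel. (\<lambda>n. gradient (\<psi> (r n)) x $ i * \<eta> x) \<longlonglongrightarrow> G x $ i * \<eta> x"
        using limG by eventually_elim (intro tendsto_intros)
    qed measurable
    have parts: "(\<integral>x. \<psi> (r n) x * partial i \<eta> x \<partial>lborel) = - (\<integral>x. gradient (\<psi> (r n)) x $ i * \<eta> x \<partial>lborel)" for n
      using integration_by_parts[OF \<psi>t \<eta>] by (simp add: gradient_def)
    show "(\<integral>x. w x * partial i \<eta> x \<partial>lborel) = - (\<integral>x. G x $ i * \<eta> x \<partial>lborel)"
      by (rule LIMSEQ_unique[OF lim1[unfolded parts] tendsto_minus[OF lim2]])
  qed measurable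
  note W = weak_gradient_AE_eq[OF wG]
  have Wm[measurable]: "weak_gradient w \<in> borel_measurable borel"
    using W(1) by (simp add: has_weak_gradient_def)
  have energy: "Lp_power p (weak_gradient w) = Lp_power p G"
    by (rule nn_integral_cong_AE) (use W(2) in eventually_elim, simp)
  have c_fin: "(\<integral>\<^sup>+x. ennreal (c * indicator (cball (0::real^'n) (R + 1)) x) \<partial>lborel) < \<infinity>" if "0 \<le> c" for c
    using V_int[of c] that by (subst nn_integral_eq_integral) auto
  have G_fin: "Lp_power p G < \<infinity>"
  proof (rule order_le_less_trans[OF nn_integral_mono_AE c_fin[of "L powr p"]])
    show "AE x in lborel. ennreal (norm (G x) powr p) \<le> ennreal (L powr p * indicator (cball (0::real^'n) (R + 1)) x)"
      using G_bound
    proof eventually_elim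
      case (elim x)
      then show ?case using p by (cases "norm x > R + 1") (auto intro!: ennreal_leI powr_mono2)
    qed
  qed simp
  show "dirichlet_energy p w \<le> Lp_power p (gradient \<phi>)"
  proof -
    have "dirichlet_energy p w = Lp_power p G"
      by (simp add: dirichlet_energy_def energy)
    also have "\<dots> \<le> (\<integral>\<^sup>+x. liminf (\<lambda>i. ennreal (norm (gradient (\<psi> (r i)) x) powr p)) \<partial>lborel)"
    proof (rule nn_integral_mono_AE, use limG in eventually_elim)
      case (elim x)
      have "(\<lambda>i. ennreal (norm (gradient (\<psi> (r i)) x) powr p)) \<longlonglongrightarrow> ennreal (norm (G x) powr p)"
        by (intro tendsto_ennrealI tendsto_powr' tendsto_norm elim tendsto_const) (use p in auto)
      from lim_imp_Liminf[OF _ this] show ?case by simp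
    qed
    also have "\<dots> \<le> liminf (\<lambda>i. \<integral>\<^sup>+x. ennreal (norm (gradient (\<psi> (r i)) x) powr p) \<partial>lborel)"
      by (rule nn_integral_liminf) measurable
    also have "\<dots> \<le> liminf (\<lambda>i::nat. M)"
      by (intro Liminf_mono always_eventually allI \<psi>M)
    finally show ?thesis by (simp add: Liminf_const M_def)
  qed
  show "w \<in> D1p p"
    unfolding D1p_def
  proof (intro CollectI conjI exI[of _ "\<lambda>i. \<psi> (r i)"])
    let ?s = "real CARD('n) * p / (real CARD('n) - p)"
    have s: "0 \<le> ?s" using p by simp
    have "(\<integral>\<^sup>+x. ennreal (\<bar>w x\<bar> powr ?s) \<partial>lborel) \<le> (\<integral>\<^sup>+x. ennreal (B powr ?s * indicator (cball (0::real^'n) (R + 1)) x) \<partial>lborel)"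
    proof (intro nn_integral_mono ennreal_leI)
      fix x
      show "\<bar>w x\<bar> powr ?s \<le> B powr ?s * indicator (cball (0::real^'n) (R + 1)) x"
        using B R[of x] s by (cases "norm x > R + 1") (auto intro!: powr_mono2)
    qed
    then show "(\<integral>\<^sup>+x. ennreal (\<bar>w x\<bar> powr ?s) \<partial>lborel) < \<infinity>"
      by (rule order_le_less_trans) (rule c_fin, simp)
    show "has_weak_gradient w (weak_gradient w)" by (rule W(1))
    show "Lp_power p (weak_gradient w) < \<infinity>" using energy G_fin by simp
    have "(\<lambda>j. \<integral>\<^sup>+x. ennreal (norm (gradient (\<psi> (r j)) x - weak_gradient w x) powr p) \<partial>lborel)
        \<longlonglongrightarrow> (\<integral>\<^sup>+x. 0 \<partial>(lborel :: (real^'n) measure))"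
    proof (rule nn_integral_dominated_convergence)
      show "(\<integral>\<^sup>+x. ennreal ((2 * L) powr p * indicator (cball (0::real^'n) (R + 1)) x) \<partial>lborel) < \<infinity>"
        by (rule c_fin) simp
      show "AE x in lborel. ennreal (norm (gradient (\<psi> (r j)) x - weak_gradient w x) powr p)
          \<le> ennreal ((2 * L) powr p * indicator (cball (0::real^'n) (R + 1)) x)" for j
        using G_bound W(2)
      proof eventually_elim
        case (elim x)
        show ?case
        proof (cases "norm x > R + 1")
          case True
          then show ?thesis using elim \<psi>g0[OF True] p by simp
        next
          case False
          have "norm (gradient (\<psi> (r j)) x - weak_gradient w x) \<le> 2 * L"
            using norm_triangle_ineq4[of "gradient (\<psi> (r j)) x" "G x"] \<psi>L[of "r j" x] elim False by simp
          then show ?thesis using False p by (auto intro!: ennreal_leI powr_mono2)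
        qed
      qed
      show "AE x in lborel. (\<lambda>j. ennreal (norm (gradient (\<psi> (r j)) x - weak_gradient w x) powr p)) \<longlonglongrightarrow> 0"
        using limG W(2)
      proof eventually_elim
        case (elim x)
        have "(\<lambda>j. norm (gradient (\<psi> (r j)) x - G x) powr p) \<longlonglongrightarrow> norm (G x - G x) powr p"
          by (intro tendsto_powr' tendsto_norm tendsto_diff elim tendsto_const) (use p in auto)
        then show ?case using elim(2) p by (auto dest: tendsto_ennrealI)
      qed
    qed measurable
    then show "(\<lambda>j. \<integral>\<^sup>+x. ennreal (norm (gradient (\<psi> (r j)) x - weak_gradient w x) powr p) \<partial>lborel) \<longlonglongrightarrow> 0"
      by simp
  qed (use \<psi>t in auto)
qed

section \<open>Functions fixed by Schwarz symmetrization\<close>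

lemma ball0_measurable:
  assumes "finite I" shows "ball0 I r \<in> sets (leb_on I)"
proof -
  have [measurable]: "(\<lambda>y. L2_set y I) \<in> borel_measurable (leb_on I)"
    unfolding L2_set_def by measurable
  show ?thesis unfolding ball0_def by measurable
qed

lemma emeasure_leb_on_box:
  assumes "finite I" "\<And>i. i \<in> I \<Longrightarrow> A i \<in> sets borel"
  shows "emeasure (leb_on I) (Pi\<^sub>E I A) = (\<Prod>i\<in>I. emeasure lborel (A i))"
proof -
  interpret product_sigma_finite "\<lambda>_::'a. lborel :: real measure" ..
  show ?thesis using assms by (intro emeasure_PiM) auto
qed

lemma ball0_finite_measure:
  assumes I: "finite I" shows "emeasure (leb_on I) (ball0 I r) < \<infinity>"
proof -
  have "ball0 I r \<subseteq> Pi\<^sub>E I (\<lambda>_. {- \<bar>r\<bar>..\<bar>r\<bar>})"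
  proof
    fix y assume y: "y \<in> ball0 I r"
    have "\<bar>y i\<bar> \<le> \<bar>r\<bar>" if "i \<in> I" for i
    proof -
      have "\<bar>y i\<bar> = sqrt ((y i)\<^sup>2)" by simp
      also have "\<dots> \<le> L2_set y I" unfolding L2_set_def using I that by (intro real_sqrt_le_mono member_le_sum) auto
      also have "\<dots> \<le> \<bar>r\<bar>" using y unfolding ball0_def by auto
      finally show ?thesis .
    qed
    then show "y \<in> Pi\<^sub>E I (\<lambda>_. {- \<bar>r\<bar>..\<bar>r\<bar>})"
      using y by (auto simp: ball0_def space_PiM PiE_iff abs_le_iff minus_le_iff)
  qed
  moreover have "Pi\<^sub>E I (\<lambda>_. {- \<bar>r\<bar>..\<bar>r\<bar>}) \<in> sets (leb_on I)"
    by (rule sets_PiM_I_finite[OF I]) simp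
  ultimately have "emeasure (leb_on I) (ball0 I r) \<le> emeasure (leb_on I) (Pi\<^sub>E I (\<lambda>_. {- \<bar>r\<bar>..\<bar>r\<bar>}))"
    by (rule emeasure_mono)
  also have "\<dots> < \<infinity>"
    by (simp add: emeasure_leb_on_box[OF I] ennreal_power power_less_top_ennreal less_top)
  finally show ?thesis .
qed

text \<open>The difference of the balls contains a cube of positive measure; for empty \<open>I\<close> it is the whole
  one-point space.\<close>

lemma ball0_measure_strict_mono:
  assumes I: "finite I" and y: "y \<in> ball0 I s" "y \<notin> ball0 I r"
  shows "emeasure (leb_on I) (ball0 I r) < emeasure (leb_on I) (ball0 I s)"
proof -
  have ys: "y \<in> space (leb_on I)" "r \<le> L2_set y I" "L2_set y I < s"
    using y by (auto simp: ball0_def)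
  have s0: "0 < s" using ys(3) L2_set_nonneg[of y I] by linarith
  define r1 where "r1 = max r 0"
  have r1: "0 \<le> r1" "r \<le> r1" "r1 < s" using ys s0 by (auto simp: r1_def)
  obtain S where S: "S \<in> sets (leb_on I)" "S \<subseteq> ball0 I s" "S \<inter> ball0 I r = {}" "0 < emeasure (leb_on I) S"
  proof (cases "I = {}")
    case True
    have "emeasure (leb_on I) (space (leb_on I)) = 1"
      using True by (simp add: PiM_empty)
    then show ?thesis
      using ys True s0 by (intro that[of "space (leb_on I)"]) (auto simp: ball0_def)
  next
    case False
    define n where "n = real (card I)"
    have n: "0 < n" using False I by (simp add: n_def card_gt_0_iff)
    define \<alpha> where "\<alpha> = r1 / sqrt n"
    define \<gamma> where "\<gamma> = s / sqrt n"
    have ag: "0 \<le> \<alpha>" "\<alpha> < \<gamma>" "0 \<le> \<gamma>" using r1 n s0 by (auto simp: \<alpha>_def \<gamma>_def divide_strict_right_mono)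
    have const: "L2_set (\<lambda>_. c) I = c * sqrt n" if "0 \<le> c" for c
      using that by (simp add: L2_set_def n_def real_sqrt_mult mult.commute)
    let ?S = "Pi\<^sub>E I (\<lambda>_. {\<alpha><..<\<gamma>})"
    show ?thesis
    proof (rule that[of ?S])
      show "?S \<in> sets (leb_on I)" by (rule sets_PiM_I_finite[OF I]) simp
      have L: "r1 \<le> L2_set z I" "L2_set z I < s" if z: "z \<in> ?S" for z
      proof -
        have zi: "\<alpha> < z i" "z i < \<gamma>" if "i \<in> I" for i using z that by (auto simp: PiE_iff)
        have "L2_set (\<lambda>_. \<alpha>) I \<le> L2_set z I" using zi ag by (intro L2_set_mono) (auto intro: less_imp_le)
        then show "r1 \<le> L2_set z I" using n ag by (simp add: const) (simp add: \<alpha>_def)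
        have "0 \<le> z i" if "i \<in> I" for i using zi(1)[OF that] ag(1) by linarith
        then have "L2_set z I < L2_set (\<lambda>_. \<gamma>) I"
          using zi I False by (intro L2_set_strict_mono) auto
        then show "L2_set z I < s" using n ag by (simp add: const) (simp add: \<gamma>_def)
      qed
      show "?S \<subseteq> ball0 I s" using L(2) by (auto simp: ball0_def space_PiM PiE_iff)
      show "?S \<inter> ball0 I r = {}" using L(1) r1(2) by (force simp: ball0_def)
      show "0 < emeasure (leb_on I) ?S"
        using ag by (simp add: emeasure_leb_on_box[OF I] ennreal_power)
    qed
  qed
  have "emeasure (leb_on I) (ball0 I r) < emeasure (leb_on I) (ball0 I r) + emeasure (leb_on I) S"
    using S(4) ball0_finite_measure[OF I, of r]
    by (metis add.right_neutral ennreal_add_left_cancel_less infinity_ennreal_def less_irrefl)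
  also have "\<dots> = emeasure (leb_on I) (ball0 I r \<union> S)"
    using S by (intro plus_emeasure ball0_measurable I) auto
  also have "\<dots> \<le> emeasure (leb_on I) (ball0 I s)"
    using S r1 by (intro emeasure_mono ball0_measurable I) (auto simp: ball0_def)
  finally show ?thesis .
qed

lemma sym_set_ball0:
  assumes I: "finite I" shows "sym_set I (ball0 I r) = ball0 I r"
proof
  show "ball0 I r \<subseteq> sym_set I (ball0 I r)" unfolding sym_set_def by blast
  show "sym_set I (ball0 I r) \<subseteq> ball0 I r"
  proof
    fix y assume "y \<in> sym_set I (ball0 I r)"
    then obtain s where "y \<in> ball0 I s" "emeasure (leb_on I) (ball0 I s) = emeasure (leb_on I) (ball0 I r)"
      unfolding sym_set_def by auto
    then show "y \<in> ball0 I r" using ball0_measure_strict_mono[OF I, of y s r] by auto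
  qed
qed

text \<open>If all superlevel sets are balls, symmetrization does not change them, and they determine the
  function.\<close>

lemma schwarz_eq_self:
  assumes I: "finite I" and y: "y \<in> space (leb_on I)"
    and A: "\<And>t. 0 < t \<Longrightarrow> \<exists>r. {y \<in> space (leb_on I). t < f y} = ball0 I r"
  shows "schwarz I f y = f y"
proof -
  have "y \<in> sym_set I {y' \<in> space (leb_on I). t < f y'} \<longleftrightarrow> t < f y" if t: "0 < t" for t
  proof -
    obtain r where r: "{y \<in> space (leb_on I). t < f y} = ball0 I r" using A[OF t] by blast
    have "y \<in> sym_set I {y' \<in> space (leb_on I). t < f y'} \<longleftrightarrow> y \<in> {y' \<in> space (leb_on I). t < f y'}"
      unfolding r sym_set_ball0[OF I] ..
    then show ?thesis using y by simp
  qed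
  then have "schwarz I f y = Sup {t. 0 < t \<and> t < f y}"
    unfolding schwarz_def by (metis (no_types, lifting))
  also have "\<dots> = f y"
  proof (rule Sup_eqI)
    fix z assume z: "\<And>t. t \<in> {t. 0 < t \<and> t < f y} \<Longrightarrow> t \<le> z"
    show "f y \<le> z"
    proof (rule ccontr)
      assume "\<not> f y \<le> z"
      then obtain t where "z < t" "t < f y" using dense[of z "f y"] by (auto simp: not_le)
      moreover from this(1) have "0 < t" by (rule le_less_trans[OF zero_le])
      ultimately show False using z[of t] by auto
    qed
  qed auto
  finally show ?thesis .
qed

text \<open>The point with the coordinates of \<open>y\<close> in \<open>I\<close> and those of \<open>x\<close> elsewhere, as in \<open>schwarz_in\<close>.\<close>

definition insert_coords :: "'n set \<Rightarrow> real^'n \<Rightarrow> ('n \<Rightarrow> real) \<Rightarrow> real^'n::finite" where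
  "insert_coords I x y = (\<chi> i. if i \<in> I then y i else x $ i)"

lemma norm_insert_coords:
  "(norm (insert_coords I x y))\<^sup>2 = (L2_set y I)\<^sup>2 + (\<Sum>i\<in>-I. (x $ i)\<^sup>2)"
proof -
  have "(norm (insert_coords I x y))\<^sup>2 = (\<Sum>i\<in>I \<union> -I. (insert_coords I x y $ i)\<^sup>2)"
    by (simp add: norm_vec_def L2_set_def sum_nonneg)
  also have "\<dots> = (\<Sum>i\<in>I. (insert_coords I x y $ i)\<^sup>2) + (\<Sum>i\<in>-I. (insert_coords I x y $ i)\<^sup>2)"
    by (rule sum.union_disjoint) auto
  finally show ?thesis by (simp add: insert_coords_def L2_set_def sum_nonneg)
qed

text \<open>By monotonicity the superlevel set contains, with each point, all points closer to 0, so it is a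
  ball around 0 with the supremum of the norms as radius. The ball is open, because by continuity each
  point of the superlevel set can be moved a little away from 0 within the set.\<close>

lemma superlevel_set_is_ball0:
  fixes w :: "real^'n::finite \<Rightarrow> real" and t :: ennreal
  assumes L: "\<And>x y. \<bar>w x - w y\<bar> \<le> L * norm (x - y)" "0 \<le> L" and R: "\<And>x. norm x > R \<Longrightarrow> w x = 0"
    and mono: "\<And>a b. norm a < norm b \<Longrightarrow> (\<forall>i\<in>-I. a $ i = b $ i) \<Longrightarrow> w b \<le> w a"
    and t: "0 < t"
  shows "\<exists>r. {y \<in> space (leb_on I). t < ennreal (w (insert_coords I x y))} = ball0 I r" (is "\<exists>r. ?A = _")
proof (cases "?A = {} \<or> I = {}")
  case True
  then show ?thesis
  proof
    assume "?A = {}"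
    moreover have "ball0 I 0 = {}" using L2_set_nonneg by (auto simp: ball0_def not_less)
    ultimately show ?thesis by blast
  next
    assume I: "I = {}"
    have "space (leb_on I) = {\<lambda>_. undefined}" using I by (simp add: space_PiM)
    then have "?A = {} \<or> ?A = space (leb_on I)" by auto
    moreover have "ball0 I 0 = {}" "ball0 I 1 = space (leb_on I)" using I by (auto simp: ball0_def)
    ultimately show ?thesis by metis
  qed
next
  case False
  let ?e = "insert_coords I x"
  let ?r = "Sup ((\<lambda>y. L2_set y I) ` ?A)"
  have norm_mono: "norm (?e y) < norm (?e z)" if "L2_set y I < L2_set z I" for y z
  proof -
    have "(L2_set y I)\<^sup>2 < (L2_set z I)\<^sup>2" using that by (intro power_strict_mono) (auto simp: L2_set_nonneg)
    then have "(norm (?e y))\<^sup>2 < (norm (?e z))\<^sup>2" by (simp only: norm_insert_coords)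
    then show ?thesis by (rule power2_less_imp_less) simp
  qed
  have bdd: "bdd_above ((\<lambda>y. L2_set y I) ` ?A)"
  proof (rule bdd_aboveI2)
    fix y assume y: "y \<in> ?A"
    have "norm (?e y) \<le> R"
    proof (rule ccontr)
      assume "\<not> norm (?e y) \<le> R"
      then have "w (?e y) = 0" by (intro R) simp
      then show False using y t by simp
    qed
    moreover have "(L2_set y I)\<^sup>2 \<le> (norm (?e y))\<^sup>2" by (simp add: norm_insert_coords sum_nonneg)
    then have "L2_set y I \<le> norm (?e y)" by (rule power2_le_imp_le) simp
    ultimately show "L2_set y I \<le> R" by simp
  qed
  have "?A = ball0 I ?r"
  proof
    show "ball0 I ?r \<subseteq> ?A"
    proof
      fix y assume y: "y \<in> ball0 I ?r"
      then have "L2_set y I < ?r" by (simp add: ball0_def)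
      then obtain z where z: "z \<in> ?A" "L2_set y I < L2_set z I"
        using False bdd by (subst (asm) less_cSup_iff) auto
      have "w (?e z) \<le> w (?e y)"
        using norm_mono[OF z(2)] by (intro mono) (auto simp: insert_coords_def)
      then have "t < ennreal (w (?e y))" using z(1) by (auto intro: less_le_trans ennreal_leI)
      then show "y \<in> ?A" using y by (simp add: ball0_def)
    qed
    show "?A \<subseteq> ball0 I ?r"
    proof
      fix y assume y: "y \<in> ?A"
      obtain t0 where t0: "t = ennreal t0" "0 \<le> t0" using y by (cases t) auto
      then have gap: "t0 < w (?e y)" using y by (simp add: ennreal_less_iff)
      define n where "n = real CARD('n)"
      define s where "s = (w (?e y) - t0) / (2 * (L * n + 1))"
      have n: "0 < n" by (simp add: n_def)
      have den: "0 < L * n + 1" using L(2) n by (simp add: add_nonneg_pos)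
      have s: "0 < s" using gap den by (simp add: s_def)
      have Ls: "L * (n * s) < w (?e y) - t0"
      proof -
        have "L * (n * s) \<le> (L * n + 1) * s" using s by (simp add: algebra_simps)
        also have "\<dots> = (w (?e y) - t0) / 2" using den by (simp add: s_def field_simps)
        also have "\<dots> < w (?e y) - t0" using gap by simp
        finally show ?thesis .
      qed
      \<comment> \<open>All coordinates in \<open>I\<close> are moved away from 0 by \<open>s\<close>.\<close>
      define z where "z = (\<lambda>i\<in>I. y i + (if 0 \<le> y i then s else - s))"
      have "norm (?e z - ?e y) \<le> (\<Sum>i\<in>UNIV. \<bar>(?e z - ?e y) $ i\<bar>)" by (rule norm_le_l1_cart)
      also have "\<dots> \<le> (\<Sum>i\<in>(UNIV :: 'n set). s)"
        using s by (intro sum_mono) (auto simp: insert_coords_def z_def)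
      also have "\<dots> = n * s" by (simp add: n_def)
      finally have "L * norm (?e z - ?e y) \<le> L * (n * s)" by (intro mult_left_mono L)
      then have "t0 < w (?e z)" using L(1)[of "?e z" "?e y"] Ls by linarith
      then have zA: "z \<in> ?A" using t0 by (auto simp: ennreal_less_iff z_def space_PiM)
      have abs: "L2_set v I = L2_set (\<lambda>i. \<bar>v i\<bar>) I" for v :: "'n \<Rightarrow> real" by (simp add: L2_set_def)
      have "L2_set (\<lambda>i. \<bar>y i\<bar>) I < L2_set (\<lambda>i. \<bar>z i\<bar>) I"
        using False s by (intro L2_set_strict_mono) (auto simp: z_def)
      then have "L2_set y I < L2_set z I" by (simp only: abs[symmetric])
      also have "\<dots> \<le> ?r" using zA bdd by (intro cSup_upper) auto
      finally show "y \<in> ball0 I ?r" using y by (simp add: ball0_def)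
    qed
  qed
  then show ?thesis by blast
qed

lemma schwarz_in_eq_self:
  fixes w :: "real^'n::finite \<Rightarrow> real"
  assumes "\<And>x y. \<bar>w x - w y\<bar> \<le> L * norm (x - y)" "0 \<le> L" "\<And>x. norm x > R \<Longrightarrow> w x = 0"
    and "\<And>a b. norm a < norm b \<Longrightarrow> (\<forall>i\<in>-I. a $ i = b $ i) \<Longrightarrow> w b \<le> w a"
  shows "schwarz_in I (\<lambda>x. ennreal (w x)) = (\<lambda>x. ennreal (w x))"
proof
  fix x
  let ?f = "\<lambda>y. ennreal (w (insert_coords I x y))"
  have "schwarz_in I (\<lambda>x. ennreal (w x)) x = schwarz I ?f (\<lambda>i\<in>I. x $ i)"
    by (simp add: schwarz_in_def insert_coords_def)
  also have "\<dots> = ?f (\<lambda>i\<in>I. x $ i)"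
    by (rule schwarz_eq_self[OF _ _ superlevel_set_is_ball0[OF assms]]) (auto simp: space_PiM)
  also have "insert_coords I x (\<lambda>i\<in>I. x $ i) = x" by (simp add: insert_coords_def vec_eq_iff)
  finally show "schwarz_in I (\<lambda>x. ennreal (w x)) x = ennreal (w x)" .
qed

section \<open>Equality of the two infima\<close>

lemma nonlocal_energy_scale:
  fixes w :: "'a::euclidean_space \<Rightarrow> real"
  assumes [measurable]: "w \<in> borel_measurable borel" and c: "0 \<le> c"
  shows "nonlocal_energy p t (\<lambda>x. c * w x) = ennreal (c powr p) * nonlocal_energy p t w"
proof -
  have "(if norm (x - y) < t then \<bar>c * w x - c * w y\<bar> powr p else 0)
      = c powr p * (if norm (x - y) < t then \<bar>w x - w y\<bar> powr p else 0)" for x y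
    using c by (simp add: right_diff_distrib[symmetric] abs_mult powr_mult)
  then show ?thesis
    unfolding nonlocal_energy_def by (simp only: ennreal_mult' powr_ge_zero) (simp add: nn_integral_cmult)
qed

lemma weighted_integral_scale:
  fixes w :: "real^'n::finite \<Rightarrow> real"
  assumes [measurable]: "w \<in> borel_measurable borel" and c: "0 \<le> c"
  shows "weighted_integral K \<beta> q (\<lambda>x. c * w x) = ennreal (c powr q) * weighted_integral K \<beta> q w"
proof -
  have "\<bar>c * w x\<bar> powr q / L2_set (($) x) K powr \<beta> = c powr q * (\<bar>w x\<bar> powr q / L2_set (($) x) K powr \<beta>)" for x
    using c by (simp add: abs_mult powr_mult)
  then show ?thesis
    unfolding weighted_integral_def by (simp only: ennreal_mult' powr_ge_zero) (simp add: nn_integral_cmult)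
qed

text \<open>The symmetric competitor of an approximating test function, multiplied by the constant \<open>c\<close> that
  makes its weighted integral 1.\<close>

lemma symmetric_near_optimal:
  fixes K :: "'n::finite set" and u :: "real^'n \<Rightarrow> real"
  assumes K: "K \<noteq> {}" and \<beta>: "0 \<le> \<beta>" "\<beta> < real (card K)" and p: "1 < p" "p < real CARD('n)" and q: "0 < q"
    and u: "u \<in> D1p p" "weighted_integral K \<beta> q u = 1" and e: "0 < e" "e < 1"
  obtains v where "v \<in> D1p_star_star K p" "weighted_integral K \<beta> q v = 1"
    "dirichlet_energy p v \<le> ennreal ((1 - e) powr (- (p / q))) * (dirichlet_energy p u + ennreal e)"
proof -
  obtain \<phi> where \<phi>: "\<phi> \<in> test_functions"
    "Lp_power p (gradient \<phi>) \<le> dirichlet_energy p u + ennreal e"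
    "ennreal (1 - e) \<le> weighted_integral K \<beta> q \<phi>"
    by (rule test_approximation[OF u(1) p q u(2) e])
  obtain w L R where LR: "0 \<le> L" "0 \<le> R" and w: "\<And>x. 0 \<le> w x" "\<And>x y. \<bar>w x - w y\<bar> \<le> L * norm (x - y)"
    "\<And>x. norm x > R \<Longrightarrow> w x = 0" "\<And>t. 0 < t \<Longrightarrow> nonlocal_energy p t w \<le> nonlocal_energy p t \<phi>"
    "weighted_integral K \<beta> q \<phi> \<le> weighted_integral K \<beta> q w"
    "\<And>a b. norm a < norm b \<Longrightarrow> (\<forall>i\<in>K. a $ i = b $ i) \<or> (\<forall>i\<in>-K. a $ i = b $ i) \<Longrightarrow> w b \<le> w a"
    by (rule symmetric_competitor_exists[OF K \<beta> _ q \<phi>(1), of p]) (use p in auto)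
  have cont: "continuous_on UNIV w" by (rule Lipschitz_continuous[OF w(2) LR(1)])
  have wm: "w \<in> borel_measurable borel" by (rule borel_measurable_continuous_onI[OF cont])
  obtain B where B: "0 < B" "\<And>x. \<bar>w x\<bar> \<le> B"
    using bounded_continuous_bounded_support[OF cont w(3)] by (metis real_norm_def)
  have "weighted_integral K \<beta> q w < \<infinity>"
    by (rule weighted_integral_finite[OF K \<beta> _ LR(2) w(3) B(2)]) (use q B in auto)
  then obtain \<omega> where \<omega>: "0 \<le> \<omega>" "weighted_integral K \<beta> q w = ennreal \<omega>"
    by (cases "weighted_integral K \<beta> q w") auto
  have \<omega>e: "1 - e \<le> \<omega>"
    using order_trans[OF \<phi>(3) w(5)] \<omega> by (simp add: ennreal_le_iff)
  then have \<omega>0: "0 < \<omega>" using e by linarith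
  define c where "c = \<omega> powr (- (1 / q))"
  have c: "0 < c" using \<omega>0 by (simp add: c_def)
  have cq: "c powr q = 1 / \<omega>"
  proof -
    have "c powr q = \<omega> powr (- (1 / q) * q)" unfolding c_def by (rule powr_powr)
    also have "- (1 / q) * q = - 1" using q by simp
    finally show ?thesis using \<omega>0 by (simp add: powr_minus_divide)
  qed
  have cp: "c powr p \<le> (1 - e) powr (- (p / q))"
  proof -
    have "c powr p = \<omega> powr (- (p / q))" by (simp add: c_def powr_powr)
    also have "\<dots> \<le> (1 - e) powr (- (p / q))" using \<omega>e e p q by (intro powr_mono2') auto
    finally show ?thesis .
  qed
  define v where "v x = c * w x" for x
  have c\<phi>: "(\<lambda>x. c * \<phi> x) \<in> test_functions" by (rule test_scale[OF \<phi>(1)])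
  have vL: "\<bar>v x - v y\<bar> \<le> (c * L) * norm (x - y)" for x y
    using mult_left_mono[OF w(2)[of x y], of c] c by (simp add: v_def right_diff_distrib[symmetric] abs_mult mult.assoc)
  have v0: "v x = 0" if "norm x > R" for x using w(3)[OF that] by (simp add: v_def)
  have cL: "0 \<le> c * L" using c LR by simp
  have v_le: "nonlocal_energy p t v \<le> nonlocal_energy p t (\<lambda>x. c * \<phi> x)" if "0 < t" for t
    unfolding v_def[abs_def] using c
    by (simp add: nonlocal_energy_scale wm test_measurable[OF \<phi>(1)] mult_left_mono w(4)[OF that])
  note D = Lipschitz_in_D1p[OF p c\<phi> cL LR(2) vL v0 v_le]
  have mono: "v b \<le> v a" if "norm a < norm b" "(\<forall>i\<in>K. a $ i = b $ i) \<or> (\<forall>i\<in>-K. a $ i = b $ i)" for a b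
    using w(6)[OF that] c by (simp add: v_def)
  have "double_star K (\<lambda>x. ennreal (v x)) = (\<lambda>x. ennreal (v x))"
    unfolding double_star_def
    by (subst schwarz_in_eq_self[OF vL cL v0]) (auto intro: mono schwarz_in_eq_self[OF vL cL v0])
  then have "v \<in> D1p_star_star K p"
    using D(1) w(1) c by (simp add: D1p_star_star_def v_def)
  moreover have "weighted_integral K \<beta> q v = 1"
    unfolding v_def[abs_def] using c \<omega>0
    by (simp add: weighted_integral_scale[OF wm] cq \<omega>(2) ennreal_mult[symmetric])
  moreover have "dirichlet_energy p v \<le> ennreal ((1 - e) powr (- (p / q))) * (dirichlet_energy p u + ennreal e)"
  proof -
    have "dirichlet_energy p v \<le> Lp_power p (gradient (\<lambda>x. c * \<phi> x))" by (rule D(2))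
    also have "\<dots> = (\<integral>\<^sup>+x. ennreal (c powr p) * ennreal (norm (gradient \<phi> x) powr p) \<partial>lborel)"
      using c by (simp add: gradient_scale test_differentiable \<phi>(1) powr_mult ennreal_mult)
    also have "\<dots> = ennreal (c powr p) * Lp_power p (gradient \<phi>)"
      using test_gradient_measurable[OF \<phi>(1)] by (intro nn_integral_cmult) measurable
    also have "\<dots> \<le> ennreal ((1 - e) powr (- (p / q))) * (dirichlet_energy p u + ennreal e)"
      using cp \<phi>(2) by (intro mult_mono ennreal_leI) auto
    finally show ?thesis .
  qed
  ultimately show ?thesis by (rule that)
qed

theorem theorem3p1:
  fixes K :: "'n::finite set" and N k :: nat and p \<beta> q :: real
  assumes "CARD('n) = N" and "card K = k" and "1 \<le> k" and "k \<le> N"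
    and "1 < p" and "p < real N"
    and "0 \<le> \<beta>" and "\<beta> < real k" and "\<beta> \<le> p"
    and "q = p * (real N - \<beta>) / (real N - p)"
  shows "Inf {dirichlet_energy p u | u. u \<in> D1p p \<and> weighted_integral K \<beta> q u = 1}
       = Inf {dirichlet_energy p u | u. u \<in> D1p_star_star K p \<and> weighted_integral K \<beta> q u = 1}"
    (is "?S = ?T")
proof (rule antisym)
  show "?S \<le> ?T"
    by (rule Inf_superset_mono) (auto simp: D1p_star_star_def)
  have K: "K \<noteq> {}" using assms by auto
  have \<beta>: "0 \<le> \<beta>" "\<beta> < real (card K)" using assms by auto
  have p: "1 < p" "p < real CARD('n)" using assms by auto
  have "\<beta> < real N" using assms by linarith
  then have q: "0 < q" using assms by simp
  show "?T \<le> ?S"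
  proof (rule Inf_greatest)
    fix X assume "X \<in> {dirichlet_energy p u | u. u \<in> D1p p \<and> weighted_integral K \<beta> q u = 1}"
    then obtain u where X: "X = dirichlet_energy p u" and u: "u \<in> D1p p" "weighted_integral K \<beta> q u = 1" by blast
    have "X < \<infinity>" using u(1) by (simp add: X D1p_def dirichlet_energy_def)
    then obtain E where E: "0 \<le> E" "X = ennreal E" by (cases X) auto
    define e where "e n = inverse (real (Suc (Suc n)))" for n
    have e: "0 < e n" "e n < 1" for n by (auto simp: e_def divide_simps)
    have e0: "e \<longlonglongrightarrow> 0"
      unfolding e_def using LIMSEQ_Suc[OF LIMSEQ_inverse_real_of_nat] by simp
    have "?T \<le> ennreal ((1 - e n) powr (- (p / q)) * (E + e n))" for n
    proof -
      obtain v where "v \<in> D1p_star_star K p" "weighted_integral K \<beta> q v = 1"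
        "dirichlet_energy p v \<le> ennreal ((1 - e n) powr (- (p / q))) * (dirichlet_energy p u + ennreal (e n))"
        by (rule symmetric_near_optimal[OF K \<beta> p q u e])
      then have "?T \<le> ennreal ((1 - e n) powr (- (p / q))) * (dirichlet_energy p u + ennreal (e n))"
        by (intro Inf_lower2[of "dirichlet_energy p v"]) auto
      also have "\<dots> = ennreal ((1 - e n) powr (- (p / q)) * (E + e n))"
        using E e(1)[of n] by (simp add: X[symmetric] ennreal_mult[symmetric] ennreal_plus[symmetric] del: ennreal_plus)
      finally show ?thesis .
    qed
    moreover have "(\<lambda>n. ennreal ((1 - e n) powr (- (p / q)) * (E + e n))) \<longlonglongrightarrow> ennreal ((1 - 0) powr (- (p / q)) * (E + 0))"
      by (intro tendsto_ennrealI tendsto_intros e0) simp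
    ultimately have "?T \<le> ennreal ((1 - 0) powr (- (p / q)) * (E + 0))"
      by (intro LIMSEQ_le_const) auto
    then show "?T \<le> X" by (simp add: E(2))
  qed
qed

end
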